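(* Let $p$ be a probability density on $\mathbb{R}^d$, let $f:\mathbb{R}_+\to\mathbb{R}$, and let $(a,b)\in\mathbb{R}^2$. Let $k\in\mathbb{N}$ be fixed with $k>-2a$, and suppose that the estimator function $\phi_k$ of $f$ with parameter $k$ exists, is continuous, and satisfies $|\phi_k(u)|\le C\psi_{a,b}(u)$ for all $u>0$ and some constant $C$. If $p$ satisfies the property $\mathrm{U}(p;k,a)$ and the property $\mathrm{L}(p;\xi,b)$ with $\xi(t)=t^2$, then the estimator $\hat T_f^{(k)}$ is $L_2$-consistent, i.e., $$\lim_{m\to\infty}\mathbb{E}\Bigl[\bigl(\hat T_f^{(k)}(X_1,\ldots,X_m)-T_f(p)\bigr)^2\Bigr]=0.$$
   Context: $\mathrm{Leb}$ is Lebesgue measure on $\mathbb{R}^d$ with Euclidean norm $\|\cdot\|$; $B(x,r)=\{y:\|x-y\|<r\}$; $\upsilon(r)=\mathrm{Leb}(B(0,r))$ and $\varrho(v)$ is the radius of a ball of volume $v$ (the inverse of $\upsilon$). $P$ is the probability measure with density $p$, and $X_1,X_2,\ldots$ are i.i.d. with density $p$. For a finite set of points $A$, $r_k(x|A)$ is the distance from $x$ to its $k$-th nearest neighbor in $A$ (ties broken arbitrarily). Functional: $T_f(p)=\int f(p(x))p(x)\,dx$. Estimator function: $\phi_k(u)=\frac{\Gamma(k)}{u^{k-1}}\mathcal{L}^{-1}\{f(p)/p^k\}(u)$, where $\mathcal{L}^{-1}$ is the inverse of the one-sided Laplace transform; that is, $\phi_k:(0,\infty)\to\mathbb{R}$ is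 a function with $\int_0^\infty u^{k-1}\phi_k(u)e^{-su}\,du=\Gamma(k)f(s)/s^k$ for all $s>0$. Estimator: for $m\ge k+1$, $U_{km}(X_i)=(m-1)\,\mathrm{Leb}\bigl(B(X_i,r_k(X_i|\{X_j:j\ne i\}))\bigr)$ and $\hat T_f^{(k)}(X_1,\ldots,X_m)=\frac1m\sum_{i=1}^m\phi_k(U_{km}(X_i))$. Polynomial envelope: $\psi_{a,b}(u)=u^a$ for $0<u\le1$ and $\psi_{a,b}(u)=u^b$ for $u>1$. For $r>0$ let $M_rp(x)=\sup_{r'\in(0,r]}\frac{P(B(x,r'))}{\mathrm{Leb}(B(x,r'))}$ and $m_rp(x)=\inf_{r'\in(0,r]}\frac{P(B(x,r'))}{\mathrm{Leb}(B(x,r'))}$. Property $\mathrm{U}(p;k,a)$: either $a\ge0$, or $a<0$ and there exists $r>0$ with $\int p(x)(M_rp(x))^k\,dx<\infty$. Property $\mathrm{L}(p;\xi,b)$ (for a non-decreasing $\xi:\mathbb{R}_+\to\mathbb{R}_+$): either $b\le0$, or $b>0$ and there exists $r>0$ with $\int p(x)\,\xi\bigl((m_rp(x))^{-b}\bigr)dx<\infty$, and $$\limsup_{m\to\infty}\ \xi(m^b)\iint_{\|x-y\|>\varrho(\kappa_m/m)}p(x)p(y)\,\xi\bigl(\upsilon(\|x-y\|)^b\bigr)\,dx\,dy<\infty$$ for some sequence $\kappa_m$ with $\kappa_m/m\to\infty$ and $(\ln\kappa_m)/m\to0$ as $m\to\infty$. *)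

theory Defs
  imports "HOL-Probability.Probability"
begin

definition ball_vol :: "'a::euclidean_space itself \<Rightarrow> real \<Rightarrow> real" where
  "ball_vol _ r = measure lborel (ball (0::'a) r)"

definition ball_radius :: "'a::euclidean_space itself \<Rightarrow> real \<Rightarrow> real" where
  "ball_radius T = the_inv_into {0..} (ball_vol T)"

(* Distance from x to its k-th nearest neighbour in the finite set A (1 <= k <= card A):
   the k-th smallest element of the multiset of distances, so ties are counted with multiplicity. *)
definition nn_dist :: "nat \<Rightarrow> 'a::metric_space \<Rightarrow> 'a set \<Rightarrow> real" where
  "nn_dist k x A = sorted_list_of_multiset (image_mset (dist x) (mset_set A)) ! (k - 1)"

definition T_functional :: "(real \<Rightarrow> real) \<Rightarrow> ('a::euclidean_space \<Rightarrow> real) \<Rightarrow> real" where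
  "T_functional f p = (LINT x|lborel. f (p x) * p x)"

(* phi is the estimator function of f with parameter k; its values outside {0<..} are irrelevant. *)
definition estimator_function :: "(real \<Rightarrow> real) \<Rightarrow> nat \<Rightarrow> (real \<Rightarrow> real) \<Rightarrow> bool" where
  "estimator_function f k \<phi> \<longleftrightarrow>
     (\<forall>s>0. set_integrable lborel {0<..} (\<lambda>u. u ^ (k - 1) * \<phi> u * exp (- s * u)) \<and>
            (LINT u:{0<..}|lborel. u ^ (k - 1) * \<phi> u * exp (- s * u)) = Gamma (real k) * f s / s ^ k)"

(* The sample is x 1, ..., x m. *)
definition U_stat :: "nat \<Rightarrow> nat \<Rightarrow> (nat \<Rightarrow> 'a::euclidean_space) \<Rightarrow> nat \<Rightarrow> real" where
  "U_stat k m x i =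
     (real m - 1) * measure lborel (ball (x i) (nn_dist k (x i) (x ` ({1..m} - {i}))))"

definition T_estimator :: "(real \<Rightarrow> real) \<Rightarrow> nat \<Rightarrow> nat \<Rightarrow> (nat \<Rightarrow> 'a::euclidean_space) \<Rightarrow> real" where
  "T_estimator \<phi> k m x = (\<Sum>i\<in>{1..m}. \<phi> (U_stat k m x i)) / real m"

definition poly_envelope :: "real \<Rightarrow> real \<Rightarrow> real \<Rightarrow> real" where
  "poly_envelope a b u = (if u \<le> 1 then u powr a else u powr b)"

definition max_avg :: "('a::euclidean_space \<Rightarrow> real) \<Rightarrow> real \<Rightarrow> 'a \<Rightarrow> ennreal" where
  "max_avg p r x = (SUP r'\<in>{0<..r}.
     emeasure (density lborel (\<lambda>y. ennreal (p y))) (ball x r') / emeasure lborel (ball x r'))"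

definition min_avg :: "('a::euclidean_space \<Rightarrow> real) \<Rightarrow> real \<Rightarrow> 'a \<Rightarrow> ennreal" where
  "min_avg p r x = (INF r'\<in>{0<..r}.
     emeasure (density lborel (\<lambda>y. ennreal (p y))) (ball x r') / emeasure lborel (ball x r'))"

definition property_U :: "('a::euclidean_space \<Rightarrow> real) \<Rightarrow> nat \<Rightarrow> real \<Rightarrow> bool" where
  "property_U p k a \<longleftrightarrow> a \<ge> 0 \<or>
     (a < 0 \<and> (\<exists>r>0. (\<integral>\<^sup>+ x. ennreal (p x) * max_avg p r x ^ k \<partial>lborel) < \<infinity>))"

(* For b > 0, a vanishing min_avg gives min_avg to the power -b the value infinity; since
   0 powr (- b) = 0 this case is treated explicitly. min_avg is never infinite, so enn2real
   loses nothing. *)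
definition property_L ::
  "('a::euclidean_space \<Rightarrow> real) \<Rightarrow> (real \<Rightarrow> real) \<Rightarrow> real \<Rightarrow> bool" where
  "property_L p \<xi> b \<longleftrightarrow> b \<le> 0 \<or>
     (b > 0 \<and>
      (\<exists>r>0. (\<integral>\<^sup>+ x. ennreal (p x) *
                 (if min_avg p r x = 0 then \<infinity>
                  else ennreal (\<xi> (enn2real (min_avg p r x) powr (- b)))) \<partial>lborel) < \<infinity>) \<and>
      (\<exists>\<kappa> :: nat \<Rightarrow> real.
         filterlim (\<lambda>m. \<kappa> m / real m) at_top sequentially \<and>
         (\<lambda>m. ln (\<kappa> m) / real m) \<longlonglongrightarrow> 0 \<and>
         limsup (\<lambda>m. ennreal (\<xi> (real m powr b)) *
           (\<integral>\<^sup>+ y. (\<integral>\<^sup>+ x.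
              ennreal (p x * p y * \<xi> (ball_vol TYPE('a) (norm (x - y)) powr b)) *
              indicator {z. norm (z - y) > ball_radius TYPE('a) (\<kappa> m / real m)} x
            \<partial>lborel) \<partial>lborel)) < \<infinity>))"

end

theory Submission
  imports Defs "HOL-Real_Asymp.Real_Asymp"
begin

text \<open>
  The mean square error is controlled through truncation. For a threshold \<open>s\<close> the event that the
  normalized neighbour volume of a sample point exceeds \<open>s\<close> is a binomial tail event, and for two
  different points the two events decouple; Lebesgue differentiation and the Poisson limit then
  show that the fraction of points with volume above \<open>s\<close> converges in mean square to the tail of the
  mixture of the Gamma distributions with shape \<open>k\<close> and rates \<open>p x\<close>. Hence every step function in
  place of \<open>\<phi>\<close> is estimated consistently, and it remains to bound what \<open>\<phi>\<close> loses by truncation.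
  Small volumes are controlled by \<open>max_avg\<close>, and large ones whose \<open>k\<close>-th neighbour lies within a
  fixed radius by \<open>min_avg\<close>.

  Points whose \<open>k\<close>-th neighbour is farther away need care, because the second moment of \<open>\<phi>\<close> at such
  a point may be unbounded in \<open>m\<close>. The volume of the \<open>k\<close>-th neighbour ball is at most the average
  over the sample points outside it, which bounds the diagonal terms by
  \<open>m powr (2 * b - 1)\<close> times a vanishing quantity (if \<open>2 * b > 1\<close>, ball probabilities are
  even bounded below), while in the off-diagonal terms both points have to be isolated
  simultaneously, which is rare enough.
\<close>

section \<open>Binomial and trinomial lower tails\<close>

text \<open>Two facts shape the argument. Multiplied by s^k / Gamma(k), the Laplace equation says
  that phi has mean f(s) under the Gamma law with shape k and rate s; averaging over s = p(x) turns
  the mean of phi under the mixture into T_f(p). And P(U <= s) is bounded by a multiple of s^k near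
  0 when a < 0, so the square of u^a is integrable there because k + 2a > 0. The obstacle is distant
  neighbours. With q(x) the probability of a ball of fixed radius around x, isolation costs about
  exp(- m q(x) / 2), but q may come arbitrarily close to 0 while the second moment carries m^(2b).
  For two isolated points the exponential splits: the factor at the second point absorbs m^(2b), as
  t^(2b) exp(- t) is bounded and q^(- 2b) is integrable, and the factor at the first point sends the
  rest to 0. A single isolated point offers one factor only. There the weight 1 / m of the diagonal
  suffices for 2b <= 1; beyond that, integrability of the minimal average to the power - 2b is
  itself strong enough to keep q away from 0.\<close>

fun binomial_below :: "nat \<Rightarrow> nat \<Rightarrow> real \<Rightarrow> real" where
  "binomial_below n 0 q = 0"
| "binomial_below 0 (Suc k) q = 1"
| "binomial_below (Suc n) (Suc k) q =
     (1 - q) * binomial_below n (Suc k) q + q * binomial_below n k q"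

text \<open>Law of two counters: a trial falls into one of two disjoint classes of probabilities
  \<open>q\<close> and \<open>q'\<close>, and fewer than \<open>k\<close> resp. \<open>l\<close>
  trials do so. As in \<open>binomial_below\<close>, the recursion conditions on one trial, which is
  how sample points are integrated out later.\<close>

fun trinomial_below :: "nat \<Rightarrow> nat \<Rightarrow> nat \<Rightarrow> real \<Rightarrow> real \<Rightarrow> real" where
  "trinomial_below n 0 l q q' = 0"
| "trinomial_below n (Suc k) 0 q q' = 0"
| "trinomial_below 0 (Suc k) (Suc l) q q' = 1"
| "trinomial_below (Suc n) (Suc k) (Suc l) q q' =
     (1 - q - q') * trinomial_below n (Suc k) (Suc l) q q'
     + q * trinomial_below n k (Suc l) q q' + q' * trinomial_below n (Suc k) l q q'"

lemma trinomial_below_0 [simp]: "trinomial_below n k 0 q q' = 0"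
  by (cases k) auto

lemma binomial_below_bounds:
  assumes "0 \<le> q" "q \<le> 1"
  shows "0 \<le> binomial_below n k q \<and> binomial_below n k q \<le> 1"
  using assms
proof (induction n k q rule: binomial_below.induct)
  case (3 n k q)
  then show ?case
    using convex_bound_le[of "binomial_below n (Suc k) q" 1 "binomial_below n k q" "1 - q" q] by auto
qed auto

lemma trinomial_below_bounds:
  assumes "0 \<le> q" "0 \<le> q'" "q + q' \<le> 1"
  shows "0 \<le> trinomial_below n k l q q' \<and> trinomial_below n k l q q' \<le> 1"
  using assms
proof (induction n k l q q' rule: trinomial_below.induct)
  case (4 n k l q q')
  have "(1 - q - q') * trinomial_below n (Suc k) (Suc l) q q'
     + q * trinomial_below n k (Suc l) q q' + q' * trinomial_below n (Suc k) l q q'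
     \<le> (1 - q - q') * 1 + q * 1 + q' * 1"
    using 4 by (intro add_mono mult_left_mono) auto
  with 4 show ?case by auto
qed auto

text \<open>The product of the two binomial recursions is the trinomial recursion up to
  \<open>q * q'\<close> times a factor of modulus at most 1, since independent trials may succeed
  together while disjoint classes exclude each other. Each trial adds at most this error and convex
  combinations do not enlarge the earlier ones, hence the factor \<open>n\<close>.\<close>

lemma trinomial_below_near_product:
  assumes "0 \<le> q" "0 \<le> q'" "q + q' \<le> 1"
  shows "\<bar>trinomial_below n k l q q' - binomial_below n k q * binomial_below n l q'\<bar>
    \<le> real n * (q * q')"
  using assms
proof (induction n k l q q' rule: trinomial_below.induct)
  case (4 n k l q q')
  define a a' b b' where "a = binomial_below n (Suc k) q" and "a' = binomial_below n k q"
    and "b = binomial_below n (Suc l) q'" and "b' = binomial_below n l q'"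
  define x y z where "x = trinomial_below n (Suc k) (Suc l) q q' - a * b"
    and "y = trinomial_below n k (Suc l) q q' - a' * b"
    and "z = trinomial_below n (Suc k) l q q' - a * b'"
  have ih: "\<bar>x\<bar> \<le> n * (q * q')" "\<bar>y\<bar> \<le> n * (q * q')" "\<bar>z\<bar> \<le> n * (q * q')"
    using 4 by (auto simp: x_def y_def z_def a_def b_def a'_def b'_def)
  have "0 \<le> a \<and> a \<le> 1" "0 \<le> a' \<and> a' \<le> 1" "0 \<le> b \<and> b \<le> 1" "0 \<le> b' \<and> b' \<le> 1"
    using 4 by (auto simp: a_def a'_def b_def b'_def binomial_below_bounds)
  then have w: "\<bar>(a - a') * (b - b')\<bar> \<le> 1"
    by (auto simp: abs_mult intro!: mult_le_one)
  have "trinomial_below (Suc n) (Suc k) (Suc l) q q'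
      - binomial_below (Suc n) (Suc k) q * binomial_below (Suc n) (Suc l) q'
    = (1 - q - q') * x + q * y + q' * z - (q * q') * ((a - a') * (b - b'))"
    by (simp add: x_def y_def z_def a_def b_def a'_def b'_def algebra_simps)
  also have "\<bar>\<dots>\<bar> \<le> \<bar>(1 - q - q') * x\<bar> + \<bar>q * y\<bar> + \<bar>q' * z\<bar> + \<bar>(q * q') * ((a - a') * (b - b'))\<bar>"
    by linarith
  also have "\<dots> = (1 - q - q') * \<bar>x\<bar> + q * \<bar>y\<bar> + q' * \<bar>z\<bar> + (q * q') * \<bar>(a - a') * (b - b')\<bar>"
    using 4 by (simp add: abs_mult)
  also have "\<dots> \<le> (1 - q - q') * (n * (q * q')) + q * (n * (q * q')) + q' * (n * (q * q')) + (q * q') * 1"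
    using 4 ih w by (intro add_mono mult_left_mono) auto
  also have "\<dots> = real (Suc n) * (q * q')"
    by (simp add: algebra_simps)
  finally show ?case .
qed auto

text \<open>Chernoff bound with base 2: for a binomial count N the indicator of N < k is at most
  2^(k - N), and the mean of 2^(- N) is (1 - q / 2)^n. The induction proves that form; 1 - x <=
  exp(- x) does the rest.\<close>

lemma binomial_below_le_exp:
  assumes "0 \<le> q" "q \<le> 1"
  shows "binomial_below n k q \<le> 2 ^ k * exp (- (real n * q / 2))"
proof -
  have "binomial_below n k q \<le> 2 ^ k * (1 - q / 2) ^ n"
    using assms
  proof (induction n k q rule: binomial_below.induct)
    case (3 n k q)
    have "binomial_below (Suc n) (Suc k) q
        \<le> (1 - q) * (2 ^ Suc k * (1 - q / 2) ^ n) + q * (2 ^ k * (1 - q / 2) ^ n)"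
      using 3 by (auto intro!: add_mono mult_left_mono)
    also have "\<dots> = 2 ^ Suc k * (1 - q / 2) ^ Suc n"
      by (simp add: algebra_simps)
    finally show ?case .
  next
    case (2 k q)
    then show ?case
      using one_le_power[of "2::real" k] by (simp del: one_le_power)
  qed auto
  also have "(1 - q / 2) ^ n \<le> exp (- (q / 2)) ^ n"
    using assms exp_ge_add_one_self[of "- (q / 2)"] by (intro power_mono) auto
  finally show ?thesis
    by (simp add: exp_of_nat_mult[symmetric])
qed

text \<open>In substance a union bound: \<open>k\<close> successes need \<open>k\<close> trials that
  all succeed, and there are at most n^k choices of them.\<close>

lemma binomial_below_ge:
  assumes "0 \<le> q" "q \<le> 1"
  shows "1 - binomial_below n k q \<le> (real n * q) ^ k"
  using assms
proof (induction n k q rule: binomial_below.induct)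
  case (3 n k q)
  have b: "0 \<le> 1 - binomial_below n (Suc k) q"
    using 3 binomial_below_bounds[of q n "Suc k"] by simp
  have b': "binomial_below n k q \<le> 1"
    using 3 binomial_below_bounds[of q n k] by simp
  have "1 - binomial_below (Suc n) (Suc k) q
      = (1 - q) * (1 - binomial_below n (Suc k) q) + q * (1 - binomial_below n k q)"
    by (simp add: algebra_simps)
  also have "\<dots> \<le> 1 * (n * q) ^ Suc k + q * (n * q) ^ k"
    using 3 b b' by (intro add_mono mult_mono) auto
  also have "\<dots> = q * (n + 1) * (n * q) ^ k"
    by (simp add: algebra_simps)
  also have "\<dots> \<le> q * (n + 1) * ((n + 1) * q) ^ k"
    using 3 by (intro mult_left_mono power_mono mult_right_mono) auto
  also have "\<dots> = (real (Suc n) * q) ^ Suc k"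
    by (simp add: algebra_simps)
  finally show ?case .
qed auto

lemma binomial_below_eq_sum:
  "binomial_below n k q = (\<Sum>i<k. real (n choose i) * q ^ i * (1 - q) ^ (n - i))"
proof (induction n k q rule: binomial_below.induct)
  case (2 k q)
  have "(\<Sum>i<Suc k. real (0 choose i) * q ^ i * (1 - q) ^ (0 - i)) =
        (\<Sum>i<Suc k. if i = 0 then 1 else 0)"
    by (intro sum.cong) (auto simp: binomial_eq_0)
  then show ?case by simp
next
  case (3 n k q)
  let ?t = "\<lambda>n i. real (n choose i) * q ^ i * (1 - q) ^ (n - i)"
  have pascal: "?t (Suc n) (Suc i) = (1 - q) * ?t n (Suc i) + q * ?t n i" for i
  proof (cases "Suc i \<le> n")
    case True
    then have "n - i = Suc (n - Suc i)" by auto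
    then show ?thesis by (simp add: algebra_simps)
  next
    case False
    then show ?thesis by (simp add: binomial_eq_0)
  qed
  have "(\<Sum>i<Suc k. ?t (Suc n) i) = (1 - q) * ?t n 0 + (\<Sum>i<k. (1 - q) * ?t n (Suc i) + q * ?t n i)"
    by (subst sum.lessThan_Suc_shift) (simp only: pascal, simp)
  also have "\<dots> = (1 - q) * (\<Sum>i<Suc k. ?t n i) + q * (\<Sum>i<k. ?t n i)"
    by (simp only: sum.lessThan_Suc_shift[of _ k] sum.distrib sum_distrib_left[symmetric] distrib_left add.assoc)
  finally show ?case using 3 by simp
qed auto

section \<open>Poisson limit of the binomial lower tail\<close>

lemma tendsto_one_minus_power:
  fixes q :: "nat \<Rightarrow> real"
  assumes N: "filterlim N at_top sequentially"
    and l: "(\<lambda>n. real (N n) * q n) \<longlonglongrightarrow> c"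
  shows "q \<longlonglongrightarrow> 0" "(\<lambda>n. (1 - q n) ^ N n) \<longlonglongrightarrow> exp (- c)"
proof -
  have rN: "filterlim (\<lambda>n. real (N n)) at_top sequentially"
    using N filterlim_compose filterlim_real_sequentially by blast
  have "(\<lambda>n. (real (N n) * q n) / real (N n)) \<longlonglongrightarrow> 0"
    by (rule real_tendsto_divide_at_top[OF l rN])
  moreover have "\<forall>\<^sub>F n in sequentially. N n > 0"
    using filterlim_at_top_dense[THEN iffD1, OF rN] by (auto elim!: allE[of _ 0])
  ultimately show q0: "q \<longlonglongrightarrow> 0"
    by (rule Lim_transform_eventually[OF _ eventually_mono]) auto
  \<comment> \<open>The value 1 at 0 makes \<open>g\<close> continuous there, so (1 - q)^N = exp(- N
    q g(q)) holds for every q < 1, the case q = 0 included.\<close>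
  define g :: "real \<Rightarrow> real" where "g = (\<lambda>x. if x = 0 then 1 else - ln (1 - x) / x)"
  have "((\<lambda>x. - ln (1 - x) / x) \<longlongrightarrow> 1) (at (0::real))"
    by real_asymp
  then have "isCont g 0"
    unfolding isCont_def g_def
    by (subst tendsto_cong[where g="\<lambda>x. - ln (1 - x) / x"]) (auto simp: eventually_at_filter)
  then have g1: "(\<lambda>n. g (q n)) \<longlonglongrightarrow> 1"
    using q0 isCont_tendsto_compose[of 0 g q] by (simp add: g_def)
  have "(\<lambda>n. exp (- (real (N n) * q n * g (q n)))) \<longlonglongrightarrow> exp (- (c * 1))"
    by (intro tendsto_intros l g1)
  moreover have "\<forall>\<^sub>F n in sequentially. q n < 1"
    using q0 by (rule order_tendstoD) auto
  then have "\<forall>\<^sub>F n in sequentially. exp (- (real (N n) * q n * g (q n))) = (1 - q n) ^ N n"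
  proof eventually_elim
    case (elim n)
    then have "exp (- (real (N n) * q n * g (q n))) = exp (real (N n) * ln (1 - q n))"
      by (simp add: g_def)
    then show ?case
      using elim by (simp add: exp_of_nat_mult)
  qed
  ultimately show "(\<lambda>n. (1 - q n) ^ N n) \<longlonglongrightarrow> exp (- c)"
    by (auto intro: Lim_transform_eventually)
qed

lemma binomial_below_poisson_limit:
  fixes q :: "nat \<Rightarrow> real"
  assumes N: "filterlim N at_top sequentially"
    and l: "(\<lambda>n. real (N n) * q n) \<longlonglongrightarrow> c"
  shows "(\<lambda>n. binomial_below (N n) k (q n)) \<longlonglongrightarrow> (\<Sum>i<k. c ^ i * exp (- c) / fact i)"
  unfolding binomial_below_eq_sum
proof (intro tendsto_sum)
  fix i
  note q0 = tendsto_one_minus_power(1)[OF N l] and qe = tendsto_one_minus_power(2)[OF N l]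
  \<comment> \<open>The powers of \<open>q n\<close> are distributed over the factors of the falling
    factorial, so that each factor (N - j) q converges to c separately.\<close>
  have lim: "(\<lambda>n. (\<Prod>j<i. real (N n) * q n - real j * q n) / fact i * ((1 - q n) ^ N n / (1 - q n) ^ i))
     \<longlonglongrightarrow> (\<Prod>j<i. c - real j * 0) / fact i * (exp (- c) / (1 - 0) ^ i)"
    by (intro tendsto_intros l q0 qe) auto
  have "\<forall>\<^sub>F n in sequentially. N n \<ge> i"
    using N by (simp add: filterlim_at_top)
  moreover have "\<forall>\<^sub>F n in sequentially. q n < 1"
    using q0 by (rule order_tendstoD) auto
  ultimately have ev: "\<forall>\<^sub>F n in sequentially.
      (\<Prod>j<i. real (N n) * q n - real j * q n) / fact i * ((1 - q n) ^ N n / (1 - q n) ^ i)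
      = real (N n choose i) * q n ^ i * (1 - q n) ^ (N n - i)"
  proof eventually_elim
    case (elim n)
    have "real (N n choose i) = (\<Prod>j<i. real (N n) - real j) / fact i"
      by (simp add: binomial_gbinomial gbinomial_prod_rev atLeast0LessThan)
    moreover have "(\<Prod>j<i. real (N n) * q n - real j * q n) = (\<Prod>j<i. real (N n) - real j) * q n ^ i"
      by (simp add: left_diff_distrib[symmetric] prod.distrib)
    ultimately show ?case
      using elim by (simp add: power_diff)
  qed
  then show "(\<lambda>n. real (N n choose i) * q n ^ i * (1 - q n) ^ (N n - i)) \<longlonglongrightarrow> c ^ i * exp (- c) / fact i"
    using Lim_transform_eventually[OF lim ev] by simp
qed

lemma binomial_below_measurable [measurable]:
  "f \<in> borel_measurable M \<Longrightarrow> (\<lambda>x. binomial_below n k (f x)) \<in> borel_measurable M"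
  unfolding binomial_below_eq_sum
  by (intro borel_measurable_sum borel_measurable_times borel_measurable_power borel_measurable_diff) auto

lemma trinomial_below_measurable [measurable]:
  assumes [measurable]: "f \<in> borel_measurable M" "g \<in> borel_measurable M"
  shows "(\<lambda>x. trinomial_below n k l (f x) (g x)) \<in> borel_measurable M"
proof (induction n arbitrary: k l)
  case 0
  show ?case by (cases k; cases l) auto
next
  case (Suc n)
  note [measurable] = Suc
  show ?case by (cases k; cases l) auto
qed

section \<open>Samples and nearest neighbours\<close>

locale iid_sample = prob_space D for D :: "'a measure"
begin

abbreviation sample :: "'i set \<Rightarrow> ('i \<Rightarrow> 'a) measure" where
  "sample J \<equiv> Pi\<^sub>M J (\<lambda>_. D)"

lemma prob_space_sample: "prob_space (sample J)"
  by (intro prob_space_PiM prob_space_axioms)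

lemma nn_integral_sample_insert:
  fixes f :: "('i \<Rightarrow> 'a) \<Rightarrow> ennreal"
  assumes "finite J" "i \<notin> J" "f \<in> borel_measurable (sample (insert i J))"
  shows "(\<integral>\<^sup>+w. f w \<partial>sample (insert i J)) = (\<integral>\<^sup>+x. \<integral>\<^sup>+w. f (w(i := x)) \<partial>sample J \<partial>D)"
proof -
  interpret product_sigma_finite "\<lambda>_. D"
    by unfold_locales
  show ?thesis
    using assms by (rule product_nn_integral_insert_rev)
qed

lemma measurable_card_sample:
  assumes "finite J" "\<And>j. j \<in> J \<Longrightarrow> Measurable.pred N (\<lambda>w. P w j)"
  shows "(\<lambda>w. card {j\<in>J. P w j}) \<in> measurable N (count_space UNIV)"
  using assms
proof (induction J)
  case (insert i J)
  note [measurable] = insert.prems[of i, simplified] insert.IH[OF insert.prems, simplified]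
  have "card {j\<in>insert i J. P w j} = (if P w i then Suc (card {j\<in>J. P w j}) else card {j\<in>J. P w j})" for w
  proof -
    have "{j\<in>insert i J. P w j} = (if P w i then {i} else {}) \<union> {j\<in>J. P w j}"
      by auto
    then show ?thesis
      using insert(1,2) by auto
  qed
  then have "(\<lambda>w. card {j\<in>insert i J. P w j})
      = (\<lambda>w. if P w i then Suc (card {j\<in>J. P w j}) else card {j\<in>J. P w j})"
    by auto
  then show ?case
    by simp
qed simp

text \<open>Integrating out one point splits on whether it hits \<open>A\<close>; the two cases are
  the two summands in the recursion of \<open>binomial_below\<close>.\<close>

lemma nn_integral_count_below:
  fixes J :: "'i set"
  assumes "finite J" and A[measurable]: "A \<in> sets D"
  shows "(\<integral>\<^sup>+w. of_bool (card {j\<in>J. w j \<in> A} < k) \<partial>sample J)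
    = ennreal (binomial_below (card J) k (measure D A))"
  using assms(1)
proof (induction J arbitrary: k)
  case empty
  show ?case by (cases k) (auto simp: PiM_empty)
next
  case (insert i J)
  let ?q = "measure D A"
  have [measurable]: "(\<lambda>w. card {j\<in>insert i J. w j \<in> A}) \<in> measurable (sample (insert i J)) (count_space UNIV)"
    using insert(1) by (intro measurable_card_sample) measurable
  have [measurable]: "(\<lambda>w. card {j\<in>J. w j \<in> A}) \<in> measurable (sample J) (count_space UNIV)"
    using insert(1) by (intro measurable_card_sample) measurable
  have c: "card {j\<in>insert i J. (w(i := x)) j \<in> A} = (if x \<in> A then 1 else 0) + card {j\<in>J. w j \<in> A}" for w x
  proof -
    have "{j\<in>insert i J. (w(i := x)) j \<in> A} = (if x \<in> A then {i} else {}) \<union> {j\<in>J. w j \<in> A}"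
      using insert by auto
    then show ?thesis
      using insert by (auto simp: card_insert_if)
  qed
  show ?case
  proof (cases k)
    case 0
    then show ?thesis by simp
  next
    case (Suc l)
    have "(\<integral>\<^sup>+w. of_bool (card {j\<in>insert i J. w j \<in> A} < k) \<partial>sample (insert i J))
      = (\<integral>\<^sup>+x. \<integral>\<^sup>+w. of_bool ((if x \<in> A then 1 else 0) + card {j\<in>J. w j \<in> A} < k) \<partial>sample J \<partial>D)"
      using insert(1,2) by (subst nn_integral_sample_insert) (simp_all only: c, measurable)
    also have "\<dots> = (\<integral>\<^sup>+x. ennreal (binomial_below (card J) l ?q) * indicator A x
        + ennreal (binomial_below (card J) k ?q) * indicator (space D - A) x \<partial>D)"
      using insert.IH[of l] insert.IH[of k] 
      by (intro nn_integral_cong) (simp add: Suc split: split_indicator)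
    also have "\<dots> = ennreal (binomial_below (card J) l ?q) * ennreal ?q
        + ennreal (binomial_below (card J) k ?q) * ennreal (1 - ?q)"
      by (subst nn_integral_add) (auto simp: nn_integral_cmult_indicator emeasure_eq_measure prob_compl)
    also have "\<dots> = ennreal (binomial_below (card J) l ?q * ?q + binomial_below (card J) k ?q * (1 - ?q))"
      using binomial_below_bounds[of ?q] by (simp add: ennreal_mult)
    also have "\<dots> = ennreal (binomial_below (card (insert i J)) k ?q)"
      using insert by (simp add: Suc mult.commute add.commute)
    finally show ?thesis .
  qed
qed

text \<open>By disjointness the point that is integrated out lies in \<open>A\<close>, in
  \<open>B\<close> or in neither, matching the three summands of
  \<open>trinomial_below\<close>.\<close>

lemma nn_integral_count2_below:
  fixes J :: "'i set"
  assumes "finite J" and A[measurable]: "A \<in> sets D" and B[measurable]: "B \<in> sets D" and AB: "A \<inter> B = {}"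
  shows "(\<integral>\<^sup>+w. of_bool (card {j\<in>J. w j \<in> A} < k \<and> card {j\<in>J. w j \<in> B} < l) \<partial>sample J)
    = ennreal (trinomial_below (card J) k l (measure D A) (measure D B))"
  using assms(1)
proof (induction J arbitrary: k l)
  case empty
  show ?case by (cases k; cases l) (auto simp: PiM_empty)
next
  case (insert i J)
  let ?q = "measure D A" and ?q' = "measure D B"
  have [measurable]: "(\<lambda>w. card {j\<in>insert i J. w j \<in> S}) \<in> measurable (sample (insert i J)) (count_space UNIV)"
    if [measurable]: "S \<in> sets D" for S
    using insert(1) by (intro measurable_card_sample) measurable
  have [measurable]: "(\<lambda>w. card {j\<in>J. w j \<in> S}) \<in> measurable (sample J) (count_space UNIV)"
    if [measurable]: "S \<in> sets D" for S
    using insert(1) by (intro measurable_card_sample) measurable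
  have c: "card {j\<in>insert i J. (w(i := x)) j \<in> S} = (if x \<in> S then 1 else 0) + card {j\<in>J. w j \<in> S}" for w x S
  proof -
    have "{j\<in>insert i J. (w(i := x)) j \<in> S} = (if x \<in> S then {i} else {}) \<union> {j\<in>J. w j \<in> S}"
      using insert by auto
    then show ?thesis
      using insert by (auto simp: card_insert_if)
  qed
  have qq: "?q + ?q' \<le> 1"
    using finite_measure_Union[OF A B AB] prob_le_1[of "A \<union> B"] by simp
  show ?case
  proof (cases "k = 0 \<or> l = 0")
    case True
    then show ?thesis by auto
  next
    case False
    then obtain k' l' where Suc: "k = Suc k'" "l = Suc l'"
      by (cases k; cases l) auto
    let ?t = "\<lambda>k l. trinomial_below (card J) k l ?q ?q'"
    have "(\<integral>\<^sup>+w. of_bool (card {j\<in>insert i J. w j \<in> A} < k \<and> card {j\<in>insert i J. w j \<in> B} < l) \<partial>sample (insert i J))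
      = (\<integral>\<^sup>+x. \<integral>\<^sup>+w. of_bool ((if x \<in> A then 1 else 0) + card {j\<in>J. w j \<in> A} < k \<and>
             (if x \<in> B then 1 else 0) + card {j\<in>J. w j \<in> B} < l) \<partial>sample J \<partial>D)"
      using insert(1,2) by (subst nn_integral_sample_insert) (simp_all only: c, measurable)
    also have "\<dots> = (\<integral>\<^sup>+x. ennreal (?t k' l) * indicator A x
        + (ennreal (?t k l') * indicator B x + ennreal (?t k l) * indicator (space D - (A \<union> B)) x) \<partial>D)"
      using insert.IH[of k' l] insert.IH[of k l'] insert.IH[of k l] disjoint_iff[THEN iffD1, OF AB]
      by (intro nn_integral_cong) (auto simp: Suc split: split_indicator)
    also have "\<dots> = ennreal (?t k' l) * ennreal ?q + (ennreal (?t k l') * ennreal ?q'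
        + ennreal (?t k l) * ennreal (1 - ?q - ?q'))"
      using finite_measure_Union[OF A B AB]
      by (subst nn_integral_add, simp, simp)
         (subst nn_integral_add, auto simp: nn_integral_cmult_indicator emeasure_eq_measure prob_compl diff_diff_eq)
    also have "\<dots> = ennreal (?t k' l * ?q + (?t k l' * ?q' + ?t k l * (1 - ?q - ?q')))"
      using trinomial_below_bounds[of ?q ?q'] qq by (simp add: ennreal_mult)
    also have "\<dots> = ennreal (trinomial_below (card (insert i J)) k l ?q ?q')"
      using insert by (simp add: Suc mult.commute add_ac)
    finally show ?thesis .
  qed
qed

end

section \<open>Order statistics and nearest-neighbour radii\<close>

definition kth_smallest :: "nat \<Rightarrow> 'i set \<Rightarrow> ('i \<Rightarrow> real) \<Rightarrow> real" where
  "kth_smallest k J d = Min ((\<lambda>S. Max (d ` S)) ` {S. S \<subseteq> J \<and> card S = k})"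

text \<open>A minimum over \<open>k\<close>-element index sets of a maximum is at most
  \<open>t\<close> exactly when some \<open>k\<close> indices have values at most \<open>t\<close>.
  Working with indices counts ties with multiplicity and needs no sorting.\<close>

lemma kth_smallest_le_iff:
  assumes J: "finite J" and k: "1 \<le> k" "k \<le> card J"
  shows "kth_smallest k J d \<le> t \<longleftrightarrow> k \<le> card {j\<in>J. d j \<le> t}"
proof -
  let ?F = "{S. S \<subseteq> J \<and> card S = k}"
  have fin: "finite ?F" using J by auto
  obtain S0 where "S0 \<subseteq> J" "card S0 = k"
    using k(2) by (rule obtain_subset_with_card_n)
  then have ne: "?F \<noteq> {}" by blast
  then have ne': "(\<lambda>S. Max (d ` S)) ` ?F \<noteq> {}" by blast
  have "kth_smallest k J d \<le> t \<longleftrightarrow> (\<exists>S\<in>?F. Max (d ` S) \<le> t)"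
    unfolding kth_smallest_def Min_le_iff[OF finite_imageI[OF fin] ne']
    by blast
  also have "\<dots> \<longleftrightarrow> (\<exists>S\<in>?F. \<forall>j\<in>S. d j \<le> t)"
  proof (intro bex_cong refl)
    fix S assume "S \<in> ?F"
    then have "finite S" "S \<noteq> {}" using J k by (auto intro: finite_subset)
    then show "Max (d ` S) \<le> t \<longleftrightarrow> (\<forall>j\<in>S. d j \<le> t)" by simp
  qed
  also have "\<dots> \<longleftrightarrow> k \<le> card {j\<in>J. d j \<le> t}"
  proof
    assume "\<exists>S\<in>?F. \<forall>j\<in>S. d j \<le> t"
    then obtain S where S: "S \<subseteq> {j\<in>J. d j \<le> t}" "card S = k" by blast
    have "card S \<le> card {j\<in>J. d j \<le> t}"
      by (rule card_mono[OF _ S(1)]) (use J in simp)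
    with S(2) show "k \<le> card {j\<in>J. d j \<le> t}" by simp
  next
    assume "k \<le> card {j\<in>J. d j \<le> t}"
    then obtain S where "S \<subseteq> {j\<in>J. d j \<le> t}" "card S = k"
      by (rule obtain_subset_with_card_n) blast
    then show "\<exists>S\<in>?F. \<forall>j\<in>S. d j \<le> t" by (intro bexI[of _ S]) auto
  qed
  finally show ?thesis .
qed

lemma kth_smallest_attained:
  assumes J: "finite J" and k: "1 \<le> k" "k \<le> card J"
  shows "\<exists>j\<in>J. kth_smallest k J d = d j"
proof -
  let ?F = "{S. S \<subseteq> J \<and> card S = k}"
  obtain S0 where "S0 \<subseteq> J" "card S0 = k"
    using k(2) by (rule obtain_subset_with_card_n)
  then have ne: "?F \<noteq> {}" by blast
  have "finite ?F" using J by auto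
  with ne have "kth_smallest k J d \<in> (\<lambda>S. Max (d ` S)) ` ?F"
    unfolding kth_smallest_def by (intro Min_in) simp_all
  then obtain S where S: "S \<subseteq> J" "card S = k" "kth_smallest k J d = Max (d ` S)" by blast
  have "finite S" "S \<noteq> {}" using S(1,2) J k by (auto intro: finite_subset)
  then have "Max (d ` S) \<in> d ` S"
    by (intro Max_in) simp_all
  then obtain j where "j \<in> S" "Max (d ` S) = d j" by blast
  with S show ?thesis by (intro bexI[of _ j]) auto
qed

text \<open>Fewer than \<open>k\<close> indices lie strictly below the order statistic: otherwise
  the largest of those smaller values would already have \<open>k\<close> indices at or below it. So
  \<open>S\<close> loses at most \<open>k - 1\<close> indices.\<close>

lemma kth_smallest_card_ge:
  assumes J: "finite J" and k: "1 \<le> k" "k \<le> card J" and S: "S \<subseteq> J"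
  shows "card S \<le> card {j\<in>S. kth_smallest k J d \<le> d j} + (k - 1)"
proof -
  let ?t = "kth_smallest k J d" and ?L = "{j\<in>J. d j < kth_smallest k J d}"
  have "card ?L < k"
  proof (rule ccontr)
    assume *: "\<not> card ?L < k"
    with k have "card ?L \<noteq> 0" by linarith
    then have "?L \<noteq> {}" by (metis card.empty)
    then have "Max (d ` ?L) \<in> d ` ?L" using J by (intro Max_in) simp_all
    then obtain j where "Max (d ` ?L) = d j" "d j < ?t" by blast
    have "?L \<subseteq> {j\<in>J. d j \<le> Max (d ` ?L)}"
      using J by (intro subsetI CollectI conjI Max_ge finite_imageI imageI) simp_all
    then have "card ?L \<le> card {j\<in>J. d j \<le> Max (d ` ?L)}"
      by (rule card_mono[rotated]) (use J in simp)
    with * have "k \<le> card {j\<in>J. d j \<le> Max (d ` ?L)}"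
      by linarith
    then have "?t \<le> Max (d ` ?L)" using kth_smallest_le_iff[OF J k] by blast
    with \<open>Max (d ` ?L) = d j\<close> \<open>d j < ?t\<close> show False by linarith
  qed
  moreover have "S \<subseteq> {j\<in>S. ?t \<le> d j} \<union> ?L" using S by auto
  then have "card S \<le> card {j\<in>S. ?t \<le> d j} + card ?L"
    using J finite_subset[OF S J] card_mono[of "{j\<in>S. ?t \<le> d j} \<union> ?L" S]
      card_Un_le[of "{j\<in>S. ?t \<le> d j}" ?L] by simp
  ultimately show ?thesis by linarith
qed

lemma sorted_nth_le_iff:
  fixes xs :: "'b::linorder list"
  assumes "sorted xs" "1 \<le> k" "k \<le> length xs"
  shows "xs ! (k - 1) \<le> t \<longleftrightarrow> k \<le> length (filter (\<lambda>y. y \<le> t) xs)"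
proof -
  let ?I = "{i. i < length xs \<and> xs ! i \<le> t}"
  have "xs ! (k - 1) \<le> t \<longleftrightarrow> k \<le> card ?I"
  proof
    assume *: "xs ! (k - 1) \<le> t"
    have "{..<k} \<subseteq> ?I"
    proof
      fix i assume "i \<in> {..<k}"
      then have "i \<le> k - 1" "k - 1 < length xs" using assms by auto
      with sorted_nth_mono[OF assms(1) this] * show "i \<in> ?I" by auto
    qed
    then have "card {..<k} \<le> card ?I" by (intro card_mono) auto
    then show "k \<le> card ?I" by simp
  next
    assume *: "k \<le> card ?I"
    have "\<not> ?I \<subseteq> {..<k - 1}"
    proof
      assume "?I \<subseteq> {..<k - 1}"
      then have "card ?I \<le> card {..<k - 1}" by (intro card_mono) auto
      with * assms show False by simp
    qed
    then obtain i where "i \<in> ?I" "i \<notin> {..<k - 1}" by blast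
    then have "i < length xs" "xs ! i \<le> t" "k - 1 \<le> i" by simp_all
    then show "xs ! (k - 1) \<le> t"
      using sorted_nth_mono[OF assms(1), of "k - 1" i] by auto
  qed
  then show ?thesis by (simp add: length_filter_conv_card)
qed

lemma nn_dist_le_iff:
  assumes "finite A" "1 \<le> k" "k \<le> card A"
  shows "nn_dist k x A \<le> t \<longleftrightarrow> k \<le> card {y\<in>A. dist x y \<le> t}"
proof -
  let ?M = "image_mset (dist x) (mset_set A)"
  have "length (filter (\<lambda>y. y \<le> t) (sorted_list_of_multiset ?M)) = size (filter_mset (\<lambda>y. y \<le> t) ?M)"
    by (metis mset_filter mset_sorted_list_of_multiset size_mset)
  also have "\<dots> = card {y\<in>A. dist x y \<le> t}"
    using assms(1) by (simp add: filter_mset_image_mset filter_mset_mset_set)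
  finally have c: "length (filter (\<lambda>y. y \<le> t) (sorted_list_of_multiset ?M)) = card {y\<in>A. dist x y \<le> t}" .
  have l: "length (sorted_list_of_multiset ?M) = card A"
    by (metis mset_sorted_list_of_multiset size_image_mset size_mset size_mset_set)
  show ?thesis
    unfolding nn_dist_def
    by (subst sorted_nth_le_iff) (use assms l c in \<open>auto simp: sorted_sorted_list_of_multiset\<close>)
qed

lemma disjoint_cballs:
  fixes x y :: "'a::metric_space"
  assumes "2 * r < dist x y"
  shows "cball x r \<inter> cball y r = {}"
proof (rule ccontr)
  assume "cball x r \<inter> cball y r \<noteq> {}"
  then obtain z where "dist x z \<le> r" "dist y z \<le> r" by auto
  then show False using dist_triangle2[of x y z] assms by linarith
qed

definition knn_radius :: "nat \<Rightarrow> 'i set \<Rightarrow> ('i \<Rightarrow> 'a::metric_space) \<Rightarrow> 'i \<Rightarrow> real" where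
  "knn_radius k J w i = kth_smallest k (J - {i}) (\<lambda>j. dist (w i) (w j))"

text \<open>Passing to the image set forgets repeated points, hence injectivity. Both numbers are
  characterised by their upper bounds \<open>t\<close>, and two reals with the same upper bounds
  agree.\<close>

lemma nn_dist_eq_knn_radius:
  assumes J: "finite J" "i \<in> J" "1 \<le> k" "k < card J" and inj: "inj_on w J"
  shows "nn_dist k (w i) (w ` (J - {i})) = knn_radius k J w i"
proof -
  have inj': "inj_on w (J - {i})" using inj by (rule inj_on_subset) auto
  have c: "card (w ` (J - {i})) = card J - 1" "card (J - {i}) = card J - 1"
    using J inj' by (auto simp: card_image)
  have le_iff: "nn_dist k (w i) (w ` (J - {i})) \<le> t \<longleftrightarrow> knn_radius k J w i \<le> t" for t
  proof -
    have "{y \<in> w ` (J - {i}). dist (w i) y \<le> t} = w ` {j\<in>J - {i}. dist (w i) (w j) \<le> t}"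
      by auto
    moreover have "inj_on w {j\<in>J - {i}. dist (w i) (w j) \<le> t}"
      using inj' by (rule inj_on_subset) auto
    ultimately have "card {y \<in> w ` (J - {i}). dist (w i) y \<le> t} = card {j\<in>J - {i}. dist (w i) (w j) \<le> t}"
      by (simp add: card_image)
    then show ?thesis
      unfolding knn_radius_def using J c by (subst nn_dist_le_iff, simp, simp, simp, subst kth_smallest_le_iff) auto
  qed
  show ?thesis
    using le_iff[of "nn_dist k (w i) (w ` (J - {i}))"] le_iff[of "knn_radius k J w i"] by simp
qed

section \<open>Integrating out chosen sample points\<close>

context iid_sample
begin

lemma nn_integral_sample_pull:
  fixes f :: "('i \<Rightarrow> 'a) \<Rightarrow> ennreal"
  assumes "finite I" "i \<in> I" "f \<in> borel_measurable (sample I)"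
  shows "(\<integral>\<^sup>+w. f w \<partial>sample I) = (\<integral>\<^sup>+x. \<integral>\<^sup>+w. f (w(i := x)) \<partial>sample (I - {i}) \<partial>D)"
  using nn_integral_sample_insert[of "I - {i}" i f] assms by (simp add: insert_absorb)

lemma nn_integral_sample_pull2:
  fixes f :: "('i \<Rightarrow> 'a) \<Rightarrow> ennreal"
  assumes I: "finite I" "i \<in> I" "j \<in> I" "i \<noteq> j" and f: "f \<in> borel_measurable (sample I)"
  shows "(\<integral>\<^sup>+w. f w \<partial>sample I)
    = (\<integral>\<^sup>+x. \<integral>\<^sup>+y. \<integral>\<^sup>+w. f (w(j := y, i := x)) \<partial>sample (I - {i, j}) \<partial>D \<partial>D)"
proof -
  have "(\<integral>\<^sup>+w. f w \<partial>sample I) = (\<integral>\<^sup>+x. \<integral>\<^sup>+w. f (w(i := x)) \<partial>sample (I - {i}) \<partial>D)"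
    using I f by (intro nn_integral_sample_pull)
  also have "\<dots> = (\<integral>\<^sup>+x. \<integral>\<^sup>+y. \<integral>\<^sup>+w. f ((w(j := y))(i := x)) \<partial>sample (I - {i} - {j}) \<partial>D \<partial>D)"
  proof (intro nn_integral_cong nn_integral_sample_pull)
    fix x assume "x \<in> space D"
    then show "(\<lambda>w. f (w(i := x))) \<in> borel_measurable (sample (I - {i}))"
      by (intro measurable_compose[OF _ f] measurable_fun_upd[where J="I - {i}"]) (use I in auto)
  qed (use I in auto)
  also have "I - {i} - {j} = I - {i, j}" by auto
  finally show ?thesis .
qed

lemma nn_integral_sample_pull3:
  fixes f :: "('i \<Rightarrow> 'a) \<Rightarrow> ennreal"
  assumes I: "finite I" "i \<in> I" "i' \<in> I" "j \<in> I" "i \<noteq> i'" "i \<noteq> j" "i' \<noteq> j"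
    and f: "f \<in> borel_measurable (sample I)"
  shows "(\<integral>\<^sup>+w. f w \<partial>sample I)
    = (\<integral>\<^sup>+x. \<integral>\<^sup>+x'. \<integral>\<^sup>+y. \<integral>\<^sup>+w. f (w(j := y, i' := x', i := x)) \<partial>sample (I - {i, i', j}) \<partial>D \<partial>D \<partial>D)"
proof -
  have "(\<integral>\<^sup>+w. f w \<partial>sample I) = (\<integral>\<^sup>+x. \<integral>\<^sup>+w. f (w(i := x)) \<partial>sample (I - {i}) \<partial>D)"
    using I f by (intro nn_integral_sample_pull)
  also have "\<dots> = (\<integral>\<^sup>+x. \<integral>\<^sup>+x'. \<integral>\<^sup>+y. \<integral>\<^sup>+w. f ((w(j := y, i' := x'))(i := x)) \<partial>sample (I - {i} - {i', j}) \<partial>D \<partial>D \<partial>D)"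
  proof (intro nn_integral_cong nn_integral_sample_pull2)
    fix x assume "x \<in> space D"
    then show "(\<lambda>w. f (w(i := x))) \<in> borel_measurable (sample (I - {i}))"
      by (intro measurable_compose[OF _ f] measurable_fun_upd[where J="I - {i}"]) (use I in auto)
  qed (use I in auto)
  also have "I - {i} - {i', j} = I - {i, i', j}" by auto
  finally show ?thesis .
qed

end

section \<open>Probabilities that sample points are isolated\<close>

locale knn_sample = iid_sample D for D :: "'a::euclidean_space measure" +
  assumes sets_D [measurable_cong]: "sets D = sets borel"
begin

lemma space_D [simp]: "space D = UNIV"
  using sets_eq_imp_space_eq[OF sets_D] by simp

lemma measurable_prob_region [measurable]:
  assumes [measurable]: "Measurable.pred (N \<Otimes>\<^sub>M D) (\<lambda>(x, y). P x y)"
  shows "(\<lambda>x. prob {y. P x y}) \<in> borel_measurable N"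
proof -
  have "(\<lambda>x. measure D (Pair x -` {z\<in>space (N \<Otimes>\<^sub>M D). case z of (x, y) \<Rightarrow> P x y})) \<in> borel_measurable N"
    unfolding measure_def by (intro borel_measurable_enn2real measurable_emeasure_Pair) measurable
  moreover have "Pair x -` {z\<in>space (N \<Otimes>\<^sub>M D). case z of (x, y) \<Rightarrow> P x y} = {y. P x y}" if "x \<in> space N" for x
    using that by (auto simp: space_pair_measure)
  ultimately show ?thesis
    by (simp cong: measurable_cong)
qed

lemma measurable_prob_cball [measurable]: "(\<lambda>x. prob (cball x r)) \<in> borel_measurable borel"
  unfolding cball_def by measurable

lemma measurable_prob_cball_Un [measurable]:
  "(\<lambda>z. prob (cball (fst z) r \<union> cball (snd z) r)) \<in> borel_measurable (borel \<Otimes>\<^sub>M borel)"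
  unfolding cball_def Un_def mem_Collect_eq by measurable

lemma measurable_count_cball [measurable]:
  assumes "finite J" "i \<in> I" "J \<subseteq> I"
  shows "(\<lambda>w. card {j\<in>J. w j \<in> cball (w i) r}) \<in> measurable (sample I) (count_space UNIV)"
  using assms(1)
proof (rule measurable_card_sample)
  fix j assume "j \<in> J"
  then have [measurable]: "j \<in> I" "i \<in> I" using assms by auto
  show "Measurable.pred (sample I) (\<lambda>w. w j \<in> cball (w i) r)"
    unfolding mem_cball by measurable
qed

lemma measurable_count_cball_Un [measurable]:
  assumes "finite J" "i \<in> I" "i' \<in> I" "J \<subseteq> I"
  shows "(\<lambda>w. card {j\<in>J. w j \<in> cball (w i) r \<union> cball (w i') r}) \<in> measurable (sample I) (count_space UNIV)"
  using assms(1)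
proof (rule measurable_card_sample)
  fix j assume "j \<in> J"
  then have [measurable]: "j \<in> I" "i \<in> I" "i' \<in> I" using assms by auto
  show "Measurable.pred (sample I) (\<lambda>w. w j \<in> cball (w i) r \<union> cball (w i') r)"
    unfolding mem_cball Un_iff by measurable
qed

lemma nn_integral_isolated:
  assumes I: "finite I" "i \<in> I"
  shows "(\<integral>\<^sup>+w. of_bool (card {j\<in>I - {i}. w j \<in> cball (w i) r} < k) \<partial>sample I)
    = (\<integral>\<^sup>+x. ennreal (binomial_below (card I - 1) k (prob (cball x r))) \<partial>D)"
proof -
  have [measurable]: "finite (I - {i})" "i \<in> I" "I - {i} \<subseteq> I"
    using I by auto
  have "(\<integral>\<^sup>+w. of_bool (card {j\<in>I - {i}. w j \<in> cball (w i) r} < k) \<partial>sample I)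
    = (\<integral>\<^sup>+x. \<integral>\<^sup>+w. of_bool (card {j\<in>I - {i}. (w(i := x)) j \<in> cball ((w(i := x)) i) r} < k) \<partial>sample (I - {i}) \<partial>D)"
    using I by (intro nn_integral_sample_pull) measurable
  also have "\<dots> = (\<integral>\<^sup>+x. \<integral>\<^sup>+w. of_bool (card {j\<in>I - {i}. w j \<in> cball x r} < k) \<partial>sample (I - {i}) \<partial>D)"
    by (intro nn_integral_cong arg_cong[of _ _ of_bool] arg_cong2[of _ _ _ _ "(<)"] arg_cong[of _ _ card]) auto
  also have "\<dots> = (\<integral>\<^sup>+x. ennreal (binomial_below (card I - 1) k (prob (cball x r))) \<partial>D)"
    using I by (subst nn_integral_count_below) (auto simp: sets_D)
  finally show ?thesis .
qed

text \<open>Dropping both centres from the counters only lowers the counts, and the remaining points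
  are independent of the centres. Centres farther apart than \<open>2 * r\<close> have disjoint
  balls and the trinomial law applies; closer pairs are charged probability 1.\<close>

lemma nn_integral_both_isolated:
  assumes I: "finite I" "i \<in> I" "i' \<in> I" "i \<noteq> i'"
  shows "(\<integral>\<^sup>+w. of_bool (card {j\<in>I - {i}. w j \<in> cball (w i) r} < k \<and>
             card {j\<in>I - {i'}. w j \<in> cball (w i') r} < k) \<partial>sample I)
    \<le> (\<integral>\<^sup>+x. \<integral>\<^sup>+y. (if dist x y \<le> 2 * r then 1
          else ennreal (trinomial_below (card I - 2) k k (prob (cball x r)) (prob (cball y r)))) \<partial>D \<partial>D)"
proof -
  let ?J = "I - {i, i'}"
  have [measurable]: "finite ?J" "i \<in> I" "i' \<in> I" "?J \<subseteq> I" "?J \<subseteq> I - {i}" "i' \<in> I - {i}"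
    using I by auto
  have mono: "card {j\<in>?J. w j \<in> B} \<le> card {j\<in>I - {l}. w j \<in> B}" if "l = i \<or> l = i'" for w :: "'b \<Rightarrow> 'a" and B l
    using I that by (intro card_mono) auto
  have "(\<integral>\<^sup>+w. of_bool (card {j\<in>I - {i}. w j \<in> cball (w i) r} < k \<and>
             card {j\<in>I - {i'}. w j \<in> cball (w i') r} < k) \<partial>sample I)
    \<le> (\<integral>\<^sup>+w. of_bool (card {j\<in>?J. w j \<in> cball (w i) r} < k \<and>
             card {j\<in>?J. w j \<in> cball (w i') r} < k) \<partial>sample I)"
  proof (intro nn_integral_mono)
    fix w :: "'b \<Rightarrow> 'a"
    show "(of_bool (card {j\<in>I - {i}. w j \<in> cball (w i) r} < k \<and> card {j\<in>I - {i'}. w j \<in> cball (w i') r} < k) :: ennreal)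
      \<le> of_bool (card {j\<in>?J. w j \<in> cball (w i) r} < k \<and> card {j\<in>?J. w j \<in> cball (w i') r} < k)"
      using mono[of i w "cball (w i) r"] mono[of i' w "cball (w i') r"] by (simp del: mem_cball Diff_iff)
  qed
  also have "\<dots> = (\<integral>\<^sup>+x. \<integral>\<^sup>+y. \<integral>\<^sup>+w. of_bool (card {j\<in>?J. (w(i' := y, i := x)) j \<in> cball ((w(i' := y, i := x)) i) r} < k \<and>
             card {j\<in>?J. (w(i' := y, i := x)) j \<in> cball ((w(i' := y, i := x)) i') r} < k) \<partial>sample ?J \<partial>D \<partial>D)"
    using I by (intro nn_integral_sample_pull2) measurable
  also have "\<dots> = (\<integral>\<^sup>+x. \<integral>\<^sup>+y. \<integral>\<^sup>+w. of_bool (card {j\<in>?J. w j \<in> cball x r} < k \<and>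
             card {j\<in>?J. w j \<in> cball y r} < k) \<partial>sample ?J \<partial>D \<partial>D)"
    using I by (intro nn_integral_cong arg_cong[of _ _ of_bool] arg_cong2[of _ _ _ _ "(\<and>)"]
        arg_cong2[of _ _ _ _ "(<)"] arg_cong[of _ _ card]) auto
  also have "\<dots> \<le> (\<integral>\<^sup>+x. \<integral>\<^sup>+y. (if dist x y \<le> 2 * r then 1
          else ennreal (trinomial_below (card I - 2) k k (prob (cball x r)) (prob (cball y r)))) \<partial>D \<partial>D)"
  proof (intro nn_integral_mono)
    fix x y :: 'a
    interpret S: prob_space "sample ?J" by (rule prob_space_sample)
    show "(\<integral>\<^sup>+w. of_bool (card {j\<in>?J. w j \<in> cball x r} < k \<and> card {j\<in>?J. w j \<in> cball y r} < k) \<partial>sample ?J)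
       \<le> (if dist x y \<le> 2 * r then 1
          else ennreal (trinomial_below (card I - 2) k k (prob (cball x r)) (prob (cball y r))))"
    proof (cases "dist x y \<le> 2 * r")
      case True
      have "(\<integral>\<^sup>+w. of_bool (card {j\<in>?J. w j \<in> cball x r} < k \<and> card {j\<in>?J. w j \<in> cball y r} < k) \<partial>sample ?J)
         \<le> (\<integral>\<^sup>+w. 1 \<partial>sample ?J)"
        by (intro nn_integral_mono) auto
      with True show ?thesis by (simp add: S.emeasure_space_1)
    next
      case False
      then have "cball x r \<inter> cball y r = {}"
        by (intro disjoint_cballs) simp
      moreover have "card ?J = card I - 2" using I by (simp add: card_Diff_subset)
      ultimately show ?thesis
        using False I by (subst nn_integral_count2_below) (auto simp: sets_D)
    qed
  qed
  finally show ?thesis .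
qed

text \<open>The weight involves only the points \<open>i\<close> and \<open>j\<close>, the counter
  only the others and the centre \<open>w i\<close>; so the integral factorises once
  \<open>w i\<close> is fixed.\<close>

lemma nn_integral_weighted_isolated:
  assumes I: "finite I" "i \<in> I" "j \<in> I" "i \<noteq> j"
    and h[measurable]: "case_prod h \<in> borel_measurable (borel \<Otimes>\<^sub>M borel)"
  shows "(\<integral>\<^sup>+w. h (w i) (w j) * of_bool (card {l\<in>I - {i, j}. w l \<in> cball (w i) r} < k) \<partial>sample I)
    = (\<integral>\<^sup>+x. (\<integral>\<^sup>+y. h x y \<partial>D) * ennreal (binomial_below (card I - 2) k (prob (cball x r))) \<partial>D)"
proof -
  have [measurable]: "finite (I - {i, j})" "i \<in> I" "j \<in> I" "I - {i, j} \<subseteq> I"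
    using I by auto
  have "(\<integral>\<^sup>+w. h (w i) (w j) * of_bool (card {l\<in>I - {i, j}. w l \<in> cball (w i) r} < k) \<partial>sample I)
    = (\<integral>\<^sup>+x. \<integral>\<^sup>+y. \<integral>\<^sup>+w. h ((w(j := y, i := x)) i) ((w(j := y, i := x)) j) *
         of_bool (card {l\<in>I - {i, j}. (w(j := y, i := x)) l \<in> cball ((w(j := y, i := x)) i) r} < k)
       \<partial>sample (I - {i, j}) \<partial>D \<partial>D)"
    using I by (intro nn_integral_sample_pull2) measurable
  also have "\<dots> = (\<integral>\<^sup>+x. \<integral>\<^sup>+y. \<integral>\<^sup>+w. h x y * of_bool (card {l\<in>I - {i, j}. w l \<in> cball x r} < k)
       \<partial>sample (I - {i, j}) \<partial>D \<partial>D)"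
    using I by (intro nn_integral_cong arg_cong[of _ _ of_bool] arg_cong2[of _ _ _ _ "(*)"]
        arg_cong2[of _ _ _ _ "(<)"] arg_cong[of _ _ card]) auto
  also have "\<dots> = (\<integral>\<^sup>+x. \<integral>\<^sup>+y. h x y * ennreal (binomial_below (card I - 2) k (prob (cball x r))) \<partial>D \<partial>D)"
  proof (intro nn_integral_cong)
    fix x y :: 'a
    have [measurable]: "(\<lambda>w. card {l\<in>I - {i, j}. w l \<in> cball x r}) \<in> measurable (sample (I - {i, j})) (count_space UNIV)"
    proof (rule measurable_card_sample)
      fix l assume [measurable]: "l \<in> I - {i, j}"
      show "Measurable.pred (sample (I - {i, j})) (\<lambda>w. w l \<in> cball x r)"
        unfolding mem_cball by measurable
    qed (use I in simp)
    have "card (I - {i, j}) = card I - 2" using I by (simp add: card_Diff_subset)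
    then show "(\<integral>\<^sup>+w. h x y * of_bool (card {l\<in>I - {i, j}. w l \<in> cball x r} < k) \<partial>sample (I - {i, j}))
       = h x y * ennreal (binomial_below (card I - 2) k (prob (cball x r)))"
      using I by (subst nn_integral_cmult, measurable) (subst nn_integral_count_below, auto simp: sets_D)
  qed
  also have "\<dots> = (\<integral>\<^sup>+x. (\<integral>\<^sup>+y. h x y \<partial>D) * ennreal (binomial_below (card I - 2) k (prob (cball x r))) \<partial>D)"
    by (intro nn_integral_cong nn_integral_multc) measurable
  finally show ?thesis .
qed

text \<open>A single counter on the union of the two balls keeps the law binomial whether or not the
  balls overlap.\<close>

lemma nn_integral_weighted_both_isolated:
  assumes I: "finite I" "i \<in> I" "i' \<in> I" "j \<in> I" "i \<noteq> i'" "i \<noteq> j" "i' \<noteq> j"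
    and h[measurable]: "case_prod h \<in> borel_measurable (borel \<Otimes>\<^sub>M borel)"
  shows "(\<integral>\<^sup>+w. h (w i) (w j) * of_bool (card {l\<in>I - {i, i', j}. w l \<in> cball (w i) r \<union> cball (w i') r} < k) \<partial>sample I)
    = (\<integral>\<^sup>+x. \<integral>\<^sup>+x'. (\<integral>\<^sup>+y. h x y \<partial>D) *
        ennreal (binomial_below (card I - 3) k (prob (cball x r \<union> cball x' r))) \<partial>D \<partial>D)"
proof -
  have [measurable]: "finite (I - {i, i', j})" "i \<in> I" "i' \<in> I" "j \<in> I" "I - {i, i', j} \<subseteq> I"
    using I by auto
  have "(\<integral>\<^sup>+w. h (w i) (w j) * of_bool (card {l\<in>I - {i, i', j}. w l \<in> cball (w i) r \<union> cball (w i') r} < k) \<partial>sample I)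
    = (\<integral>\<^sup>+x. \<integral>\<^sup>+x'. \<integral>\<^sup>+y. \<integral>\<^sup>+w. h ((w(j := y, i' := x', i := x)) i) ((w(j := y, i' := x', i := x)) j) *
         of_bool (card {l\<in>I - {i, i', j}. (w(j := y, i' := x', i := x)) l \<in> cball ((w(j := y, i' := x', i := x)) i) r
           \<union> cball ((w(j := y, i' := x', i := x)) i') r} < k)
       \<partial>sample (I - {i, i', j}) \<partial>D \<partial>D \<partial>D)"
    using I by (intro nn_integral_sample_pull3) measurable
  also have "\<dots> = (\<integral>\<^sup>+x. \<integral>\<^sup>+x'. \<integral>\<^sup>+y. \<integral>\<^sup>+w. h x y * of_bool (card {l\<in>I - {i, i', j}. w l \<in> cball x r \<union> cball x' r} < k)
       \<partial>sample (I - {i, i', j}) \<partial>D \<partial>D \<partial>D)"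
    using I by (intro nn_integral_cong arg_cong[of _ _ of_bool] arg_cong2[of _ _ _ _ "(*)"]
        arg_cong2[of _ _ _ _ "(<)"] arg_cong[of _ _ card]) auto
  also have "\<dots> = (\<integral>\<^sup>+x. \<integral>\<^sup>+x'. \<integral>\<^sup>+y. h x y * ennreal (binomial_below (card I - 3) k (prob (cball x r \<union> cball x' r))) \<partial>D \<partial>D \<partial>D)"
  proof (intro nn_integral_cong)
    fix x x' y :: 'a
    have [measurable]: "(\<lambda>w. card {l\<in>I - {i, i', j}. w l \<in> cball x r \<union> cball x' r}) \<in> measurable (sample (I - {i, i', j})) (count_space UNIV)"
    proof (rule measurable_card_sample)
      fix l assume [measurable]: "l \<in> I - {i, i', j}"
      show "Measurable.pred (sample (I - {i, i', j})) (\<lambda>w. w l \<in> cball x r \<union> cball x' r)"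
        unfolding mem_cball Un_iff by measurable
    qed (use I in simp)
    have "card (I - {i, i', j}) = card I - 3" using I by (simp add: card_Diff_subset)
    then show "(\<integral>\<^sup>+w. h x y * of_bool (card {l\<in>I - {i, i', j}. w l \<in> cball x r \<union> cball x' r} < k) \<partial>sample (I - {i, i', j}))
       = h x y * ennreal (binomial_below (card I - 3) k (prob (cball x r \<union> cball x' r)))"
      using I by (subst nn_integral_cmult, measurable) (subst nn_integral_count_below, auto simp: sets_D)
  qed
  also have "\<dots> = (\<integral>\<^sup>+x. \<integral>\<^sup>+x'. (\<integral>\<^sup>+y. h x y \<partial>D) * ennreal (binomial_below (card I - 3) k (prob (cball x r \<union> cball x' r))) \<partial>D \<partial>D)"
    by (intro nn_integral_cong nn_integral_multc) measurable
  finally show ?thesis .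
qed

end

section \<open>Lebesgue differentiation along balls\<close>

text \<open>Reflection in the coordinates belonging to \<open>B\<close>. Differentiation along cubes
  with lowest corner x sees one orthant only; conjugating with the 2^d reflections yields every
  orthant, and the resulting cubes cover a ball around x.\<close>

definition flip :: "'a::euclidean_space set \<Rightarrow> 'a \<Rightarrow> 'a" where
  "flip B x = (\<Sum>j\<in>Basis. ((if j \<in> B then -1 else 1) * (x \<bullet> j)) *\<^sub>R j)"

lemma flip_inner [simp]: "j \<in> Basis \<Longrightarrow> flip B x \<bullet> j = (if j \<in> B then -1 else 1) * (x \<bullet> j)"
  by (simp add: flip_def inner_sum_left inner_Basis if_distrib cong: if_cong)

lemma flip_flip [simp]: "flip B (flip B x) = x"
  by (rule euclidean_eqI) auto

lemma flip_measurable [measurable]: "flip B \<in> borel_measurable borel"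
  unfolding flip_def[abs_def] by measurable

lemma distr_lborel_flip: "distr lborel borel (flip B) = lborel"
proof -
  have "lborel = density (distr lborel borel (\<lambda>x::'a. 0 + (\<Sum>j\<in>Basis. ((if j \<in> B then -1 else 1) * (x \<bullet> j)) *\<^sub>R j)))
     (\<lambda>_. (\<Prod>j\<in>Basis. \<bar>if j \<in> B then -1 else 1 :: real\<bar>))"
    by (rule lborel_affine_euclidean) auto
  also have "(\<Prod>j\<in>(Basis::'a set). \<bar>if j \<in> B then -1 else 1 :: real\<bar>) = 1"
    by (intro prod.neutral) auto
  finally have "lborel = distr lborel borel (\<lambda>x::'a. \<Sum>j\<in>Basis. ((if j \<in> B then -1 else 1) * (x \<bullet> j)) *\<^sub>R j)"
    by (simp only: add_0 density_1 ennreal_1)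
  then show ?thesis
    unfolding flip_def[abs_def] by (rule sym)
qed

lemma lborel_corner_cube_differentiation:
  fixes g :: "'a::euclidean_space \<Rightarrow> real"
  assumes int: "\<And>a b. set_integrable lborel (cbox a b) g"
  shows "AE x in lborel. ((\<lambda>h. (LINT y:cbox x (x + h *\<^sub>R One)|lborel. g y) / h ^ DIM('a)) \<longlongrightarrow> g x) (at_right 0)"
proof -
  have "g integrable_on cbox a b" for a b
    using int by (rule set_borel_integral_eq_integral)
  then obtain N where N: "negligible N" and lim: "\<And>x e. x \<notin> N \<Longrightarrow> 0 < e \<Longrightarrow>
      \<exists>d>0. \<forall>h. 0 < h \<and> h < d \<longrightarrow> norm (integral (cbox x (x + h *\<^sub>R One)) g /\<^sub>R h ^ DIM('a) - g x) < e"
    using integrable_ccontinuous_explicit[of g] by blast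
  have "AE x in lebesgue. x \<notin> N"
    using N by (intro AE_not_in) (simp add: negligible_iff_null_sets)
  then have "AE x in lborel. x \<notin> N"
    by (simp add: AE_completion_iff)
  then show ?thesis
  proof eventually_elim
    case (elim x)
    show ?case
    proof (rule tendstoI)
      fix e :: real assume "0 < e"
      from lim[OF elim this] obtain d where d: "d > 0"
        "\<And>h. 0 < h \<Longrightarrow> h < d \<Longrightarrow> norm (integral (cbox x (x + h *\<^sub>R One)) g /\<^sub>R h ^ DIM('a) - g x) < e"
        by blast
      have "(LINT y:cbox x (x + h *\<^sub>R One)|lborel. g y) = integral (cbox x (x + h *\<^sub>R One)) g" for h
        using int by (rule set_borel_integral_eq_integral)
      then have "dist ((LINT y:cbox x (x + h *\<^sub>R One)|lborel. g y) / h ^ DIM('a)) (g x) < e" if "0 < h" "h < d" for h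
        using d(2)[OF that] by (simp add: dist_real_def divide_inverse mult.commute)
      then show "\<forall>\<^sub>F h in at_right 0. dist ((LINT y:cbox x (x + h *\<^sub>R One)|lborel. g y) / h ^ DIM('a)) (g x) < e"
        unfolding eventually_at_right_field using d(1) by blast
    qed
  qed
qed

text \<open>The cube of side \<open>h\<close> with a corner at \<open>x\<close> that extends
  downwards in the coordinates of \<open>B\<close> and upwards in the others.\<close>

definition orthant_cube :: "'a::euclidean_space set \<Rightarrow> 'a \<Rightarrow> real \<Rightarrow> 'a set" where
  "orthant_cube B x h = flip B -` cbox (flip B x) (flip B x + h *\<^sub>R One)"

lemma orthant_cube_measurable [measurable]: "orthant_cube B x h \<in> sets borel"
  using measurable_sets[OF flip_measurable[of B], of "cbox (flip B x) (flip B x + h *\<^sub>R One)"]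
  by (simp add: orthant_cube_def)

lemma cball_subset_orthant_cubes: "cball x h \<subseteq> (\<Union>B\<in>Pow Basis. orthant_cube B x h)"
proof
  fix y assume y: "y \<in> cball x h"
  define B where "B = {j\<in>Basis. y \<bullet> j < x \<bullet> j}"
  have "\<bar>y \<bullet> j - x \<bullet> j\<bar> \<le> h" if "j \<in> Basis" for j
    using Basis_le_norm[OF that, of "y - x"] y by (simp add: inner_diff_left dist_norm norm_minus_commute)
  note bound = this
  have "flip B y \<in> cbox (flip B x) (flip B x + h *\<^sub>R One)"
    unfolding mem_box
  proof (intro ballI)
    fix j :: 'a assume j: "j \<in> Basis"
    show "flip B x \<bullet> j \<le> flip B y \<bullet> j \<and> flip B y \<bullet> j \<le> (flip B x + h *\<^sub>R One) \<bullet> j"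
      using bound[OF j] j by (auto simp: inner_add_left B_def)
  qed
  then show "y \<in> (\<Union>B\<in>Pow Basis. orthant_cube B x h)"
    by (auto simp: orthant_cube_def B_def)
qed

text \<open>This is the corner case for \<open>g\<close> composed with \<open>flip B\<close>, taken
  at the point \<open>flip B x\<close>. The reflection preserves \<open>lborel\<close>, so the
  integrals as well as the exceptional null set are carried over.\<close>

lemma lborel_orthant_cube_differentiation:
  fixes g :: "'a::euclidean_space \<Rightarrow> real"
  assumes g[measurable]: "g \<in> borel_measurable borel" and int: "\<And>S. bounded S \<Longrightarrow> S \<in> sets borel \<Longrightarrow> set_integrable lborel S g"
  shows "AE x in lborel. ((\<lambda>h. (LINT y:orthant_cube B x h|lborel. g y) / h ^ DIM('a)) \<longlongrightarrow> g x) (at_right 0)"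
proof -
  have flip_int: "(LINT y|lborel. f (flip B y)) = (LINT y|lborel. f y)" if [measurable]: "f \<in> borel_measurable borel" for f :: "'a \<Rightarrow> real"
    using integral_distr[of "flip B" lborel borel f] by (simp add: distr_lborel_flip)
  have flip_integrable: "integrable lborel (\<lambda>y. f (flip B y)) \<longleftrightarrow> integrable lborel f" if [measurable]: "f \<in> borel_measurable borel" for f :: "'a \<Rightarrow> real"
    using integrable_distr_eq[of "flip B" lborel borel f] by (simp add: distr_lborel_flip)
  have "set_integrable lborel (cbox a b) (\<lambda>y. g (flip B y))" for a b
  proof -
    have sub: "flip B -` cbox a b \<subseteq> cbox (- (norm a + norm b) *\<^sub>R One) ((norm a + norm b) *\<^sub>R One)"
    proof
      fix x assume "x \<in> flip B -` cbox a b"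
      then have 1: "a \<bullet> j \<le> (if j \<in> B then -1 else 1) * (x \<bullet> j) \<and> (if j \<in> B then -1 else 1) * (x \<bullet> j) \<le> b \<bullet> j" if "j \<in> Basis" for j
        using that by (auto simp: mem_box)
      show "x \<in> cbox (- (norm a + norm b) *\<^sub>R One) ((norm a + norm b) *\<^sub>R One)"
        unfolding mem_box
      proof (intro ballI)
        fix j :: 'a assume j: "j \<in> Basis"
        show "(- (norm a + norm b) *\<^sub>R One) \<bullet> j \<le> x \<bullet> j \<and> x \<bullet> j \<le> ((norm a + norm b) *\<^sub>R One) \<bullet> j"
          using 1[OF j] Basis_le_norm[OF j, of a] Basis_le_norm[OF j, of b] j by (auto split: if_splits)
      qed
    qed
    have m: "flip B -` cbox a b \<in> sets borel"
      using measurable_sets[OF flip_measurable[of B], of "cbox a b"] by simp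
    have "set_integrable lborel (flip B -` cbox a b) g"
      using sub m by (intro int bounded_subset[OF bounded_cbox])
    then have "integrable lborel (\<lambda>y. indicator (flip B -` cbox a b) y * g y)"
      by (simp add: set_integrable_def)
    then have "integrable lborel (\<lambda>y. indicator (flip B -` cbox a b) (flip B y) * g (flip B y))"
      using m by (subst flip_integrable) auto
    then show ?thesis by (simp add: set_integrable_def indicator_def)
  qed
  from lborel_corner_cube_differentiation[OF this]
  have "AE x in distr lborel borel (flip B). ((\<lambda>h. (LINT y:cbox x (x + h *\<^sub>R One)|lborel. g (flip B y)) / h ^ DIM('a)) \<longlongrightarrow> g (flip B x)) (at_right 0)"
    unfolding distr_lborel_flip .
  then have "AE x in lborel. ((\<lambda>h. (LINT y:cbox (flip B x) (flip B x + h *\<^sub>R One)|lborel. g (flip B y)) / h ^ DIM('a)) \<longlongrightarrow> g (flip B (flip B x))) (at_right 0)"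
    by (rule AE_distrD[rotated]) simp
  moreover have "(LINT y:cbox (flip B x) (flip B x + h *\<^sub>R One)|lborel. g (flip B y)) = (LINT y:orthant_cube B x h|lborel. g y)" for x h
    using flip_int[of "\<lambda>y. indicator (orthant_cube B x h) y * g y"]
    by (simp add: set_lebesgue_integral_def orthant_cube_def indicator_def)
  ultimately show ?thesis by simp
qed

text \<open>A ball is merely covered by cubes, so averages of \<open>p\<close> do not transfer from
  cubes to balls. Averages of |p - q| do, being nonnegative: the ball lies in 2^d cubes of
  comparable volume. Rational \<open>q\<close> near p x suffice, and countably many of them keep the
  exceptional set null.\<close>

theorem lborel_ball_differentiation:
  fixes p :: "'a::euclidean_space \<Rightarrow> real"
  assumes p[measurable]: "p \<in> borel_measurable borel" and int: "integrable lborel p"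
  shows "AE x in lborel. ((\<lambda>r. (LINT y:cball x r|lborel. p y) / measure lborel (cball x r)) \<longlongrightarrow> p x) (at_right 0)"
proof -
  have intq: "set_integrable lborel S (\<lambda>y. \<bar>p y - q\<bar>)" if "bounded S" "S \<in> sets borel" for S q
  proof -
    have "emeasure lborel S < \<infinity>" using that by (intro emeasure_bounded_finite)
    then have "set_integrable lborel S (\<lambda>_. q)"
      using that unfolding set_integrable_def by (simp add: integrable_indicator_iff)
    moreover have "set_integrable lborel S p"
      using that int unfolding set_integrable_def by (intro integrable_mult_indicator) auto
    ultimately have "set_integrable lborel S (\<lambda>y. p y - q)" by (rule set_integral_diff[rotated])
    then show ?thesis by (rule set_integrable_abs)
  qed
  have "AE x in lborel. \<forall>q\<in>\<rat>. \<forall>B\<in>Pow Basis.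
    ((\<lambda>h. (LINT y:orthant_cube B x h|lborel. \<bar>p y - q\<bar>) / h ^ DIM('a)) \<longlongrightarrow> \<bar>p x - q\<bar>) (at_right 0)"
    by (intro AE_ball_countable' countable_rat lborel_orthant_cube_differentiation intq) (auto intro: countable_finite)
  then show ?thesis
  proof eventually_elim
    case (elim x)
    define v where "v = unit_ball_vol (real DIM('a))"
    define n where "n = real (card (Pow (Basis::'a set)))"
    have v: "v > 0" by (simp add: v_def)
    have n: "n \<ge> 0" by (simp add: n_def)
    \<comment> \<open>Each of the \<open>n\<close> cubes contributes at most 2 e r^d, the ball has
      volume v r^d, and passing from q to p x costs the last e.\<close>
    have main: "\<forall>\<^sub>F r in at_right 0. \<bar>(LINT y:cball x r|lborel. p y) / measure lborel (cball x r) - p x\<bar> \<le> n * (2 * e) / v + e"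
      if e: "e > 0" for e
    proof -
      obtain q where q: "q \<in> \<rat>" "p x - e < q" "q < p x"
        using Rats_dense_in_real[of "p x - e" "p x"] e by auto
      then have pq: "\<bar>p x - q\<bar> < e" by auto
      have "\<forall>\<^sub>F h in at_right 0. \<forall>B\<in>Pow Basis. (LINT y:orthant_cube B x h|lborel. \<bar>p y - q\<bar>) / h ^ DIM('a) < 2 * e"
        using elim q(1) pq e by (intro eventually_ball_finite ballI order_tendstoD(2)) auto
      then show ?thesis
        using eventually_at_right_less[of 0]
      proof eventually_elim
        case (elim r)
        let ?b = "cball x r"
        have vol: "measure lborel ?b = v * r ^ DIM('a)"
          using elim by (simp add: content_cball v_def)
        have r0: "r \<noteq> 0" using elim by simp
        have rd: "r ^ DIM('a) > 0" using elim by simp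
        have bd: "bounded (orthant_cube B x r)" for B
        proof -
          have "norm (y - x) \<le> (\<Sum>b\<in>(Basis::'a set). r)" if "y \<in> orthant_cube B x r" for y
          proof (rule order_trans[OF norm_le_l1 sum_mono])
            fix j :: 'a assume j: "j \<in> Basis"
            have "flip B x \<bullet> j \<le> flip B y \<bullet> j \<and> flip B y \<bullet> j \<le> flip B x \<bullet> j + r"
              using that j by (auto simp: orthant_cube_def mem_box inner_add_left)
            with j show "\<bar>(y - x) \<bullet> j\<bar> \<le> r"
              by (auto simp: inner_diff_left split: if_splits)
          qed
          then show ?thesis
            unfolding bounded_def by (intro exI[of _ x] exI ballI) (simp only: dist_norm norm_minus_commute[of x])
        qed
        have i1: "integrable lborel (\<lambda>y. indicator ?b y * \<bar>p y - q\<bar>)"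
          using intq[of ?b q] by (simp add: set_integrable_def)
        have i2: "integrable lborel (\<lambda>y. indicator (orthant_cube B x r) y * \<bar>p y - q\<bar>)" for B
          using intq[OF bd, of B q] by (simp add: set_integrable_def)
        have "(LINT y:?b|lborel. \<bar>p y - q\<bar>) \<le> (\<integral>y. (\<Sum>B\<in>Pow Basis. indicator (orthant_cube B x r) y * \<bar>p y - q\<bar>) \<partial>lborel)"
          unfolding set_lebesgue_integral_def real_scaleR_def
        proof (intro integral_mono i1 Bochner_Integration.integrable_sum i2)
          fix y
          show "indicator ?b y * \<bar>p y - q\<bar> \<le> (\<Sum>B\<in>Pow Basis. indicator (orthant_cube B x r) y * \<bar>p y - q\<bar>)"
          proof (cases "y \<in> ?b")
            case True
            then obtain B where B: "B \<in> Pow Basis" "y \<in> orthant_cube B x r"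
              using cball_subset_orthant_cubes by blast
            then have "indicator ?b y * \<bar>p y - q\<bar> \<le> indicator (orthant_cube B x r) y * \<bar>p y - q\<bar>"
              using True by simp
            also have "\<dots> \<le> (\<Sum>B\<in>Pow Basis. indicator (orthant_cube B x r) y * \<bar>p y - q\<bar>)"
              using B(1) by (intro member_le_sum) auto
            finally show ?thesis .
          qed (auto intro: sum_nonneg)
        qed
        also have "\<dots> = (\<Sum>B\<in>Pow Basis. LINT y:orthant_cube B x r|lborel. \<bar>p y - q\<bar>)"
          using i2 by (subst Bochner_Integration.integral_sum) (auto simp: set_lebesgue_integral_def)
        also have "\<dots> \<le> (\<Sum>B\<in>Pow (Basis::'a set). 2 * e * r ^ DIM('a))"
          using elim rd by (intro sum_mono) (auto simp: divide_less_eq less_imp_le)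
        also have "\<dots> = n * (2 * e) * r ^ DIM('a)" by (simp add: n_def)
        finally have A: "(LINT y:?b|lborel. \<bar>p y - q\<bar>) \<le> n * (2 * e) * r ^ DIM('a)" .
        have ip: "set_integrable lborel ?b p"
          using int unfolding set_integrable_def by (intro integrable_mult_indicator) auto
        have ic: "set_integrable lborel ?b (\<lambda>_. q)"
          unfolding set_integrable_def using emeasure_bounded_finite[of ?b]
          by (auto intro!: simp: integrable_indicator_iff)
        have "(LINT y:?b|lborel. p y) - q * measure lborel ?b = (LINT y:?b|lborel. p y - q)"
          using ip ic by (subst set_integral_diff) (auto simp: set_lebesgue_integral_def)
        also have "\<bar>\<dots>\<bar> \<le> (LINT y:?b|lborel. \<bar>p y - q\<bar>)"
          unfolding set_lebesgue_integral_def using i1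
          by (intro order_trans[OF integral_abs_bound]) (auto simp: abs_mult)
        finally have "\<bar>(LINT y:?b|lborel. p y) - q * measure lborel ?b\<bar> \<le> n * (2 * e) * r ^ DIM('a)"
          using A by linarith
        then have "\<bar>(LINT y:?b|lborel. p y) - q * measure lborel ?b\<bar> / measure lborel ?b
            \<le> n * (2 * e) * r ^ DIM('a) / measure lborel ?b"
          by (intro divide_right_mono) auto
        moreover have "(LINT y:?b|lborel. p y) / measure lborel ?b - q
            = ((LINT y:?b|lborel. p y) - q * measure lborel ?b) / measure lborel ?b"
          using r0 v by (simp add: vol diff_divide_distrib)
        then have "\<bar>(LINT y:?b|lborel. p y) / measure lborel ?b - q\<bar>
            = \<bar>(LINT y:?b|lborel. p y) - q * measure lborel ?b\<bar> / measure lborel ?b"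
          by (simp add: abs_divide)
        moreover have "n * (2 * e) * r ^ DIM('a) / measure lborel ?b = n * (2 * e) / v"
          using r0 v by (simp add: vol)
        ultimately have "\<bar>(LINT y:?b|lborel. p y) / measure lborel ?b - q\<bar> \<le> n * (2 * e) / v"
          by simp
        then show ?case using pq by linarith
      qed
    qed
    show ?case
    proof (rule tendstoI)
      fix e' :: real assume "0 < e'"
      define c where "c = n * 2 / v + 1"
      define e where "e = e' / (2 * c)"
      have c: "c > 0" using n v by (simp add: c_def add_nonneg_pos)
      have "n * (2 * e) / v + e = e * c" by (simp add: c_def algebra_simps)
      also have "\<dots> = e' / 2" using c by (simp add: e_def)
      finally have e: "e > 0" "n * (2 * e) / v + e = e' / 2"
        using \<open>0 < e'\<close> c by (simp_all add: e_def)
      show "\<forall>\<^sub>F r in at_right 0. dist ((LINT y:cball x r|lborel. p y) / measure lborel (cball x r)) (p x) < e'"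
        using main[OF e(1)] by eventually_elim (unfold dist_real_def, use e(2) \<open>0 < e'\<close> in linarith)
    qed
  qed
qed

section \<open>The sample of a density\<close>

lemma ball_vol_eq: "ball_vol TYPE('a::euclidean_space) r = unit_ball_vol DIM('a) * max 0 r ^ DIM('a)"
proof (cases "r \<ge> 0")
  case True
  then show ?thesis by (simp add: ball_vol_def content_ball)
next
  case False
  then show ?thesis by (simp add: ball_vol_def ball_empty)
qed

lemma ball_vol_nonneg [simp]: "0 \<le> ball_vol TYPE('a::euclidean_space) r"
  by (simp add: ball_vol_def)

lemma ball_vol_measurable [measurable]: "ball_vol TYPE('a::euclidean_space) \<in> borel_measurable borel"
  unfolding ball_vol_eq[abs_def] by measurable

lemma ball_vol_mono: "r \<le> r' \<Longrightarrow> ball_vol TYPE('a::euclidean_space) r \<le> ball_vol TYPE('a) r'"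
  unfolding ball_vol_eq by (intro mult_left_mono power_mono) auto

lemma ball_vol_pos: "0 < r \<Longrightarrow> 0 < ball_vol TYPE('a::euclidean_space) r"
  by (simp add: ball_vol_eq)

lemma measure_ball_eq_ball_vol: "measure lborel (ball (x::'a::euclidean_space) r) = ball_vol TYPE('a) r"
proof (cases "r \<ge> 0")
  case True
  then show ?thesis by (simp add: ball_vol_def content_ball)
next
  case False
  then show ?thesis by (simp add: ball_vol_def ball_empty)
qed

lemma unit_ball_vol_nonzero [simp]: "unit_ball_vol (real n) \<noteq> 0"
  by (metis less_irrefl of_nat_0_le_iff unit_ball_vol_pos)

text \<open>Inverse of \<open>ball_vol\<close> on the nonnegative reals as an explicit root, from
  which order and limits can be read off.\<close>

definition radius_of_vol :: "'a::euclidean_space itself \<Rightarrow> real \<Rightarrow> real" where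
  "radius_of_vol _ t = root DIM('a) (t / unit_ball_vol DIM('a))"

lemma radius_of_vol_nonneg [simp]: "0 \<le> t \<Longrightarrow> 0 \<le> radius_of_vol TYPE('a::euclidean_space) t"
  by (simp add: radius_of_vol_def)

lemma radius_of_vol_pos: "0 < t \<Longrightarrow> 0 < radius_of_vol TYPE('a::euclidean_space) t"
  by (simp add: radius_of_vol_def)

lemma ball_vol_radius_of_vol: "0 \<le> t \<Longrightarrow> ball_vol TYPE('a::euclidean_space) (radius_of_vol TYPE('a) t) = t"
  unfolding ball_vol_eq by (simp add: radius_of_vol_def max_absorb2)

lemma less_ball_vol_iff:
  assumes "0 \<le> t" "0 \<le> r"
  shows "t < ball_vol TYPE('a::euclidean_space) r \<longleftrightarrow> radius_of_vol TYPE('a) t < r"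
proof -
  have "radius_of_vol TYPE('a) t < r \<longleftrightarrow> radius_of_vol TYPE('a) t ^ DIM('a) < r ^ DIM('a)"
    using assms radius_of_vol_nonneg[OF assms(1), where 'a='a]
    by (metis DIM_positive power_less_imp_less_base power_strict_mono)
  also have "\<dots> \<longleftrightarrow> t < ball_vol TYPE('a) r"
    using assms by (simp add: radius_of_vol_def ball_vol_eq max_absorb2 divide_less_eq mult.commute)
  finally show ?thesis by simp
qed

lemma tendsto_radius_of_vol:
  assumes "(f \<longlongrightarrow> 0) F"
  shows "((\<lambda>x. radius_of_vol TYPE('a::euclidean_space) (f x)) \<longlongrightarrow> 0) F"
proof -
  have "((\<lambda>x. root DIM('a) (f x / unit_ball_vol DIM('a))) \<longlongrightarrow> root DIM('a) (0 / unit_ball_vol DIM('a))) F"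
    by (intro tendsto_intros assms) simp
  then show ?thesis by (simp add: radius_of_vol_def)
qed

section \<open>Tail probabilities of the volume statistic and their Gamma limit\<close>

locale knn_density =
  fixes p :: "'a::euclidean_space \<Rightarrow> real" and k :: nat
  assumes p_borel [measurable]: "p \<in> borel_measurable borel"
    and p_nonneg: "\<And>x. 0 \<le> p x"
    and p_total: "(\<integral>\<^sup>+ x. ennreal (p x) \<partial>lborel) = 1"
    and k_pos: "1 \<le> k"
begin

definition D :: "'a measure" where
  "D = density lborel (\<lambda>x. ennreal (p x))"

sublocale knn_sample D
proof -
  interpret prob_space D
    using p_total by (intro prob_spaceI) (simp add: D_def emeasure_density)
  show "knn_sample D"
    by unfold_locales (simp add: D_def)
qed

lemma emeasure_D_UNIV [simp]: "emeasure D UNIV = 1"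
  using emeasure_space_1 by simp

lemma AE_D_iff: "(AE x in D. P x) \<longleftrightarrow> (AE x in lborel. 0 < p x \<longrightarrow> P x)"
  unfolding D_def by (subst AE_density) auto

lemma integrable_p: "integrable lborel p"
  using p_total p_nonneg by (intro integrableI_nonneg) auto

lemma emeasure_D_lborel_null: "A \<in> sets borel \<Longrightarrow> emeasure lborel A = 0 \<Longrightarrow> emeasure D A = 0"
  unfolding D_def using absolutely_continuousI_density[of "\<lambda>x. ennreal (p x)" lborel]
  by (auto simp: absolutely_continuous_def null_sets_def)

lemma prob_set_integral: "A \<in> sets borel \<Longrightarrow> prob A = (LINT y:A|lborel. p y)"
proof -
  assume [measurable]: "A \<in> sets borel"
  have "emeasure D A = (\<integral>\<^sup>+y. ennreal (indicator A y * p y) \<partial>lborel)"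
    unfolding D_def by (subst emeasure_density) (auto intro!: nn_integral_cong split: split_indicator)
  also have "\<dots> = ennreal (\<integral>y. indicator A y * p y \<partial>lborel)"
    using integrable_mult_indicator[OF _ integrable_p, of A] p_nonneg by (intro nn_integral_eq_integral) auto
  finally show ?thesis
    using p_nonneg by (simp add: measure_def set_lebesgue_integral_def integral_nonneg)
qed

text \<open>The ball averages use open balls, the counting events closed ones; spheres are Lebesgue
  null, hence null under \<open>D\<close>.\<close>

lemma prob_ball_cball: "prob (ball x r) = prob (cball x r)"
proof -
  have "emeasure lborel (cball x r - ball x r) = 0"
  proof -
    have "cball x r - ball x r = sphere x r" by auto
    then show ?thesis
      using negligible_sphere[of x r] by (simp add: negligible_iff_null_sets null_sets_completion_iff null_setsD1)
  qed
  then have "prob (cball x r - ball x r) = 0"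
    by (simp add: measure_def emeasure_D_lborel_null)
  moreover have "prob (cball x r) = prob (ball x r) + prob (cball x r - ball x r)"
    using finite_measure_Union[of "ball x r" "cball x r - ball x r"] by (simp add: sets_D Un_absorb1 ball_subset_cball Un_Diff_cancel)
  ultimately show ?thesis by simp
qed

lemma AE_ball_ratio: "AE x in D. 0 < p x \<and> ((\<lambda>r. prob (cball x r) / ball_vol TYPE('a) r) \<longlongrightarrow> p x) (at_right 0)"
  unfolding AE_D_iff
  using lborel_ball_differentiation[OF p_borel integrable_p]
proof eventually_elim
  case (elim x)
  have "\<forall>\<^sub>F r in at_right 0. (LINT y:cball x r|lborel. p y) / measure lborel (cball x r) = prob (cball x r) / ball_vol TYPE('a) r"
    using eventually_at_right_less[of 0]
    by eventually_elim (simp add: prob_set_integral content_cball ball_vol_eq max_absorb2)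
  with elim show ?case by (auto intro: Lim_transform_eventually)
qed

text \<open>Version of \<open>U_stat\<close> that runs over sample indices instead of the set of
  sample points. It is measurable on the product space and agrees with \<open>U_stat\<close> on
  samples without repetitions.\<close>

definition U :: "nat \<Rightarrow> (nat \<Rightarrow> 'a) \<Rightarrow> nat \<Rightarrow> real" where
  "U m w i = (real m - 1) * ball_vol TYPE('a) (knn_radius k {1..m} w i)"

text \<open>The radius at which the normalised ball volume equals \<open>s\<close>; it turns
  thresholds for volumes into thresholds for distances.\<close>

definition \<rho> :: "nat \<Rightarrow> real \<Rightarrow> real" where
  "\<rho> m s = radius_of_vol TYPE('a) (s / (real m - 1))"

lemma \<rho>_limit: "(\<lambda>m. \<rho> m s) \<longlonglongrightarrow> 0"
  unfolding \<rho>_def by (intro tendsto_radius_of_vol) real_asymp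

lemma ball_vol_\<rho>: "0 \<le> s \<Longrightarrow> 2 \<le> m \<Longrightarrow> (real m - 1) * ball_vol TYPE('a) (\<rho> m s) = s"
  unfolding \<rho>_def by (subst ball_vol_radius_of_vol) auto

lemma \<rho>_pos: "0 < s \<Longrightarrow> 2 \<le> m \<Longrightarrow> 0 < \<rho> m s"
  unfolding \<rho>_def by (intro radius_of_vol_pos) auto

lemma knn_radius_nonneg:
  assumes "k < m" "i \<in> {1..m}"
  shows "0 \<le> knn_radius k {1..m} w i"
proof -
  have "k \<le> card ({1..m} - {i})" using assms by simp
  then obtain j where "kth_smallest k ({1..m} - {i}) (\<lambda>j. dist (w i) (w j)) = dist (w i) (w j)"
    using kth_smallest_attained[of "{1..m} - {i}" k "\<lambda>j. dist (w i) (w j)"] k_pos by auto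
  then show ?thesis by (simp add: knn_radius_def)
qed

lemma less_knn_radius_iff:
  assumes "k < m" "i \<in> {1..m}"
  shows "r < knn_radius k {1..m} w i \<longleftrightarrow> card {j\<in>{1..m} - {i}. w j \<in> cball (w i) r} < k"
  using kth_smallest_le_iff[of "{1..m} - {i}" k "\<lambda>j. dist (w i) (w j)" r] assms k_pos
  by (auto simp: knn_radius_def not_le[symmetric])

text \<open>The strict inequality goes with the closed ball: the k-th distance exceeds a radius
  exactly if fewer than \<open>k\<close> other points are within that radius, boundary
  included.\<close>

lemma less_U_iff:
  assumes m: "k < m" "i \<in> {1..m}" and s: "0 \<le> s"
  shows "s < U m w i \<longleftrightarrow> card {j\<in>{1..m} - {i}. w j \<in> cball (w i) (\<rho> m s)} < k"
proof -
  have m2: "real m - 1 > 0" using m k_pos by auto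
  have "s < U m w i \<longleftrightarrow> s / (real m - 1) < ball_vol TYPE('a) (knn_radius k {1..m} w i)"
    using m2 by (simp add: U_def divide_less_eq mult.commute)
  also have "\<dots> \<longleftrightarrow> \<rho> m s < knn_radius k {1..m} w i"
    unfolding \<rho>_def using m2 s knn_radius_nonneg[OF m] by (intro less_ball_vol_iff) auto
  finally show ?thesis using less_knn_radius_iff[OF m] by simp
qed

lemma measurable_knn_radius [measurable]:
  assumes "k < m" "i \<in> {1..m}"
  shows "(\<lambda>w. knn_radius k {1..m} w i) \<in> borel_measurable (sample {1..m})"
proof (rule borel_measurableI_greater)
  fix r
  have [measurable]: "(\<lambda>w. card {j\<in>{1..m} - {i}. w j \<in> cball (w i) r}) \<in> measurable (sample {1..m}) (count_space UNIV)"
    using assms by (intro measurable_count_cball) auto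
  show "{w \<in> space (sample {1..m}). r < knn_radius k {1..m} w i} \<in> sets (sample {1..m})"
    unfolding less_knn_radius_iff[OF assms] by measurable
qed

lemma measurable_U [measurable]:
  "k < m \<Longrightarrow> i \<in> {1..m} \<Longrightarrow> (\<lambda>w. U m w i) \<in> borel_measurable (sample {1..m})"
  unfolding U_def by measurable

lemma U_tail:
  assumes "k < m" "i \<in> {1..m}" "0 \<le> s"
  shows "(\<integral>\<^sup>+w. of_bool (s < U m w i) \<partial>sample {1..m})
    = (\<integral>\<^sup>+x. ennreal (binomial_below (m - 1) k (prob (cball x (\<rho> m s)))) \<partial>D)"
  unfolding less_U_iff[OF assms] using nn_integral_isolated[of "{1..m}" i "\<rho> m s" k] assms by simp

text \<open>Probability that a Gamma variable with shape \<open>k\<close> and rate \<open>l\<close>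
  exceeds \<open>s\<close>; equally, that a Poisson variable with mean \<open>s * l\<close> is below
  \<open>k\<close>.\<close>

definition Q :: "real \<Rightarrow> real \<Rightarrow> real" where
  "Q s l = (\<Sum>i<k. (s * l) ^ i * exp (- (s * l)) / fact i)"

lemma Q_bounds: "0 \<le> s \<Longrightarrow> 0 < l \<Longrightarrow> 0 \<le> Q s l \<and> Q s l \<le> 1"
  using erlang_CDF_nonneg[of l "k - 1" s] k_pos
  by (auto simp: erlang_CDF_def Q_def lessThan_Suc_atMost[symmetric] mult.commute intro!: sum_nonneg)

lemma Q_measurable [measurable]: "Q s \<in> borel_measurable borel"
  unfolding Q_def[abs_def] by measurable

text \<open>As (m - 1) times the ball volume is \<open>s\<close>, the expression is (m - c) / (m -
  1) * s times the average of the density over a shrinking ball. The offset \<open>c\<close>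
  accounts for sample points already integrated out.\<close>

lemma binomial_below_prob_limit:
  assumes s: "0 < s" and c: "c \<ge> 1"
    and lim: "((\<lambda>r. prob (cball x r) / ball_vol TYPE('a) r) \<longlongrightarrow> p x) (at_right 0)"
  shows "(\<lambda>m. real (m - c) * prob (cball x (\<rho> m s))) \<longlonglongrightarrow> s * p x"
proof -
  have "filterlim (\<lambda>m. \<rho> m s) (at_right 0) sequentially"
    unfolding filterlim_at using \<rho>_limit \<rho>_pos[OF s]
    by (auto intro!: eventually_mono[OF eventually_ge_at_top[of 2]] simp: less_imp_neq[symmetric])
  then have l1: "(\<lambda>m. prob (cball x (\<rho> m s)) / ball_vol TYPE('a) (\<rho> m s)) \<longlonglongrightarrow> p x"
    using lim filterlim_compose by blast
  have l2: "(\<lambda>m. (real m - real c) / (real m - 1) * s) \<longlonglongrightarrow> s"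
    by real_asymp
  have "(\<lambda>m. ((real m - real c) / (real m - 1) * s) * (prob (cball x (\<rho> m s)) / ball_vol TYPE('a) (\<rho> m s))) \<longlonglongrightarrow> s * p x"
    by (intro tendsto_mult l1 l2)
  moreover have "\<forall>\<^sub>F m in sequentially. ((real m - real c) / (real m - 1) * s) * (prob (cball x (\<rho> m s)) / ball_vol TYPE('a) (\<rho> m s))
      = real (m - c) * prob (cball x (\<rho> m s))"
    using eventually_ge_at_top[of "c + 2"]
  proof eventually_elim
    case (elim m)
    have cancel: "(x / d * t) * (P / b) = x * P" if "d * b = t" "0 < d" "0 < b" for x d t P b :: real
      using that by (auto simp: field_simps)
    have "ball_vol TYPE('a) (\<rho> m s) > 0"
      by (rule ball_vol_pos, rule \<rho>_pos[OF s]) (use elim in simp)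
    moreover have "(real m - 1) * ball_vol TYPE('a) (\<rho> m s) = s"
      by (rule ball_vol_\<rho>) (use s elim in simp_all)
    moreover have "real (m - c) = real m - real c" using elim by (simp add: of_nat_diff)
    ultimately show ?case
      using elim by (simp only: cancel)
  qed
  ultimately show ?thesis by (rule Lim_transform_eventually)
qed

lemma filterlim_minus_nat_at_top: "filterlim (\<lambda>m. m - c) at_top sequentially" for c :: nat
  unfolding filterlim_at_top
proof
  fix Z show "\<forall>\<^sub>F m in sequentially. Z \<le> m - c"
    using eventually_ge_at_top[of "Z + c"] by eventually_elim auto
qed

lemma prob_small_ball: "(\<lambda>m. prob (cball x (\<rho> m s))) \<longlonglongrightarrow> 0"
  if "0 < s" "((\<lambda>r. prob (cball x r) / ball_vol TYPE('a) r) \<longlongrightarrow> p x) (at_right 0)"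
proof -
  have "(\<lambda>m. real (m - 1) * prob (cball x (\<rho> m s)) / real (m - 1)) \<longlonglongrightarrow> 0"
    by (rule real_tendsto_divide_at_top[OF binomial_below_prob_limit[OF that(1) _ that(2)]
          filterlim_compose[OF filterlim_real_sequentially filterlim_minus_nat_at_top]]) simp
  moreover have "\<forall>\<^sub>F m in sequentially. real (m - 1) * prob (cball x (\<rho> m s)) / real (m - 1) = prob (cball x (\<rho> m s))"
    using eventually_ge_at_top[of 2] by eventually_elim auto
  ultimately show ?thesis by (rule Lim_transform_eventually)
qed

lemma binomial_below_ball_limit:
  assumes "0 < s" "c \<ge> 1" "((\<lambda>r. prob (cball x r) / ball_vol TYPE('a) r) \<longlongrightarrow> p x) (at_right 0)"
  shows "(\<lambda>m. binomial_below (m - c) k (prob (cball x (\<rho> m s)))) \<longlonglongrightarrow> Q s (p x)"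
proof -
  have "filterlim (\<lambda>m. m - c) at_top sequentially"
    by (rule filterlim_minus_nat_at_top)
  from binomial_below_poisson_limit[OF this binomial_below_prob_limit[OF assms]]
  show ?thesis by (simp add: Q_def)
qed

text \<open>Probability that one given point has normalised volume above \<open>s\<close>, by
  \<open>U_tail\<close>.\<close>

definition tail1 :: "nat \<Rightarrow> real \<Rightarrow> ennreal" where
  "tail1 m s = (\<integral>\<^sup>+x. ennreal (binomial_below (m - 1) k (prob (cball x (\<rho> m s)))) \<partial>D)"

text \<open>Upper bound for the probability that two given points both have volume above
  \<open>s\<close>. Pairs with overlapping balls are charged 1; for distinct centres this branch
  disappears as the radius shrinks.\<close>

definition tail2 :: "nat \<Rightarrow> real \<Rightarrow> ennreal" where
  "tail2 m s = (\<integral>\<^sup>+x. \<integral>\<^sup>+y. (if dist x y \<le> 2 * \<rho> m s then 1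
      else ennreal (trinomial_below (m - 2) k k (prob (cball x (\<rho> m s))) (prob (cball y (\<rho> m s))))) \<partial>D \<partial>D)"

definition limit_tail :: "real \<Rightarrow> real" where
  "limit_tail s = (\<integral>x. Q s (p x) \<partial>D)"

lemma AE_Q_bounds: "0 \<le> s \<Longrightarrow> AE x in D. 0 \<le> Q s (p x) \<and> Q s (p x) \<le> 1"
  unfolding AE_D_iff by (auto simp: Q_bounds)

lemma integrable_Q: "0 \<le> s \<Longrightarrow> integrable D (\<lambda>x. Q s (p x))"
  using AE_Q_bounds[of s] by (intro integrable_const_bound[where B=1]) auto

lemma limit_tail_nonneg: "0 \<le> s \<Longrightarrow> 0 \<le> limit_tail s"
  unfolding limit_tail_def using AE_Q_bounds[of s] by (intro integral_nonneg_AE) auto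

lemma nn_integral_Q: "0 \<le> s \<Longrightarrow> (\<integral>\<^sup>+x. ennreal (Q s (p x)) \<partial>D) = ennreal (limit_tail s)"
  unfolding limit_tail_def using AE_Q_bounds[of s] by (intro nn_integral_eq_integral integrable_Q) auto

lemma tail1_limit:
  assumes s: "0 < s"
  shows "(\<lambda>m. tail1 m s) \<longlonglongrightarrow> ennreal (limit_tail s)"
proof -
  have "AE x in D. (\<lambda>m. ennreal (binomial_below (m - 1) k (prob (cball x (\<rho> m s))))) \<longlonglongrightarrow> ennreal (Q s (p x))"
    using AE_ball_ratio by eventually_elim (auto intro!: tendsto_ennrealI binomial_below_ball_limit s)
  then have "(\<lambda>m. tail1 m s) \<longlonglongrightarrow> (\<integral>\<^sup>+x. ennreal (Q s (p x)) \<partial>D)"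
    unfolding tail1_def
    by (intro nn_integral_dominated_convergence[where w="\<lambda>_. 1"])
       (auto simp: binomial_below_bounds emeasure_space_1)
  then show ?thesis using s by (simp add: nn_integral_Q)
qed

lemma prob_far_cballs:
  assumes "2 * r < dist x y"
  shows "prob (cball x r) + prob (cball y r) \<le> 1"
  using finite_measure_Union[of "cball x r" "cball y r"] disjoint_cballs[OF assms]
    prob_le_1[of "cball x r \<union> cball y r"] by (simp add: sets_D)

text \<open>Distinct centres have disjoint balls eventually. The distance to the product of binomial
  tails is at most (m - 2) q q', where (m - 2) q converges and q' tends to 0.\<close>

lemma trinomial_below_ball_limit:
  assumes s: "0 < s" and "x \<noteq> y"
    and x: "((\<lambda>r. prob (cball x r) / ball_vol TYPE('a) r) \<longlongrightarrow> p x) (at_right 0)"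
    and y: "((\<lambda>r. prob (cball y r) / ball_vol TYPE('a) r) \<longlongrightarrow> p y) (at_right 0)"
  shows "(\<lambda>m. if dist x y \<le> 2 * \<rho> m s then 1
      else ennreal (trinomial_below (m - 2) k k (prob (cball x (\<rho> m s))) (prob (cball y (\<rho> m s)))))
    \<longlonglongrightarrow> ennreal (Q s (p x)) * ennreal (Q s (p y))"
proof -
  let ?q = "\<lambda>x m. prob (cball x (\<rho> m s))"
  let ?t = "\<lambda>m. trinomial_below (m - 2) k k (?q x m) (?q y m)"
  let ?b = "\<lambda>x m. binomial_below (m - 2) k (?q x m)"
  have "(\<lambda>m. 2 * \<rho> m s) \<longlonglongrightarrow> 0"
    using tendsto_mult_right_zero[OF \<rho>_limit] by simp
  from order_tendstoD(2)[OF this, of "dist x y"] \<open>x \<noteq> y\<close>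
  have far: "\<forall>\<^sub>F m in sequentially. 2 * \<rho> m s < dist x y"
    by simp
  have "(\<lambda>m. (real (m - 2) * ?q x m) * ?q y m) \<longlonglongrightarrow> (s * p x) * 0"
    by (intro tendsto_mult binomial_below_prob_limit prob_small_ball s x y) auto
  then have err: "(\<lambda>m. (real (m - 2) * ?q x m) * ?q y m) \<longlonglongrightarrow> 0" by simp
  have "(\<lambda>m. ?t m - ?b x m * ?b y m) \<longlonglongrightarrow> 0"
  proof (rule Lim_null_comparison[OF _ err])
    show "\<forall>\<^sub>F m in sequentially. norm (?t m - ?b x m * ?b y m) \<le> (real (m - 2) * ?q x m) * ?q y m"
      using far
    proof eventually_elim
      case (elim m)
      then have "?q x m + ?q y m \<le> 1"
        by (rule prob_far_cballs)
      then show ?case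
        using trinomial_below_near_product[of "?q x m" "?q y m" "m - 2" k k] by (simp add: mult.assoc)
    qed
  qed
  moreover have "(\<lambda>m. ?b x m * ?b y m) \<longlonglongrightarrow> Q s (p x) * Q s (p y)"
    by (intro tendsto_mult binomial_below_ball_limit s x y) auto
  ultimately have "(\<lambda>m. (?t m - ?b x m * ?b y m) + ?b x m * ?b y m) \<longlonglongrightarrow> 0 + Q s (p x) * Q s (p y)"
    by (rule tendsto_add)
  then have "(\<lambda>m. ennreal (?t m)) \<longlonglongrightarrow> ennreal (Q s (p x) * Q s (p y))"
    by (intro tendsto_ennrealI) simp
  moreover have "\<forall>\<^sub>F m in sequentially. ennreal (?t m) = (if dist x y \<le> 2 * \<rho> m s then 1 else ennreal (?t m))"
    using far by eventually_elim auto
  ultimately have "(\<lambda>m. if dist x y \<le> 2 * \<rho> m s then 1 else ennreal (?t m)) \<longlonglongrightarrow> ennreal (Q s (p x) * Q s (p y))"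
    by (rule Lim_transform_eventually)
  moreover have "0 \<le> Q s (p x)"
    unfolding Q_def using s p_nonneg[of x] by (auto intro!: sum_nonneg)
  ultimately show ?thesis by (simp add: ennreal_mult')
qed

lemma tail2_limit:
  assumes s: "0 < s"
  shows "(\<lambda>m. tail2 m s) \<longlonglongrightarrow> ennreal (limit_tail s ^ 2)"
proof -
  let ?F = "\<lambda>m x y. if dist x y \<le> 2 * \<rho> m s then 1
      else ennreal (trinomial_below (m - 2) k k (prob (cball x (\<rho> m s))) (prob (cball y (\<rho> m s))))"
  have F1: "?F m x y \<le> 1" for m x y
  proof (cases "dist x y \<le> 2 * \<rho> m s")
    case False
    then have "prob (cball x (\<rho> m s)) + prob (cball y (\<rho> m s)) \<le> 1"
      by (intro prob_far_cballs) simp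
    then show ?thesis
      using trinomial_below_bounds[of "prob (cball x (\<rho> m s))" "prob (cball y (\<rho> m s))" "m - 2" k k] by auto
  qed simp
  have [measurable]: "(\<lambda>y. ?F m x y) \<in> borel_measurable borel" for m x
    by measurable
  have [measurable]: "(\<lambda>(x, y). ?F m x y) \<in> borel_measurable (borel \<Otimes>\<^sub>M borel)" for m
    by measurable
  have [measurable]: "(\<lambda>x. \<integral>\<^sup>+y. ?F m x y \<partial>D) \<in> borel_measurable borel" for m
    by measurable
  \<comment> \<open>The limit of the trinomial needs distinct centres; this costs nothing, as single
    points are null.\<close>
  have nz: "AE y in D. y \<noteq> x" for x
    unfolding AE_D_iff using AE_lborel_singleton[of x] by eventually_elim auto
  have inner: "AE x in D. (\<lambda>m. \<integral>\<^sup>+y. ?F m x y \<partial>D) \<longlonglongrightarrow> ennreal (Q s (p x)) * ennreal (limit_tail s)"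
    using AE_ball_ratio
  proof eventually_elim
    case (elim x)
    have "AE y in D. (\<lambda>m. ?F m x y) \<longlonglongrightarrow> ennreal (Q s (p x)) * ennreal (Q s (p y))"
      using AE_ball_ratio nz[of x] by eventually_elim (rule trinomial_below_ball_limit[OF s], use elim in auto)
    then have "(\<lambda>m. \<integral>\<^sup>+y. ?F m x y \<partial>D) \<longlonglongrightarrow> (\<integral>\<^sup>+y. ennreal (Q s (p x)) * ennreal (Q s (p y)) \<partial>D)"
      using F1 by (intro nn_integral_dominated_convergence[where w="\<lambda>_. 1"]) (auto simp: emeasure_space_1)
    then show ?case using s by (simp add: nn_integral_cmult nn_integral_Q)
  qed
  have "(\<integral>\<^sup>+y. ?F m x y \<partial>D) \<le> 1" for m x
    using nn_integral_mono[of D "?F m x" "\<lambda>_. 1"] F1 by (simp add: emeasure_space_1)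
  then have "(\<lambda>m. tail2 m s) \<longlonglongrightarrow> (\<integral>\<^sup>+x. ennreal (Q s (p x)) * ennreal (limit_tail s) \<partial>D)"
    unfolding tail2_def using inner
    by (intro nn_integral_dominated_convergence[where w="\<lambda>_. 1"]) (auto simp: emeasure_space_1)
  also have "(\<integral>\<^sup>+x. ennreal (Q s (p x)) * ennreal (limit_tail s) \<partial>D) = ennreal (limit_tail s ^ 2)"
    using s limit_tail_nonneg[of s] by (simp add: nn_integral_multc nn_integral_Q power2_eq_square ennreal_mult)
  finally show ?thesis .
qed

end

declare One_nat_def [simp del]
  \<comment> \<open>otherwise the index sets \<open>{1..m}\<close> are rewritten to \<open>{Suc 0..m}\<close>\<close>

text \<open>Expanding the square leaves \<open>m\<close> diagonal and fewer than m^2 off-diagonal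
  terms, all with weight 1 / m^2. A diagonal bound that grows with \<open>m\<close> is therefore
  affordable as long as it is of smaller order than \<open>m\<close>.\<close>

lemma sum_square_L2_bound:
  fixes F :: "'b \<Rightarrow> nat \<Rightarrow> real" and A B :: ennreal
  assumes m: "0 < m" and F0: "\<And>w i. 0 \<le> F w i"
    and meas: "\<And>i. i \<in> {1..m} \<Longrightarrow> (\<lambda>w. F w i) \<in> borel_measurable P"
    and diag: "\<And>i. i \<in> {1..m} \<Longrightarrow> (\<integral>\<^sup>+w. ennreal ((F w i)\<^sup>2) \<partial>P) \<le> A"
    and off: "\<And>i j. i \<in> {1..m} \<Longrightarrow> j \<in> {1..m} \<Longrightarrow> i \<noteq> j \<Longrightarrow> (\<integral>\<^sup>+w. ennreal (F w i * F w j) \<partial>P) \<le> B"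
  shows "(\<integral>\<^sup>+w. ennreal (((\<Sum>i\<in>{1..m}. F w i) / real m)\<^sup>2) \<partial>P) \<le> ennreal (1 / real m) * A + B"
proof -
  let ?c = "ennreal (1 / real m)"
  have eq: "ennreal (((\<Sum>i\<in>{1..m}. F w i) / real m)\<^sup>2) = ?c * ?c * (\<Sum>i\<in>{1..m}. \<Sum>j\<in>{1..m}. ennreal (F w i * F w j))" for w
  proof -
    have "((\<Sum>i\<in>{1..m}. F w i) / real m)\<^sup>2 = 1 / real m * (1 / real m) * (\<Sum>i\<in>{1..m}. \<Sum>j\<in>{1..m}. F w i * F w j)"
      by (simp add: power2_eq_square sum_product)
    also have "ennreal \<dots> = ?c * ?c * ennreal (\<Sum>i\<in>{1..m}. \<Sum>j\<in>{1..m}. F w i * F w j)"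
      using F0 by (simp only: ennreal_mult sum_nonneg mult_nonneg_nonneg zero_le_divide_1_iff of_nat_0_le_iff)
    also have "ennreal (\<Sum>i\<in>{1..m}. \<Sum>j\<in>{1..m}. F w i * F w j) = (\<Sum>i\<in>{1..m}. \<Sum>j\<in>{1..m}. ennreal (F w i * F w j))"
      using F0 by (simp add: sum_ennreal sum_nonneg flip: sum_ennreal)
    finally show ?thesis .
  qed
  have meas2: "(\<lambda>w. ennreal (F w i * F w j)) \<in> borel_measurable P" if "i \<in> {1..m}" "j \<in> {1..m}" for i j
    using meas[OF that(1)] meas[OF that(2)] by measurable
  have "(\<integral>\<^sup>+w. ennreal (((\<Sum>i\<in>{1..m}. F w i) / real m)\<^sup>2) \<partial>P)
      = ?c * ?c * (\<integral>\<^sup>+w. (\<Sum>i\<in>{1..m}. \<Sum>j\<in>{1..m}. ennreal (F w i * F w j)) \<partial>P)"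
    unfolding eq by (rule nn_integral_cmult) (intro borel_measurable_sum meas2)
  also have "(\<integral>\<^sup>+w. (\<Sum>i\<in>{1..m}. \<Sum>j\<in>{1..m}. ennreal (F w i * F w j)) \<partial>P)
      = (\<Sum>i\<in>{1..m}. \<integral>\<^sup>+w. (\<Sum>j\<in>{1..m}. ennreal (F w i * F w j)) \<partial>P)"
    by (rule nn_integral_sum) (intro borel_measurable_sum meas2)
  also have "\<dots> = (\<Sum>i\<in>{1..m}. \<Sum>j\<in>{1..m}. \<integral>\<^sup>+w. ennreal (F w i * F w j) \<partial>P)"
    by (intro sum.cong refl nn_integral_sum meas2)
  \<comment> \<open>Charging \<open>B\<close> on the diagonal too makes all rows alike and produces
    exactly m^2 copies of it.\<close>
  also have "\<dots> \<le> (\<Sum>i\<in>{1..m}. \<Sum>j\<in>{1..m}. (if j = i then A else 0) + B)"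
  proof (intro sum_mono)
    fix i j assume ij: "i \<in> {1..m}" "j \<in> {1..m}"
    show "(\<integral>\<^sup>+w. ennreal (F w i * F w j) \<partial>P) \<le> (if j = i then A else 0) + B"
    proof (cases "j = i")
      case True
      then show ?thesis using diag[OF ij(1)] by (simp add: power2_eq_square add_increasing2)
    next
      case False
      then show ?thesis using off[OF ij] by auto
    qed
  qed
  also have "\<dots> = (\<Sum>i\<in>{1..m}. A + of_nat m * B)"
    by (intro sum.cong refl) (simp add: sum.distrib)
  also have "?c * ?c * \<dots> = (?c * of_nat m) * (?c * A) + (?c * of_nat m) * (?c * of_nat m) * B"
    by (simp add: distrib_left distrib_right mult_ac)
  also have "?c * of_nat m = 1"
    using m by (simp add: ennreal_of_nat_eq_real_of_nat ennreal_mult[symmetric])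
  finally show ?thesis by (simp add: mult_left_mono)
qed

section \<open>Mean-square convergence of the tail fraction\<close>

context knn_density
begin

lemma nn_integral_both_tails:
  assumes "k < m" "i \<in> {1..m}" "j \<in> {1..m}" "i \<noteq> j" "0 \<le> s"
  shows "(\<integral>\<^sup>+w. of_bool (s < U m w i) * of_bool (s < U m w j) \<partial>sample {1..m}) \<le> tail2 m s"
proof -
  have "(\<integral>\<^sup>+w. of_bool (s < U m w i) * of_bool (s < U m w j) \<partial>sample {1..m})
     = (\<integral>\<^sup>+w. of_bool (card {l\<in>{1..m} - {i}. w l \<in> cball (w i) (\<rho> m s)} < k \<and>
             card {l\<in>{1..m} - {j}. w l \<in> cball (w j) (\<rho> m s)} < k) \<partial>sample {1..m})"
    using assms by (intro nn_integral_cong) (simp only: less_U_iff of_bool_conj)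
  also have "\<dots> \<le> tail2 m s"
    unfolding tail2_def using nn_integral_both_isolated[of "{1..m}" i j "\<rho> m s" k, unfolded card_atLeastAtMost diff_Suc_1] assms
    by blast
  finally show ?thesis .
qed

text \<open>Second-moment method. The fraction has mean \<open>tail1 m s\<close>, tending to the
  limit tail, and second moment at most 1 / m + \<open>tail2 m s\<close>, tending to its square; so
  the expanded mean square error tends to 0.\<close>

lemma tail_fraction_L2:
  assumes s: "0 < s"
  shows "(\<lambda>m. \<integral>\<^sup>+w. ennreal (((\<Sum>i\<in>{1..m}. of_bool (s < U m w i)) / real m - limit_tail s)\<^sup>2) \<partial>sample {1..m}) \<longlonglongrightarrow> 0"
proof -
  define \<tau> where "\<tau> = limit_tail s"
  have \<tau>: "0 \<le> \<tau>" using s by (simp add: \<tau>_def limit_tail_nonneg)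
  define R where "R = (\<lambda>m. (ennreal (1 / real m) + tail2 m s + ennreal (\<tau>\<^sup>2)) - ennreal (2 * \<tau>) * tail1 m s)"
  have bound: "(\<integral>\<^sup>+w. ennreal (((\<Sum>i\<in>{1..m}. of_bool (s < U m w i)) / real m - \<tau>)\<^sup>2) \<partial>sample {1..m}) \<le> R m"
    if m: "k < m" for m
  proof -
    define A :: "(nat \<Rightarrow> 'a) \<Rightarrow> real"
      where "A = (\<lambda>w. (\<Sum>i\<in>{1..m}. of_bool (s < U m w i)) / real m)"
    let ?P = "sample {1..m}"
    interpret P: prob_space ?P by (rule prob_space_sample)
    have m0: "real m > 0" using m by simp
    have Um [measurable]: "(\<lambda>w. U m w i) \<in> borel_measurable ?P" if "i \<in> {1..m}" for i
      using m that by measurable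
    have ob: "(\<lambda>w. of_bool (s < U m w i) :: ennreal) \<in> borel_measurable ?P"
      if [measurable]: "i \<in> {1..m}" for i
      by measurable
    have Am [measurable]: "A \<in> borel_measurable ?P"
      unfolding A_def by (intro borel_measurable_divide borel_measurable_sum) (use Um in auto)
    have A0: "0 \<le> A w" for w unfolding A_def by (auto intro!: divide_nonneg_nonneg sum_nonneg)
    have Aeq: "ennreal (A w) = ennreal (1 / real m) * (\<Sum>i\<in>{1..m}. of_bool (s < U m w i))" for w
    proof -
      have "ennreal (A w) = ennreal (1 / real m) * ennreal (\<Sum>i\<in>{1..m}. of_bool (s < U m w i))"
        unfolding A_def by (subst ennreal_mult[symmetric]) (auto intro!: sum_nonneg)
      also have "ennreal (\<Sum>i\<in>{1..m}. of_bool (s < U m w i)) = (\<Sum>i\<in>{1..m}. ennreal (of_bool (s < U m w i)))"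
        by (subst sum_ennreal) auto
      also have "\<dots> = (\<Sum>i\<in>{1..m}. of_bool (s < U m w i))"
        by (intro sum.cong) auto
      finally show ?thesis .
    qed
    have Y: "(\<integral>\<^sup>+w. ennreal (A w) \<partial>?P) = tail1 m s"
    proof -
      have "(\<integral>\<^sup>+w. ennreal (A w) \<partial>?P) = ennreal (1 / real m) * (\<Sum>i\<in>{1..m}. \<integral>\<^sup>+w. of_bool (s < U m w i) \<partial>?P)"
        unfolding Aeq using ob
        by (subst nn_integral_cmult, intro borel_measurable_sum, assumption)
           (subst nn_integral_sum, assumption, rule refl)
      also have "\<dots> = ennreal (1 / real m) * (\<Sum>i\<in>{1..m}. tail1 m s)"
        using m s by (intro arg_cong2[where f="(*)"] sum.cong refl) (simp only: tail1_def U_tail less_imp_le)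
      also have "\<dots> = (ennreal (1 / real m) * ennreal (real m)) * tail1 m s"
        by (simp add: mult.assoc ennreal_of_nat_eq_real_of_nat)
      also have "ennreal (1 / real m) * ennreal (real m) = 1"
        using m0 by (subst ennreal_mult[symmetric]) auto
      finally show ?thesis by simp
    qed
    have X: "(\<integral>\<^sup>+w. ennreal ((A w)\<^sup>2) \<partial>?P) \<le> ennreal (1 / real m) + tail2 m s"
    proof -
      have "(\<integral>\<^sup>+w. ennreal ((A w)\<^sup>2) \<partial>?P) \<le> ennreal (1 / real m) * 1 + tail2 m s"
        unfolding A_def
      proof (rule sum_square_L2_bound)
        show "(\<lambda>w. of_bool (s < U m w i) :: real) \<in> borel_measurable ?P" if [measurable]: "i \<in> {1..m}" for i
          by measurable
        show "(\<integral>\<^sup>+w. ennreal ((of_bool (s < U m w i))\<^sup>2) \<partial>?P) \<le> 1" for i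
        proof -
          have "(\<integral>\<^sup>+w. ennreal ((of_bool (s < U m w i))\<^sup>2) \<partial>?P) \<le> (\<integral>\<^sup>+w. 1 \<partial>?P)"
            by (intro nn_integral_mono) auto
          then show ?thesis using P.emeasure_space_1 by simp
        qed
        show "(\<integral>\<^sup>+w. ennreal (of_bool (s < U m w i) * of_bool (s < U m w j)) \<partial>?P) \<le> tail2 m s"
          if "i \<in> {1..m}" "j \<in> {1..m}" "i \<noteq> j" for i j
        proof -
          have "(\<integral>\<^sup>+w. ennreal (of_bool (s < U m w i) * of_bool (s < U m w j)) \<partial>?P)
            = (\<integral>\<^sup>+w. of_bool (s < U m w i) * of_bool (s < U m w j) \<partial>?P)"
            by (intro nn_integral_cong) auto
          then show ?thesis using nn_integral_both_tails[OF m that] s by simp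
        qed
      qed (use m in auto)
      then show ?thesis by simp
    qed
    \<comment> \<open>Subtraction in \<open>ennreal\<close> is truncated, so the cross term of the
      expanded square stands on the left as a summand; it is subtracted only at the end, when it is
      known to be finite.\<close>
    have Z: "(\<integral>\<^sup>+w. ennreal ((A w - \<tau>)\<^sup>2) \<partial>?P) + ennreal (2 * \<tau>) * tail1 m s
       = (\<integral>\<^sup>+w. ennreal ((A w - \<tau>)\<^sup>2) + ennreal (2 * \<tau>) * ennreal (A w) \<partial>?P)"
      unfolding Y[symmetric] by (subst nn_integral_add) (auto simp: nn_integral_cmult)
    also have "\<dots> = (\<integral>\<^sup>+w. ennreal ((A w)\<^sup>2) + ennreal (\<tau>\<^sup>2) \<partial>?P)"
    proof (intro nn_integral_cong)
      fix w
      have "ennreal ((A w - \<tau>)\<^sup>2) + ennreal (2 * \<tau>) * ennreal (A w) = ennreal ((A w - \<tau>)\<^sup>2 + 2 * \<tau> * A w)"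
        using A0[of w] \<tau> by (subst ennreal_plus) (auto simp: ennreal_mult)
      also have "(A w - \<tau>)\<^sup>2 + 2 * \<tau> * A w = (A w)\<^sup>2 + \<tau>\<^sup>2"
        by (simp add: power2_eq_square algebra_simps)
      also have "ennreal \<dots> = ennreal ((A w)\<^sup>2) + ennreal (\<tau>\<^sup>2)"
        by (rule ennreal_plus) auto
      finally show "ennreal ((A w - \<tau>)\<^sup>2) + ennreal (2 * \<tau>) * ennreal (A w) = ennreal ((A w)\<^sup>2) + ennreal (\<tau>\<^sup>2)" .
    qed
    also have "\<dots> = (\<integral>\<^sup>+w. ennreal ((A w)\<^sup>2) \<partial>?P) + ennreal (\<tau>\<^sup>2)"
      by (subst nn_integral_add) (auto simp: P.emeasure_space_1)
    also have "\<dots> \<le> ennreal (1 / real m) + tail2 m s + ennreal (\<tau>\<^sup>2)"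
      using X by (intro add_right_mono)
    finally have le: "(\<integral>\<^sup>+w. ennreal ((A w - \<tau>)\<^sup>2) \<partial>?P) + ennreal (2 * \<tau>) * tail1 m s
      \<le> ennreal (1 / real m) + tail2 m s + ennreal (\<tau>\<^sup>2)" .
    have "tail1 m s \<le> (\<integral>\<^sup>+x. 1 \<partial>D)"
      unfolding tail1_def by (intro nn_integral_mono) (simp add: binomial_below_bounds)
    then have "ennreal (2 * \<tau>) * tail1 m s \<noteq> \<top>"
      by (auto simp: ennreal_mult_eq_top_iff top_unique)
    then have "(\<integral>\<^sup>+w. ennreal ((A w - \<tau>)\<^sup>2) \<partial>?P)
        = ((\<integral>\<^sup>+w. ennreal ((A w - \<tau>)\<^sup>2) \<partial>?P) + ennreal (2 * \<tau>) * tail1 m s) - ennreal (2 * \<tau>) * tail1 m s"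
      by simp
    also have "\<dots> \<le> R m"
      unfolding R_def using le by (intro ennreal_minus_mono) auto
    finally show ?thesis unfolding A_def .
  qed
  have "(\<lambda>m. ennreal (1 / real m)) \<longlonglongrightarrow> ennreal 0"
    by (intro tendsto_ennrealI) real_asymp
  then have "R \<longlonglongrightarrow> (ennreal 0 + ennreal (\<tau>\<^sup>2) + ennreal (\<tau>\<^sup>2)) - ennreal (2 * \<tau>) * ennreal \<tau>"
    unfolding R_def using tail1_limit[OF s] tail2_limit[OF s]
    by (intro tendsto_diff_ennreal tendsto_add ennreal_tendsto_cmult tendsto_const) (auto simp: \<tau>_def ennreal_mult_eq_top_iff)
  also have "(ennreal 0 + ennreal (\<tau>\<^sup>2) + ennreal (\<tau>\<^sup>2)) - ennreal (2 * \<tau>) * ennreal \<tau> = 0"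
    using \<tau> by (simp add: ennreal_mult[symmetric] ennreal_plus[symmetric] power2_eq_square mult.assoc del: ennreal_plus)
  finally have R0: "R \<longlonglongrightarrow> 0" .
  show ?thesis
    unfolding \<tau>_def[symmetric]
    by (rule tendsto_sandwich[OF _ eventually_mono[OF eventually_gt_at_top[of k] bound] tendsto_const R0]) auto
qed

section \<open>Averages of the density over balls\<close>

definition avg :: "'a \<Rightarrow> real \<Rightarrow> real" where
  "avg x r = prob (cball x r) / ball_vol TYPE('a) r"

lemma avg_ennreal:
  assumes "0 < r"
  shows "emeasure (density lborel (\<lambda>y. ennreal (p y))) (ball x r) / emeasure lborel (ball x r) = ennreal (avg x r)"
proof -
  have "emeasure lborel (ball x r) = ennreal (ball_vol TYPE('a) r)"
    using assms by (simp add: emeasure_ball ball_vol_eq max_absorb2)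
  then show ?thesis
    using ball_vol_pos[OF assms, where 'a='a]
    by (simp add: D_def[symmetric] emeasure_eq_measure prob_ball_cball avg_def divide_ennreal)
qed

lemma max_avg_eq: "max_avg p r x = (SUP r'\<in>{0<..r}. ennreal (avg x r'))"
  unfolding max_avg_def by (intro SUP_cong refl avg_ennreal) simp

lemma min_avg_eq: "min_avg p r x = (INF r'\<in>{0<..r}. ennreal (avg x r'))"
  unfolding min_avg_def by (intro INF_cong refl avg_ennreal) simp

lemma scaled_prob_eq_avg:
  assumes "0 < s" "2 \<le> m"
  shows "real (m - 1) * prob (cball x (\<rho> m s)) = s * avg x (\<rho> m s)"
proof -
  have "0 < ball_vol TYPE('a) (\<rho> m s)" using \<rho>_pos[OF assms] by (rule ball_vol_pos)
  then have "real (m - 1) * prob (cball x (\<rho> m s)) = ((real m - 1) * ball_vol TYPE('a) (\<rho> m s)) * avg x (\<rho> m s)"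
    using assms by (simp add: avg_def of_nat_diff)
  then show ?thesis
    using ball_vol_\<rho>[of s m] assms by simp
qed

text \<open>If the centres converge, the indicators of the balls converge off the limiting sphere,
  which is null; dominated convergence does the rest.\<close>

lemma continuous_prob_cball: "continuous_on UNIV (\<lambda>x. prob (cball x r))"
proof (subst continuous_on_sequentially, intro ballI allI impI, elim conjE)
  fix u :: "nat \<Rightarrow> 'a" and x assume u: "u \<longlonglongrightarrow> x"
  have lim: "(\<lambda>n. indicator (cball (u n) r) y :: real) \<longlonglongrightarrow> indicator (cball x r) y" if y: "y \<notin> sphere x r" for y
  proof -
    have d: "(\<lambda>n. dist (u n) y) \<longlonglongrightarrow> dist x y" by (intro tendsto_intros u)
    have "\<forall>\<^sub>F n in sequentially. (indicator (cball x r) y :: real) = indicator (cball (u n) r) y"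
    proof (cases "dist x y < r")
      case True
      from order_tendstoD(2)[OF d this] show ?thesis
        by eventually_elim (use True in auto)
    next
      case False
      with y have f: "r < dist x y" by auto
      from order_tendstoD(1)[OF d this] show ?thesis
        by eventually_elim (use f in auto)
    qed
    then show ?thesis by (rule tendsto_eventually[OF eventually_mono]) simp
  qed
  have "AE y in D. y \<notin> sphere x r"
  proof -
    have "sphere x r \<in> null_sets lborel"
      using negligible_sphere[of x r] by (simp add: negligible_iff_null_sets null_sets_completion_iff)
    then have "sphere x r \<in> null_sets D"
      using emeasure_D_lborel_null[of "sphere x r"] by (simp add: null_sets_def sets_D)
    then show ?thesis by (rule AE_not_in)
  qed
  then have "AE y in D. (\<lambda>n. indicator (cball (u n) r) y :: real) \<longlonglongrightarrow> indicator (cball x r) y"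
    by eventually_elim (rule lim)
  then have "(\<lambda>n. \<integral>y. indicator (cball (u n) r) y \<partial>D) \<longlonglongrightarrow> (\<integral>y. (indicator (cball x r) y :: real) \<partial>D)"
    by (intro integral_dominated_convergence[where w="\<lambda>_. 1"]) (auto simp: sets_D intro!: borel_measurable_indicator)
  then show "((\<lambda>x. prob (cball x r)) \<circ> u) \<longlonglongrightarrow> prob (cball x r)"
    by (simp add: o_def)
qed

lemma continuous_avg: "continuous_on UNIV (\<lambda>x. avg x r)"
  unfolding avg_def divide_inverse by (intro continuous_intros continuous_prob_cball)

text \<open>The supremum runs over uncountably many radii. Each average is continuous in the centre,
  so strict superlevel sets are unions of open sets; the minimal average is treated dually.\<close>

lemma max_avg_measurable [measurable]: "max_avg p r \<in> borel_measurable borel"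
proof (rule borel_measurableI_greater)
  fix c
  have "{x\<in>space borel. c < max_avg p r x} = (\<Union>r'\<in>{0<..r}. {x. c < ennreal (avg x r')})"
    by (auto simp: max_avg_eq less_SUP_iff)
  also have "open \<dots>"
    by (intro open_UN ballI open_Collect_less continuous_on_const continuous_on_ennreal continuous_avg)
  finally show "{x\<in>space borel. c < max_avg p r x} \<in> sets borel" by simp
qed

lemma min_avg_measurable [measurable]: "min_avg p r \<in> borel_measurable borel"
proof (rule borel_measurableI_less)
  fix c
  have "{x\<in>space borel. min_avg p r x < c} = (\<Union>r'\<in>{0<..r}. {x. ennreal (avg x r') < c})"
    by (auto simp: min_avg_eq INF_less_iff)
  also have "open \<dots>"
    by (intro open_UN ballI open_Collect_less continuous_on_const continuous_on_ennreal continuous_avg)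
  finally show "{x\<in>space borel. min_avg p r x < c} \<in> sets borel" by simp
qed

lemma avg_le_max_avg: "0 < r' \<Longrightarrow> r' \<le> r \<Longrightarrow> ennreal (avg x r') \<le> max_avg p r x"
  unfolding max_avg_eq by (intro SUP_upper) auto

lemma min_avg_le_avg: "0 < r' \<Longrightarrow> r' \<le> r \<Longrightarrow> min_avg p r x \<le> ennreal (avg x r')"
  unfolding min_avg_eq by (intro INF_lower) auto

text \<open>The averages over small balls converge to p x, and all of them lie between the two
  extremes.\<close>

lemma AE_density_between_avgs:
  assumes r: "0 < r"
  shows "AE x in D. min_avg p r x \<le> ennreal (p x) \<and> ennreal (p x) \<le> max_avg p r x"
  using AE_ball_ratio
proof eventually_elim
  case (elim x)
  then have lim: "((\<lambda>r. ennreal (avg x r)) \<longlongrightarrow> ennreal (p x)) (at_right 0)"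
    unfolding avg_def by (intro tendsto_ennrealI) auto
  have ev: "\<forall>\<^sub>F r' in at_right 0. 0 < r' \<and> r' \<le> r"
    using r unfolding eventually_at_right_field by (intro exI[of _ r]) auto
  show ?case
  proof
    show "min_avg p r x \<le> ennreal (p x)"
      by (rule tendsto_lowerbound[OF lim eventually_mono[OF ev]]) (auto intro: min_avg_le_avg)
    show "ennreal (p x) \<le> max_avg p r x"
      by (rule tendsto_upperbound[OF lim eventually_mono[OF ev]]) (auto intro: avg_le_max_avg)
  qed
qed

end

section \<open>Moments of the volume statistic\<close>

text \<open>A crude layer-cake formula: on the interval from v to 2 v the integrand is at least (2
  v)^(\<beta> - 1), which gives v^\<beta> up to the constant. The exact formula would divide by
  \<beta> and exclude \<beta> = 0. The upper limit \<open>2 * \<epsilon>\<close> leaves room for 2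
  v.\<close>

lemma powr_le_integral_low:
  fixes \<beta> v \<epsilon> :: real
  assumes "\<beta> \<le> 0" "0 < v"
  shows "ennreal (v powr \<beta>) * of_bool (v \<le> \<epsilon>)
    \<le> ennreal (2 powr (1 - \<beta>)) * (\<integral>\<^sup>+s. ennreal (s powr (\<beta> - 1)) * indicator {0<..2 * \<epsilon>} s * of_bool (v \<le> s) \<partial>lborel)"
proof (cases "v \<le> \<epsilon>")
  case True
  have "ennreal (v powr \<beta>) = ennreal (2 powr (1 - \<beta>)) * (ennreal ((2 * v) powr (\<beta> - 1)) * ennreal v)"
    using assms by (simp add: ennreal_mult[symmetric] powr_mult powr_diff)
  also have "ennreal ((2 * v) powr (\<beta> - 1)) * ennreal v
      = (\<integral>\<^sup>+s. ennreal ((2 * v) powr (\<beta> - 1)) * indicator {v..2 * v} s \<partial>lborel)"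
    using assms by (subst nn_integral_cmult_indicator) auto
  also have "\<dots> \<le> (\<integral>\<^sup>+s. ennreal (s powr (\<beta> - 1)) * indicator {0<..2 * \<epsilon>} s * of_bool (v \<le> s) \<partial>lborel)"
    using assms True
    by (intro nn_integral_mono) (auto split: split_indicator intro!: ennreal_leI powr_mono2')
  finally show ?thesis using True by (simp add: mult_left_mono)
qed simp

text \<open>The same device on the interval from v / 2 to v, hence the lower limit
  \<open>K / 2\<close>. Writing the integrand as s^\<beta> / s and bounding numerator and
  denominator separately treats both signs of \<beta> - 1 at once.\<close>

lemma powr_le_integral_high:
  fixes \<beta> v K :: real
  assumes "0 \<le> \<beta>" "0 < v"
  shows "ennreal (v powr \<beta>) * of_bool (K < v)
    \<le> ennreal (2 powr (\<beta> + 1)) * (\<integral>\<^sup>+s. ennreal (s powr (\<beta> - 1)) * indicator {K / 2<..} s * of_bool (0 < s \<and> s < v) \<partial>lborel)"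
proof (cases "K < v")
  case True
  have "ennreal (v powr \<beta>) = ennreal (2 powr (\<beta> + 1)) * (ennreal ((v / 2) powr \<beta> / v) * ennreal (v / 2))"
    using assms by (simp add: ennreal_mult[symmetric] powr_divide powr_add)
  also have "ennreal ((v / 2) powr \<beta> / v) * ennreal (v / 2)
      = (\<integral>\<^sup>+s. ennreal ((v / 2) powr \<beta> / v) * indicator {v / 2<..<v} s \<partial>lborel)"
    using assms by (subst nn_integral_cmult_indicator) auto
  also have "\<dots> \<le> (\<integral>\<^sup>+s. ennreal (s powr (\<beta> - 1)) * indicator {K / 2<..} s * of_bool (0 < s \<and> s < v) \<partial>lborel)"
  proof (intro nn_integral_mono)
    fix s
    have "(v / 2) powr \<beta> / v \<le> s powr (\<beta> - 1)" if "v / 2 < s" "s < v"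
    proof -
      have "(v / 2) powr \<beta> / v \<le> s powr \<beta> / s"
        using that assms by (intro frac_le powr_mono2) auto
      then show ?thesis using that assms by (simp add: powr_diff)
    qed
    then show "ennreal ((v / 2) powr \<beta> / v) * indicator {v / 2<..<v} s
      \<le> ennreal (s powr (\<beta> - 1)) * indicator {K / 2<..} s * of_bool (0 < s \<and> s < v)"
      using assms True by (auto split: split_indicator intro!: ennreal_leI)
  qed
  finally show ?thesis using True by (simp add: mult_left_mono)
qed simp

lemma nn_integral_Gamma_scaled:
  fixes \<beta> c :: real
  assumes \<beta>: "0 < \<beta>" and c: "0 < c"
  shows "(\<integral>\<^sup>+s. ennreal (indicator {0..} s * s powr (\<beta> - 1) * exp (- (c * s))) \<partial>lborel) = ennreal (Gamma \<beta> / c powr \<beta>)"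
proof -
  have "(\<integral>\<^sup>+t. ennreal (indicator {0..} t * t powr (\<beta> - 1) / exp t) \<partial>lborel)
      = ennreal c * (\<integral>\<^sup>+s. ennreal (indicator {0..} (0 + c * s) * (0 + c * s) powr (\<beta> - 1) / exp (0 + c * s)) \<partial>lborel)"
    using c by (subst nn_integral_real_affine[where c=c and t=0]) auto
  also have "\<dots> = (\<integral>\<^sup>+s. ennreal c * ennreal (indicator {0..} (0 + c * s) * (0 + c * s) powr (\<beta> - 1) / exp (0 + c * s)) \<partial>lborel)"
    by (subst nn_integral_cmult) auto
  also have "\<dots> = (\<integral>\<^sup>+s. ennreal (c powr \<beta>) * ennreal (indicator {0..} s * s powr (\<beta> - 1) * exp (- (c * s))) \<partial>lborel)"
  proof (intro nn_integral_cong)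
    fix s
    have "c * ((c * s) powr (\<beta> - 1) / exp (c * s)) = c powr \<beta> * (s powr (\<beta> - 1) * exp (- (c * s)))" if "0 \<le> s"
      using c that by (simp add: powr_mult powr_diff exp_minus field_simps)
    then show "ennreal c * ennreal (indicator {0..} (0 + c * s) * (0 + c * s) powr (\<beta> - 1) / exp (0 + c * s))
      = ennreal (c powr \<beta>) * ennreal (indicator {0..} s * s powr (\<beta> - 1) * exp (- (c * s)))"
      using c by (auto split: split_indicator simp: ennreal_mult[symmetric] zero_le_mult_iff)
  qed
  also have "\<dots> = ennreal (c powr \<beta>) * (\<integral>\<^sup>+s. ennreal (indicator {0..} s * s powr (\<beta> - 1) * exp (- (c * s))) \<partial>lborel)"
    by (subst nn_integral_cmult) auto
  finally have *: "ennreal (Gamma \<beta>) = ennreal (c powr \<beta>) * (\<integral>\<^sup>+s. ennreal (indicator {0..} s * s powr (\<beta> - 1) * exp (- (c * s))) \<partial>lborel)"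
    using Gamma_conv_nn_integral_real[OF \<beta>] by simp
  have "ennreal (Gamma \<beta> / c powr \<beta>) = ennreal (1 / c powr \<beta>) * ennreal (Gamma \<beta>)"
    using \<beta> by (subst ennreal_mult[symmetric]) (auto simp: Gamma_real_pos less_imp_le)
  also have "\<dots> = (ennreal (1 / c powr \<beta>) * ennreal (c powr \<beta>)) * (\<integral>\<^sup>+s. ennreal (indicator {0..} s * s powr (\<beta> - 1) * exp (- (c * s))) \<partial>lborel)"
    by (simp only: * mult.assoc)
  also have "ennreal (1 / c powr \<beta>) * ennreal (c powr \<beta>) = 1"
    using c by (subst ennreal_mult[symmetric]) auto
  finally show ?thesis by simp
qed

text \<open>The moment of order \<beta> of a Gamma law; \<open>fact (k - 1)\<close> is the Gamma
  function at \<open>k\<close>. For negative \<beta> the singularity at 0 is integrable because of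
  \<open>0 < real k + \<beta>\<close>.\<close>

lemma nn_integral_erlang_powr:
  fixes \<beta> l :: real
  assumes k: "1 \<le> k" "0 < real k + \<beta>" and l: "0 < l"
  shows "(\<integral>\<^sup>+u. ennreal (u powr \<beta>) * ennreal (erlang_density (k - 1) l u) \<partial>lborel)
    = ennreal (Gamma (real k + \<beta>) / fact (k - 1)) * ennreal (l powr (- \<beta>))"
proof -
  have "(\<integral>\<^sup>+u. ennreal (u powr \<beta>) * ennreal (erlang_density (k - 1) l u) \<partial>lborel)
    = (\<integral>\<^sup>+u. ennreal (l ^ k / fact (k - 1)) * ennreal (indicator {0..} u * u powr ((real k + \<beta>) - 1) * exp (- (l * u))) \<partial>lborel)"
  proof (intro nn_integral_cong)
    fix u :: real
    have eq: "u powr \<beta> * (l ^ k * u ^ (k - 1) * exp (- l * u) / fact (k - 1))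
      = l ^ k / fact (k - 1) * (u powr (real k + \<beta> - 1) * exp (- (l * u)))" if "0 < u"
    proof -
      have "u powr (real k + \<beta> - 1) = u powr \<beta> * u powr real (k - 1)"
        using k by (simp add: powr_add[symmetric] of_nat_diff algebra_simps)
      then show ?thesis using that by (simp add: powr_realpow)
    qed
    have k': "Suc (k - 1) = k" using k by simp
    consider "u < 0" | "u = 0" | "0 < u" by linarith
    then show "ennreal (u powr \<beta>) * ennreal (erlang_density (k - 1) l u)
      = ennreal (l ^ k / fact (k - 1)) * ennreal (indicator {0..} u * u powr ((real k + \<beta>) - 1) * exp (- (l * u)))"
    proof cases
      case 3
      then show ?thesis
        using l eq by (subst (1 2) ennreal_mult[symmetric]) (auto simp: erlang_density_def k')
    qed (auto simp: erlang_density_def)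
  qed
  also have "\<dots> = ennreal (l ^ k / fact (k - 1)) * ennreal (Gamma (real k + \<beta>) / l powr (real k + \<beta>))"
    using k l by (subst nn_integral_cmult) (auto simp: nn_integral_Gamma_scaled)
  also have "\<dots> = ennreal (Gamma (real k + \<beta>) / fact (k - 1)) * ennreal (l powr (- \<beta>))"
  proof -
    have "l ^ k / fact (k - 1) * (Gamma (real k + \<beta>) / l powr (real k + \<beta>))
      = Gamma (real k + \<beta>) / fact (k - 1) * l powr (- \<beta>)"
      using l by (simp add: powr_add powr_minus powr_realpow field_simps)
    moreover have "0 \<le> Gamma (real k + \<beta>)" using k by (simp add: Gamma_real_pos less_imp_le)
    ultimately show ?thesis
      using l by (simp add: ennreal_mult[symmetric])
  qed
  finally show ?thesis .
qed

section \<open>Moments of small volumes and of large volumes with a near neighbour\<close>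

context knn_density
begin

lemma U_head:
  assumes m: "k < m" "i \<in> {1..m}" and s: "0 < s"
  shows "(\<integral>\<^sup>+w. of_bool (U m w i \<le> s) \<partial>sample {1..m}) = 1 - tail1 m s"
    "(\<integral>\<^sup>+w. of_bool (U m w i \<le> s) \<partial>sample {1..m})
      = (\<integral>\<^sup>+x. ennreal (1 - binomial_below (m - 1) k (prob (cball x (\<rho> m s)))) \<partial>D)"
proof -
  let ?P = "sample {1..m}"
  let ?q = "\<lambda>x. prob (cball x (\<rho> m s))"
  interpret P: prob_space ?P by (rule prob_space_sample)
  have [measurable]: "(\<lambda>w. U m w i) \<in> borel_measurable ?P" using m by measurable
  have "(\<integral>\<^sup>+w. of_bool (U m w i \<le> s) \<partial>?P) + (\<integral>\<^sup>+w. of_bool (s < U m w i) \<partial>?P)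
    = (\<integral>\<^sup>+w. of_bool (U m w i \<le> s) + of_bool (s < U m w i) \<partial>?P)"
    by (intro nn_integral_add[symmetric]) measurable
  also have "\<dots> = (\<integral>\<^sup>+w. 1 \<partial>?P)" by (intro nn_integral_cong) auto
  also have "\<dots> = 1" using P.emeasure_space_1 by simp
  finally have 1: "(\<integral>\<^sup>+w. of_bool (U m w i \<le> s) \<partial>?P) + tail1 m s = 1"
    using U_tail[OF m, of s] s by (simp add: tail1_def)
  have "(\<integral>\<^sup>+x. ennreal (1 - binomial_below (m - 1) k (?q x)) \<partial>D) + tail1 m s
    = (\<integral>\<^sup>+x. ennreal (1 - binomial_below (m - 1) k (?q x)) + ennreal (binomial_below (m - 1) k (?q x)) \<partial>D)"
    unfolding tail1_def by (intro nn_integral_add[symmetric]) measurable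
  also have "\<dots> = (\<integral>\<^sup>+x. 1 \<partial>D)"
    by (intro nn_integral_cong) (simp add: ennreal_plus[symmetric] binomial_below_bounds del: ennreal_plus)
  also have "\<dots> = 1" by simp
  finally have 2: "(\<integral>\<^sup>+x. ennreal (1 - binomial_below (m - 1) k (?q x)) \<partial>D) + tail1 m s = 1" .
  have "tail1 m s \<noteq> \<top>" using 1 by (metis ennreal_add_eq_top ennreal_one_neq_top)
  then show "(\<integral>\<^sup>+w. of_bool (U m w i \<le> s) \<partial>?P) = 1 - tail1 m s"
    "(\<integral>\<^sup>+w. of_bool (U m w i \<le> s) \<partial>?P) = (\<integral>\<^sup>+x. ennreal (1 - binomial_below (m - 1) k (?q x)) \<partial>D)"
    using 1 2 by (metis ennreal_add_diff_cancel_right)+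
qed

text \<open>The union bound \<open>binomial_below_ge\<close> gives the k-th power of (m - 1) times
  the ball probability, that is of \<open>s\<close> times an average, and averages over radii up to
  \<open>r\<close> are at most \<open>max_avg\<close>.\<close>

lemma U_lower_tail:
  assumes m: "k < m" "i \<in> {1..m}" and s: "0 < s" and r: "\<rho> m s \<le> r"
  shows "(\<integral>\<^sup>+w. of_bool (U m w i \<le> s) \<partial>sample {1..m}) \<le> ennreal (s ^ k) * (\<integral>\<^sup>+x. max_avg p r x ^ k \<partial>D)"
proof -
  let ?q = "\<lambda>x. prob (cball x (\<rho> m s))"
  have m2: "2 \<le> m" using m k_pos by simp
  have "(\<integral>\<^sup>+w. of_bool (U m w i \<le> s) \<partial>sample {1..m}) = (\<integral>\<^sup>+x. ennreal (1 - binomial_below (m - 1) k (?q x)) \<partial>D)"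
    by (rule U_head[OF m s])
  also have "\<dots> \<le> (\<integral>\<^sup>+x. ennreal (s ^ k) * max_avg p r x ^ k \<partial>D)"
  proof (intro nn_integral_mono)
    fix x
    note eq = scaled_prob_eq_avg[OF s m2, of x]
    have "ennreal (1 - binomial_below (m - 1) k (?q x)) \<le> ennreal ((real (m - 1) * ?q x) ^ k)"
      by (intro ennreal_leI binomial_below_ge) auto
    also have "\<dots> = ennreal (s ^ k) * ennreal (avg x (\<rho> m s)) ^ k"
    proof -
      have "0 \<le> avg x (\<rho> m s)" by (simp add: avg_def)
      then show ?thesis
        using s unfolding eq power_mult_distrib by (simp add: ennreal_mult ennreal_power)
    qed
    also have "\<dots> \<le> ennreal (s ^ k) * max_avg p r x ^ k"
      using avg_le_max_avg[OF \<rho>_pos[OF s m2] r] by (intro mult_left_mono power_mono) auto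
    finally show "ennreal (1 - binomial_below (m - 1) k (?q x)) \<le> ennreal (s ^ k) * max_avg p r x ^ k" .
  qed
  also have "\<dots> = ennreal (s ^ k) * (\<integral>\<^sup>+x. max_avg p r x ^ k \<partial>D)"
    by (rule nn_integral_cmult) measurable
  finally show ?thesis .
qed

text \<open>Integrating the tail bound s^k against s^(\<beta> - 1) gives the exponent k + \<beta> -
  1, integrable at 0. The result is uniform in \<open>m\<close> and small with \<epsilon>; with
  \<beta> = 2 a it is where k > - 2 a enters.\<close>

lemma U_lower_moment:
  assumes m: "k < m" "i \<in> {1..m}" and \<epsilon>: "0 < \<epsilon>" and r: "\<rho> m (2 * \<epsilon>) \<le> r"
    and \<beta>: "\<beta> \<le> 0" "0 < real k + \<beta>"
  shows "(\<integral>\<^sup>+w. ennreal (U m w i powr \<beta>) * of_bool (0 < U m w i \<and> U m w i \<le> \<epsilon>) \<partial>sample {1..m})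
    \<le> ennreal (2 powr (1 - \<beta>)) * (ennreal ((2 * \<epsilon>) powr (real k + \<beta>) / (real k + \<beta>)) * (\<integral>\<^sup>+x. max_avg p r x ^ k \<partial>D))"
proof -
  let ?P = "sample {1..m}" and ?K = "\<integral>\<^sup>+x. max_avg p r x ^ k \<partial>D"
  let ?g = "\<lambda>s. ennreal (s powr (\<beta> - 1)) * indicator {0<..2 * \<epsilon>} s"
  interpret P: prob_space ?P by (rule prob_space_sample)
  interpret PL: pair_sigma_finite lborel ?P ..
  have [measurable]: "(\<lambda>w. U m w i) \<in> borel_measurable ?P" using m by measurable
  have "(\<integral>\<^sup>+w. ennreal (U m w i powr \<beta>) * of_bool (0 < U m w i \<and> U m w i \<le> \<epsilon>) \<partial>?P)
     \<le> (\<integral>\<^sup>+w. ennreal (2 powr (1 - \<beta>)) * (\<integral>\<^sup>+s. ?g s * of_bool (U m w i \<le> s) \<partial>lborel) \<partial>?P)"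
  proof (intro nn_integral_mono)
    fix w
    show "ennreal (U m w i powr \<beta>) * of_bool (0 < U m w i \<and> U m w i \<le> \<epsilon>)
      \<le> ennreal (2 powr (1 - \<beta>)) * (\<integral>\<^sup>+s. ?g s * of_bool (U m w i \<le> s) \<partial>lborel)"
      using powr_le_integral_low[OF \<beta>(1), of "U m w i" \<epsilon>] by (cases "0 < U m w i") auto
  qed
  also have "\<dots> = ennreal (2 powr (1 - \<beta>)) * (\<integral>\<^sup>+w. \<integral>\<^sup>+s. ?g s * of_bool (U m w i \<le> s) \<partial>lborel \<partial>?P)"
    by (rule nn_integral_cmult) measurable
  also have "(\<integral>\<^sup>+w. \<integral>\<^sup>+s. ?g s * of_bool (U m w i \<le> s) \<partial>lborel \<partial>?P)
      = (\<integral>\<^sup>+s. \<integral>\<^sup>+w. ?g s * of_bool (U m w i \<le> s) \<partial>?P \<partial>lborel)"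
    by (rule PL.Fubini') measurable
  also have "\<dots> \<le> (\<integral>\<^sup>+s. ennreal (indicator {0..2 * \<epsilon>} s * s powr (real k + \<beta> - 1)) * ?K \<partial>lborel)"
  proof (intro nn_integral_mono)
    fix s
    show "(\<integral>\<^sup>+w. ?g s * of_bool (U m w i \<le> s) \<partial>?P) \<le> ennreal (indicator {0..2 * \<epsilon>} s * s powr (real k + \<beta> - 1)) * ?K"
    proof (cases "s \<in> {0<..2 * \<epsilon>}")
      case True
      have "\<rho> m s \<le> \<rho> m (2 * \<epsilon>)"
        unfolding \<rho>_def radius_of_vol_def using True m
        by (intro real_root_le_mono divide_right_mono) auto
      then have "\<rho> m s \<le> r" using r by simp
      have "(\<integral>\<^sup>+w. ?g s * of_bool (U m w i \<le> s) \<partial>?P) = ?g s * (\<integral>\<^sup>+w. of_bool (U m w i \<le> s) \<partial>?P)"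
        by (rule nn_integral_cmult) measurable
      also have "\<dots> \<le> ?g s * (ennreal (s ^ k) * ?K)"
        using True \<open>\<rho> m s \<le> r\<close> by (intro mult_left_mono U_lower_tail m) auto
      also have "\<dots> = ennreal (s powr (\<beta> - 1) * s ^ k) * ?K"
        using True by (simp add: ennreal_mult mult.assoc)
      also have "s powr (\<beta> - 1) * s ^ k = s powr (real k + \<beta> - 1)"
        using True by (simp add: powr_realpow[symmetric] powr_add[symmetric] algebra_simps)
      finally show ?thesis using True by simp
    qed simp
  qed
  also have "\<dots> = (\<integral>\<^sup>+s. ennreal (indicator {0..2 * \<epsilon>} s * s powr (real k + \<beta> - 1)) \<partial>lborel) * ?K"
    by (rule nn_integral_multc) measurable
  also have "(\<integral>\<^sup>+s. ennreal (indicator {0..2 * \<epsilon>} s * s powr (real k + \<beta> - 1)) \<partial>lborel)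
      = ennreal ((2 * \<epsilon>) powr (real k + \<beta>) / (real k + \<beta>))"
    using has_integral_powr_from_0[of "real k + \<beta> - 1" "2 * \<epsilon>"] \<beta> \<epsilon>
    by (subst nn_integral_has_integral_lebesgue) auto
  finally show ?thesis by (simp add: mult_left_mono)
qed

text \<open>Bound, independent of the sample size, for the probability that the volume exceeds
  \<open>s\<close> although the k-th neighbour is within \<open>r\<close>: the Chernoff bound with
  the average replaced by its minimum.\<close>

definition near_tail :: "real \<Rightarrow> real \<Rightarrow> ennreal" where
  "near_tail r s = (\<integral>\<^sup>+x. ennreal (2 ^ k * exp (- (enn2real (min_avg p r x) / 2 * s))) \<partial>D)"

lemma min_avg_finite: "0 < r \<Longrightarrow> min_avg p r x < \<top>"
  using min_avg_le_avg[of r r x] by (auto simp: less_top[symmetric] top_unique)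

lemma near_tail_measurable [measurable]: "near_tail r \<in> borel_measurable borel"
proof -
  have "(\<lambda>s. \<integral>\<^sup>+x. ennreal (2 ^ k * exp (- (enn2real (min_avg p r x) / 2 * s))) \<partial>D) \<in> borel_measurable borel"
    by measurable
  then show ?thesis by (simp add: near_tail_def[abs_def])
qed

text \<open>If the radius belonging to \<open>s\<close> exceeds \<open>r\<close>, the event is
  empty. Otherwise that radius takes part in the infimum \<open>min_avg\<close>, which bounds the
  Chernoff exponent.\<close>

lemma U_near_upper_tail:
  assumes m: "k < m" "i \<in> {1..m}" and s: "0 < s" and r: "0 < r"
  shows "(\<integral>\<^sup>+w. of_bool (s < U m w i \<and> knn_radius k {1..m} w i \<le> r) \<partial>sample {1..m}) \<le> near_tail r s"
proof (cases "\<rho> m s \<le> r")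
  case False
  have "\<not> (s < U m w i \<and> knn_radius k {1..m} w i \<le> r)" for w
    using False less_U_iff[OF m, of s w] less_knn_radius_iff[OF m, of "\<rho> m s" w] s by auto
  then have "(\<integral>\<^sup>+w. of_bool (s < U m w i \<and> knn_radius k {1..m} w i \<le> r) \<partial>sample {1..m}) = (\<integral>\<^sup>+w. 0 \<partial>sample {1..m})"
    by (intro nn_integral_cong) (simp only: of_bool_eq)
  then show ?thesis by (simp only: nn_integral_const mult_zero_left zero_le)
next
  case True
  have m2: "2 \<le> m" using m k_pos by simp
  have "(\<integral>\<^sup>+w. of_bool (s < U m w i \<and> knn_radius k {1..m} w i \<le> r) \<partial>sample {1..m})
    \<le> (\<integral>\<^sup>+w. of_bool (s < U m w i) \<partial>sample {1..m})"
    by (intro nn_integral_mono) auto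
  also have "\<dots> = (\<integral>\<^sup>+x. ennreal (binomial_below (m - 1) k (prob (cball x (\<rho> m s)))) \<partial>D)"
    using s by (intro U_tail m) auto
  also have "\<dots> \<le> near_tail r s"
    unfolding near_tail_def
  proof (intro nn_integral_mono ennreal_leI)
    fix x
    let ?q = "prob (cball x (\<rho> m s))"
    note eq = scaled_prob_eq_avg[OF s m2, of x]
    have "enn2real (min_avg p r x) \<le> avg x (\<rho> m s)"
      using min_avg_le_avg[OF \<rho>_pos[OF s m2] True, of x]
      by (intro enn2real_leI) (auto simp: avg_def)
    then have "enn2real (min_avg p r x) / 2 * s \<le> real (m - 1) * ?q / 2"
      unfolding eq using s by (simp add: mult.commute)
    then have le: "2 ^ k * exp (- (real (m - 1) * ?q / 2)) \<le> 2 ^ k * exp (- (enn2real (min_avg p r x) / 2 * s))"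
      by simp
    show "binomial_below (m - 1) k ?q \<le> 2 ^ k * exp (- (enn2real (min_avg p r x) / 2 * s))"
      by (rule order_trans[OF binomial_below_le_exp le]) auto
  qed
  finally show ?thesis .
qed

lemma U_near_upper_moment:
  assumes m: "k < m" "i \<in> {1..m}" and r: "0 < r" and \<beta>: "0 \<le> \<beta>" and K: "0 < K"
  shows "(\<integral>\<^sup>+w. ennreal (U m w i powr \<beta>) * of_bool (K < U m w i \<and> knn_radius k {1..m} w i \<le> r) \<partial>sample {1..m})
    \<le> ennreal (2 powr (\<beta> + 1)) * (\<integral>\<^sup>+s. ennreal (s powr (\<beta> - 1)) * indicator {K / 2<..} s * near_tail r s \<partial>lborel)"
proof -
  let ?P = "sample {1..m}"
  let ?g = "\<lambda>s. ennreal (s powr (\<beta> - 1)) * indicator {K / 2<..} s"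
  let ?N = "\<lambda>w. knn_radius k {1..m} w i \<le> r"
  interpret P: prob_space ?P by (rule prob_space_sample)
  interpret PL: pair_sigma_finite lborel ?P ..
  have [measurable]: "(\<lambda>w. U m w i) \<in> borel_measurable ?P" "(\<lambda>w. knn_radius k {1..m} w i) \<in> borel_measurable ?P"
    using m by measurable
  have "(\<integral>\<^sup>+w. ennreal (U m w i powr \<beta>) * of_bool (K < U m w i \<and> ?N w) \<partial>?P)
     \<le> (\<integral>\<^sup>+w. ennreal (2 powr (\<beta> + 1)) * (\<integral>\<^sup>+s. ?g s * of_bool (s < U m w i \<and> ?N w) \<partial>lborel) \<partial>?P)"
  proof (intro nn_integral_mono)
    fix w
    show "ennreal (U m w i powr \<beta>) * of_bool (K < U m w i \<and> ?N w)
      \<le> ennreal (2 powr (\<beta> + 1)) * (\<integral>\<^sup>+s. ?g s * of_bool (s < U m w i \<and> ?N w) \<partial>lborel)"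
    proof (cases "K < U m w i \<and> ?N w")
      case True
      then have "ennreal (U m w i powr \<beta>) * of_bool (K < U m w i \<and> ?N w)
        \<le> ennreal (2 powr (\<beta> + 1)) * (\<integral>\<^sup>+s. ?g s * of_bool (0 < s \<and> s < U m w i) \<partial>lborel)"
        using powr_le_integral_high[OF \<beta>, of "U m w i" K] K by auto
      also have "\<dots> \<le> ennreal (2 powr (\<beta> + 1)) * (\<integral>\<^sup>+s. ?g s * of_bool (s < U m w i \<and> ?N w) \<partial>lborel)"
        using True by (intro mult_left_mono nn_integral_mono) auto
      finally show ?thesis .
    next
      case False
      then show ?thesis by (simp only: of_bool_eq mult_zero_right zero_le)
    qed
  qed
  also have "\<dots> = ennreal (2 powr (\<beta> + 1)) * (\<integral>\<^sup>+w. \<integral>\<^sup>+s. ?g s * of_bool (s < U m w i \<and> ?N w) \<partial>lborel \<partial>?P)"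
    by (rule nn_integral_cmult) measurable
  also have "(\<integral>\<^sup>+w. \<integral>\<^sup>+s. ?g s * of_bool (s < U m w i \<and> ?N w) \<partial>lborel \<partial>?P)
      = (\<integral>\<^sup>+s. \<integral>\<^sup>+w. ?g s * of_bool (s < U m w i \<and> ?N w) \<partial>?P \<partial>lborel)"
    by (rule PL.Fubini') measurable
  also have "\<dots> \<le> (\<integral>\<^sup>+s. ?g s * near_tail r s \<partial>lborel)"
  proof (intro nn_integral_mono)
    fix s
    show "(\<integral>\<^sup>+w. ?g s * of_bool (s < U m w i \<and> ?N w) \<partial>?P) \<le> ?g s * near_tail r s"
    proof (cases "K / 2 < s")
      case True
      have "(\<integral>\<^sup>+w. ?g s * of_bool (s < U m w i \<and> ?N w) \<partial>?P) = ?g s * (\<integral>\<^sup>+w. of_bool (s < U m w i \<and> ?N w) \<partial>?P)"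
        by (rule nn_integral_cmult) measurable
      also have "\<dots> \<le> ?g s * near_tail r s"
        using True K by (intro mult_left_mono U_near_upper_tail m r) auto
      finally show ?thesis .
    qed simp
  qed
  finally show ?thesis by (simp add: mult_left_mono)
qed

text \<open>After exchanging the integrals the inner one is a Gamma integral with rate half the
  minimal average, so the whole is a constant times its moment of order - \<beta>.\<close>

lemma near_tail_integral_finite:
  assumes \<beta>: "0 < \<beta>" and pos: "AE x in D. 0 < enn2real (min_avg p r x)"
    and fin: "(\<integral>\<^sup>+x. ennreal (enn2real (min_avg p r x) powr (- \<beta>)) \<partial>D) < \<infinity>"
  shows "(\<integral>\<^sup>+s. ennreal (s powr (\<beta> - 1)) * indicator {0<..} s * near_tail r s \<partial>lborel) < \<infinity>"
proof -
  let ?c = "\<lambda>x. enn2real (min_avg p r x) / 2"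
  interpret DL: pair_sigma_finite D lborel ..
  have "(\<integral>\<^sup>+s. ennreal (s powr (\<beta> - 1)) * indicator {0<..} s * near_tail r s \<partial>lborel)
    = (\<integral>\<^sup>+s. \<integral>\<^sup>+x. ennreal (s powr (\<beta> - 1)) * indicator {0<..} s * ennreal (2 ^ k * exp (- (?c x * s))) \<partial>D \<partial>lborel)"
    unfolding near_tail_def by (intro nn_integral_cong nn_integral_cmult[symmetric]) measurable
  also have "\<dots> = (\<integral>\<^sup>+x. \<integral>\<^sup>+s. ennreal (s powr (\<beta> - 1)) * indicator {0<..} s * ennreal (2 ^ k * exp (- (?c x * s))) \<partial>lborel \<partial>D)"
    by (rule DL.Fubini') measurable
  also have "\<dots> \<le> (\<integral>\<^sup>+x. ennreal (2 ^ k * Gamma \<beta> * 2 powr \<beta>) * ennreal (enn2real (min_avg p r x) powr (- \<beta>)) \<partial>D)"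
  proof (intro nn_integral_mono_AE, use pos in eventually_elim)
    fix x assume c: "0 < enn2real (min_avg p r x)"
    have "(\<integral>\<^sup>+s. ennreal (s powr (\<beta> - 1)) * indicator {0<..} s * ennreal (2 ^ k * exp (- (?c x * s))) \<partial>lborel)
      \<le> (\<integral>\<^sup>+s. ennreal (2 ^ k) * ennreal (indicator {0..} s * s powr (\<beta> - 1) * exp (- (?c x * s))) \<partial>lborel)"
      by (intro nn_integral_mono) (auto simp: ennreal_mult[symmetric] mult_ac split: split_indicator)
    also have "\<dots> = ennreal (2 ^ k) * ennreal (Gamma \<beta> / ?c x powr \<beta>)"
      using c \<beta> by (subst nn_integral_cmult, measurable) (subst nn_integral_Gamma_scaled, simp_all)
    also have "\<dots> = ennreal (2 ^ k * Gamma \<beta> * 2 powr \<beta>) * ennreal (enn2real (min_avg p r x) powr (- \<beta>))"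
      using c Gamma_real_pos[OF \<beta>]
      by (subst (1 2) ennreal_mult[symmetric]) (auto simp: powr_divide powr_minus field_simps)
    finally show "(\<integral>\<^sup>+s. ennreal (s powr (\<beta> - 1)) * indicator {0<..} s * ennreal (2 ^ k * exp (- (?c x * s))) \<partial>lborel)
      \<le> ennreal (2 ^ k * Gamma \<beta> * 2 powr \<beta>) * ennreal (enn2real (min_avg p r x) powr (- \<beta>))" .
  qed
  also have "\<dots> = ennreal (2 ^ k * Gamma \<beta> * 2 powr \<beta>) * (\<integral>\<^sup>+x. ennreal (enn2real (min_avg p r x) powr (- \<beta>)) \<partial>D)"
    by (rule nn_integral_cmult) measurable
  also have "\<dots> < \<infinity>" using fin by (simp add: ennreal_mult_less_top)
  finally show ?thesis .
qed

lemma near_tail_integral_vanishes: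
  assumes fin: "(\<integral>\<^sup>+s. ennreal (s powr (\<beta> - 1)) * indicator {0<..} s * near_tail r s \<partial>lborel) < \<infinity>"
  shows "(\<lambda>n. \<integral>\<^sup>+s. ennreal (s powr (\<beta> - 1)) * indicator {real n<..} s * near_tail r s \<partial>lborel) \<longlonglongrightarrow> 0"
proof -
  have "(\<lambda>n. \<integral>\<^sup>+s. ennreal (s powr (\<beta> - 1)) * indicator {real n<..} s * near_tail r s \<partial>lborel) \<longlonglongrightarrow> (\<integral>\<^sup>+s. 0 \<partial>(lborel :: real measure))"
  proof (intro nn_integral_dominated_convergence[where w="\<lambda>s. ennreal (s powr (\<beta> - 1)) * indicator {0<..} s * near_tail r s"] fin AE_I2)
    fix s :: real and n
    show "ennreal (s powr (\<beta> - 1)) * indicator {real n<..} s * near_tail r s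
      \<le> ennreal (s powr (\<beta> - 1)) * indicator {0<..} s * near_tail r s"
      by (auto split: split_indicator)
    obtain N :: nat where N: "s \<le> real N" using real_arch_simple by blast
    have "\<forall>\<^sub>F n in sequentially. ennreal (s powr (\<beta> - 1)) * indicator {real n<..} s * near_tail r s = 0"
      using eventually_ge_at_top[of N] by eventually_elim (use N in \<open>auto split: split_indicator\<close>)
    then show "(\<lambda>n. ennreal (s powr (\<beta> - 1)) * indicator {real n<..} s * near_tail r s) \<longlonglongrightarrow> 0"
      by (rule tendsto_eventually)
  qed measurable
  then show ?thesis by simp
qed

end

text \<open>A linear function \<alpha> + B' i solves the recursion with equality. The excess e of L
  over it satisfies e(0) <= \<theta>^n e(n), and linear growth of e(n) loses against \<theta>^n. The
  point is that \<open>C\<close> and \<open>c\<close> do not occur in the conclusion.\<close>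

lemma contraction_bound:
  fixes L :: "nat \<Rightarrow> real"
  assumes step: "\<And>i. L i \<le> \<theta> * (L (Suc i) + A + B * (real i + 1))"
    and growth: "\<And>i. L i \<le> C + c * real i"
    and \<theta>: "0 < \<theta>" "\<theta> < 1" and AB: "0 \<le> A" "0 \<le> B"
  shows "L 0 \<le> \<theta> * (\<theta> * B / (1 - \<theta>) + A + B) / (1 - \<theta>)"
proof -
  define B' where "B' = \<theta> * B / (1 - \<theta>)"
  define \<alpha> where "\<alpha> = \<theta> * (B' + A + B) / (1 - \<theta>)"
  define e where "e = (\<lambda>i. L i - \<alpha> - B' * real i)"
  have B': "\<theta> * (B' + B) = B'"
    using \<theta> unfolding B'_def by (simp add: field_simps)
  have \<alpha>: "\<theta> * (\<alpha> + B' + A + B) = \<alpha>"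
    using \<theta> unfolding \<alpha>_def by (simp add: field_simps)
  have B'0: "0 \<le> B'" using \<theta> AB by (simp add: B'_def)
  have \<alpha>0: "0 \<le> \<alpha>" using \<theta> AB B'0 by (simp add: \<alpha>_def)
  have "e i \<le> \<theta> * e (Suc i)" for i
  proof -
    have "e i \<le> \<theta> * (L (Suc i) + A + B * (real i + 1)) - \<alpha> - B' * real i"
      using step[of i] by (simp add: e_def)
    also have "\<dots> = \<theta> * e (Suc i) + (\<theta> * (\<alpha> + B' + A + B) - \<alpha>) + (\<theta> * (B' + B) - B') * real i"
      by (simp add: e_def algebra_simps)
    finally show ?thesis by (simp add: B' \<alpha>)
  qed
  then have pow: "e 0 \<le> \<theta> ^ n * e n" for n
  proof (induction n)
    case (Suc n)
    have "\<theta> ^ n * e n \<le> \<theta> ^ n * (\<theta> * e (Suc n))"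
      using \<theta> Suc.prems by (intro mult_left_mono) auto
    with Suc show ?case by (simp add: mult.assoc mult.left_commute)
  qed simp
  have "e 0 \<le> \<bar>C\<bar> * \<theta> ^ n + \<bar>c\<bar> * (real n * \<theta> ^ n)" for n
  proof -
    have "e n \<le> \<bar>C\<bar> + \<bar>c\<bar> * real n"
      using growth[of n] B'0 \<alpha>0 abs_ge_self[of C] mult_right_mono[OF abs_ge_self[of c], of "real n"]
        mult_nonneg_nonneg[OF B'0, of "real n"] unfolding e_def by linarith
    then have "\<theta> ^ n * e n \<le> \<theta> ^ n * (\<bar>C\<bar> + \<bar>c\<bar> * real n)"
      using \<theta> by (intro mult_left_mono) auto
    with pow[of n] show ?thesis by (simp add: algebra_simps)
  qed
  moreover have "(\<lambda>n. \<bar>C\<bar> * \<theta> ^ n + \<bar>c\<bar> * (real n * \<theta> ^ n)) \<longlonglongrightarrow> \<bar>C\<bar> * 0 + \<bar>c\<bar> * 0"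
    using \<theta> powser_times_n_limit_0[of \<theta>] by (intro tendsto_intros LIMSEQ_realpow_zero) auto
  ultimately have "e 0 \<le> \<bar>C\<bar> * 0 + \<bar>c\<bar> * 0"
    by (intro tendsto_lowerbound[of _ _ sequentially "e 0"]) auto
  then show ?thesis by (simp add: e_def \<alpha>_def B'_def)
qed

text \<open>Put x = c t / \<beta> into x <= exp(x) and raise to the power \<beta>.\<close>

lemma powr_mult_exp_le:
  fixes \<beta> t :: real
  assumes "0 < \<beta>" "0 \<le> t" "0 < c"
  shows "t powr \<beta> * exp (- (c * t)) \<le> (\<beta> / c) powr \<beta>"
proof -
  have "t = \<beta> / c * (c * t / \<beta>)" using assms by simp
  then have "t powr \<beta> = (\<beta> / c) powr \<beta> * (c * t / \<beta>) powr \<beta>"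
    using assms by (metis divide_nonneg_pos less_imp_le mult_nonneg_nonneg powr_mult)
  also have "(c * t / \<beta>) powr \<beta> \<le> exp (c * t / \<beta>) powr \<beta>"
    using assms by (intro powr_mono2 order_trans[OF _ exp_ge_add_one_self[of "c * t / \<beta>"]]) auto
  also have "exp (c * t / \<beta>) powr \<beta> = exp (c * t)"
    using assms by (simp add: powr_def)
  finally have "t powr \<beta> \<le> (\<beta> / c) powr \<beta> * exp (c * t)"
    by (simp add: mult_left_mono)
  then have "t powr \<beta> * exp (- (c * t)) \<le> (\<beta> / c) powr \<beta> * exp (c * t) * exp (- (c * t))"
    by (intro mult_right_mono) auto
  then show ?thesis by (simp add: exp_minus mult.assoc)
qed

context knn_density
begin

lemma min_avg_le_real:
  assumes "0 < \<rho>'" "\<rho>' \<le> r"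
  shows "enn2real (min_avg p r x) \<le> avg x \<rho>'"
  using min_avg_le_avg[OF assms, of x] by (intro enn2real_leI) (auto simp: avg_def)

text \<open>Large exponents force a uniform lower bound on ball probabilities: integrating over
  \<open>cball z s\<close> bounds the probability of \<open>cball z (2 s)\<close> below by a power \<open>1 / \<beta> < 1\<close> of
  that of \<open>cball z s\<close>, and iterating from small \<open>s\<close> makes the dependence on the centre vanish.\<close>

lemma ball_prob_bounded_below:
  assumes r: "0 < r" and \<beta>: "1 < \<beta>"
    and pos: "AE x in D. 0 < enn2real (min_avg p r x)"
    and fin: "(\<integral>\<^sup>+x. ennreal (enn2real (min_avg p r x) powr (- \<beta>)) \<partial>D) < \<infinity>"
  shows "\<exists>\<delta>>0. AE x in D. \<delta> \<le> prob (cball x r)"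
proof -
  let ?mr = "\<lambda>x. enn2real (min_avg p r x)"
  let ?v = "ball_vol TYPE('a)"
  define I where "I = (\<integral>\<^sup>+x. ennreal (?mr x powr (- \<beta>)) \<partial>D)"
  \<comment> \<open>The floor 1 makes \<open>ln K\<close> nonnegative, as the constant
    \<open>A\<close> of \<open>contraction_bound\<close> has to be.\<close>
  define K where "K = max 1 (enn2real I)"
  have "I = ennreal (enn2real I)" using fin by (simp add: I_def less_top)
  also have "\<dots> \<le> ennreal K" by (intro ennreal_leI) (simp add: K_def)
  finally have K: "1 \<le> K" "(\<integral>\<^sup>+x. ennreal (?mr x powr (- \<beta>)) \<partial>D) \<le> ennreal K"
    by (simp_all add: K_def I_def)
  \<comment> \<open>For x in \<open>cball z s\<close> the ball \<open>cball x s\<close> lies in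
    \<open>cball z (2 * s)\<close>, so the minimal average at x is at most the probability of the
    latter over the volume of radius s. Integrate its power - \<beta> over \<open>cball z s\<close>
    and compare with \<open>K\<close>.\<close>
  have main: "prob (cball z s) * ?v s powr \<beta> \<le> K * prob (cball z (2 * s)) powr \<beta>"
    if s: "0 < s" "s \<le> r" and z: "0 < prob (cball z (2 * s))" for z s
  proof -
    have vs: "0 < ?v s" using s by (intro ball_vol_pos)
    let ?c = "(prob (cball z (2 * s)) / ?v s) powr (- \<beta>)"
    have "ennreal ?c * ennreal (prob (cball z s)) = (\<integral>\<^sup>+x. ennreal ?c * indicator (cball z s) x \<partial>D)"
      by (subst nn_integral_cmult_indicator) (auto simp: sets_D emeasure_eq_measure)
    also have "\<dots> \<le> (\<integral>\<^sup>+x. ennreal (?mr x powr (- \<beta>)) \<partial>D)"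
    proof (intro nn_integral_mono_AE, use pos in eventually_elim)
      fix x assume mx: "0 < ?mr x"
      show "ennreal ?c * indicator (cball z s) x \<le> ennreal (?mr x powr (- \<beta>))"
      proof (cases "x \<in> cball z s")
        case True
        have "cball x s \<subseteq> cball z (2 * s)"
        proof
          fix y assume "y \<in> cball x s"
          then show "y \<in> cball z (2 * s)" using True dist_triangle[of z y x] by auto
        qed
        then have "prob (cball x s) \<le> prob (cball z (2 * s))"
          by (intro finite_measure_mono) (auto simp: sets_D)
        then have "avg x s \<le> prob (cball z (2 * s)) / ?v s"
          unfolding avg_def using vs by (intro divide_right_mono) auto
        with min_avg_le_real[OF s, of x] have "?mr x \<le> prob (cball z (2 * s)) / ?v s"
          by linarith
        then have "?c \<le> ?mr x powr (- \<beta>)"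
          using mx \<beta> by (intro powr_mono2') auto
        then show ?thesis using True by (simp add: ennreal_leI)
      qed simp
    qed
    also have "\<dots> \<le> ennreal K" by (rule K)
    finally have "?c * prob (cball z s) \<le> K"
      using K by (simp add: ennreal_mult[symmetric])
    moreover have "?c = ?v s powr \<beta> / prob (cball z (2 * s)) powr \<beta>"
      using vs z by (simp add: powr_minus powr_divide)
    ultimately show ?thesis using z by (simp add: field_simps)
  qed
  define d where "d = real DIM('a)"
  \<comment> \<open>\<open>A\<close> and \<open>B\<close> appear when logarithms are taken in
    \<open>main\<close> at the radius r / 2^(i + 1): the volume there supplies the term linear in i.
    The absolute value keeps \<open>A\<close> nonnegative for small and for large volumes.\<close>
  define A where "A = ln K + \<beta> * \<bar>ln (?v r)\<bar>"
  define B where "B = \<beta> * (d * ln 2)"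
  define \<alpha> where "\<alpha> = (1 / \<beta>) * ((1 / \<beta>) * B / (1 - 1 / \<beta>) + A + B) / (1 - 1 / \<beta>)"
  have vr: "0 < ?v r" using r by (rule ball_vol_pos)
  have "exp (- \<alpha>) \<le> prob (cball z r)" if mz: "0 < ?mr z" for z
  proof -
    define g where "g = (\<lambda>i. prob (cball z (r / 2 ^ i)))"
    have vi: "?v (r / 2 ^ i) = ?v r * exp (- (d * ln 2 * real i))" for i
    proof -
      have "exp (real (i * DIM('a)) * ln 2) = 2 ^ (i * DIM('a))"
        by (simp only: exp_of_nat_mult exp_ln zero_less_numeral)
      moreover have "d * ln 2 * real i = real (i * DIM('a)) * ln 2"
        by (simp add: d_def)
      ultimately have "exp (- (d * ln 2 * real i)) = 1 / 2 ^ (i * DIM('a))"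
        by (simp only: exp_minus inverse_eq_divide)
      then show ?thesis using r by (simp add: ball_vol_eq max_absorb2 power_divide power_mult)
    qed
    have g_ge: "?mr z * ?v (r / 2 ^ i) \<le> g i" for i
    proof -
      have "0 < r / 2 ^ i" "r / 2 ^ i \<le> r" using r by (auto simp: divide_le_eq mult_le_cancel_left1 one_le_power)
      from min_avg_le_real[OF this, of z] ball_vol_pos[OF this(1), where 'a='a]
      show ?thesis by (simp add: avg_def g_def le_divide_eq)
    qed
    have g_pos: "0 < g i" for i
      using g_ge[of i] mz ball_vol_pos[of "r / 2 ^ i", where 'a='a] r
      by (metis divide_pos_pos less_le_trans mult_pos_pos zero_less_numeral zero_less_power)
    define L where "L = (\<lambda>i. - ln (g i))"
    have step: "L i \<le> (1 / \<beta>) * (L (Suc i) + A + B * (real i + 1))" for i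
    proof -
      have "(1::real) \<le> 2 ^ i" by (rule one_le_power) simp
      then have one_le: "(1::real) \<le> 2 * 2 ^ i" by linarith
      have "g (Suc i) * ?v (r / 2 ^ Suc i) powr \<beta> \<le> K * g i powr \<beta>"
        using main[of "r / 2 ^ Suc i" z] r g_pos[of i] unfolding g_def
        by (simp add: divide_le_eq mult_le_cancel_left1 one_le)
      then have "ln (g (Suc i) * ?v (r / 2 ^ Suc i) powr \<beta>) \<le> ln (K * g i powr \<beta>)"
        using g_pos[of "Suc i"] g_pos[of i] vr K unfolding vi by (subst ln_le_cancel_iff) auto
      then have "ln (g (Suc i)) + \<beta> * (ln (?v r) - d * ln 2 * (real i + 1)) \<le> ln K + \<beta> * ln (g i)"
        using g_pos[of "Suc i"] g_pos[of i] vr K unfolding vi by (simp add: ln_mult ln_powr algebra_simps)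
      moreover have "- (\<beta> * ln (?v r)) \<le> \<beta> * \<bar>ln (?v r)\<bar>"
        using \<beta> mult_left_mono[OF abs_ge_minus_self[of "ln (?v r)"], of \<beta>] by simp
      ultimately have "\<beta> * L i \<le> L (Suc i) + A + B * (real i + 1)"
        by (simp add: L_def A_def B_def algebra_simps)
      then show ?thesis using \<beta> by (simp add: field_simps)
    qed
    \<comment> \<open>This bound depends on \<open>z\<close> through its minimal average, but it
      serves only as the growth condition of \<open>contraction_bound\<close>, whose conclusion is
      the same constant for every \<open>z\<close>.\<close>
    have growth: "L i \<le> - ln (?mr z * ?v r) + (d * ln 2) * real i" for i
    proof -
      have "ln (?mr z * ?v (r / 2 ^ i)) \<le> ln (g i)"
        using g_ge[of i] g_pos[of i] mz vr unfolding vi by (subst ln_le_cancel_iff) auto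
      then show ?thesis using mz vr unfolding vi by (simp add: L_def ln_mult)
    qed
    have "L 0 \<le> \<alpha>"
      unfolding \<alpha>_def using \<beta> K
      by (intro contraction_bound[OF step growth]) (auto simp: A_def B_def d_def)
    then have "- \<alpha> \<le> ln (g 0)" by (simp add: L_def)
    then have "exp (- \<alpha>) \<le> g 0"
      using g_pos[of 0] by (metis exp_le_cancel_iff exp_ln)
    then show ?thesis by (simp add: g_def)
  qed
  then show ?thesis using pos by (intro exI[of _ "exp (- \<alpha>)"]) auto
qed

end

section \<open>Isolated points\<close>

context knn_density
begin

text \<open>At least \<open>card S + 1 - n\<close> members of \<open>S\<close> lie at or above the
  order statistic, and each contributes at least its transformed value. The set \<open>S\<close> may
  omit indices, which makes room for a second centre.\<close>

lemma kth_smallest_average: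
  fixes h :: "real \<Rightarrow> ennreal"
  assumes J: "finite J" and n: "1 \<le> n" "n \<le> card J" and S: "S \<subseteq> J" "n \<le> card S + 1" and h: "mono h"
  shows "of_nat (card S + 1 - n) * h (kth_smallest n J d) \<le> (\<Sum>j\<in>S. h (d j))"
proof -
  let ?t = "kth_smallest n J d"
  have fS: "finite S" using S J finite_subset by blast
  have "card S + 1 - n \<le> card {j\<in>S. ?t \<le> d j}"
    using kth_smallest_card_ge[OF J n S(1), of d] n(1) by linarith
  then have "of_nat (card S + 1 - n) * h ?t \<le> of_nat (card {j\<in>S. ?t \<le> d j}) * h ?t"
    by (intro mult_right_mono) auto
  also have "\<dots> = (\<Sum>j\<in>{j\<in>S. ?t \<le> d j}. h ?t)" by simp
  also have "\<dots> \<le> (\<Sum>j\<in>{j\<in>S. ?t \<le> d j}. h (d j))"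
    using monoD[OF h] by (intro sum_mono) auto
  also have "\<dots> \<le> (\<Sum>j\<in>S. h (d j))"
    using fS by (intro sum_mono2) auto
  finally show ?thesis .
qed

definition vpow :: "real \<Rightarrow> real \<Rightarrow> ennreal" where
  "vpow \<beta> r = ennreal (ball_vol TYPE('a) r powr \<beta>)"

lemma vpow_measurable [measurable]: "vpow \<beta> \<in> borel_measurable borel"
  unfolding vpow_def[abs_def] by measurable

lemma mono_vpow: "0 \<le> \<beta> \<Longrightarrow> mono (vpow \<beta>)"
  unfolding vpow_def by (intro monoI ennreal_leI powr_mono2 ball_vol_mono) auto

text \<open>Moment of order \<beta> of the volume of the ball around \<open>x\<close> that reaches
  an independent point. All far terms are reduced to it.\<close>

definition mean_vpow :: "real \<Rightarrow> 'a \<Rightarrow> ennreal" where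
  "mean_vpow \<beta> x = (\<integral>\<^sup>+y. vpow \<beta> (dist x y) \<partial>D)"

lemma mean_vpow_measurable [measurable]: "mean_vpow \<beta> \<in> borel_measurable borel"
  unfolding mean_vpow_def[abs_def] by measurable

text \<open>Averaging over the other points replaces the k-th distance by the distance to one point
  \<open>j\<close>. With \<open>j\<close> dropped from the counter the isolation event only grows,
  and becomes independent of \<open>w j\<close> once \<open>w i\<close> is fixed.\<close>

lemma far_single:
  assumes m: "2 * k + 2 \<le> m" "i \<in> {1..m}" and \<beta>: "0 \<le> \<beta>"
  shows "(\<integral>\<^sup>+w. vpow \<beta> (knn_radius k {1..m} w i) * of_bool (r < knn_radius k {1..m} w i) \<partial>sample {1..m})
    \<le> 2 * (\<integral>\<^sup>+x. mean_vpow \<beta> x * ennreal (binomial_below (m - 2) k (prob (cball x r))) \<partial>D)"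
    (is "?L \<le> 2 * ?J")
proof -
  let ?P = "sample {1..m}" and ?S = "{1..m} - {i}" and ?R = "\<lambda>w. knn_radius k {1..m} w i"
  let ?e = "\<lambda>j w. card {l\<in>{1..m} - {i, j}. w l \<in> cball (w i) r} < k"
  have km: "k < m" "k \<le> card ?S" using m by auto
  have [measurable]: "?R \<in> borel_measurable ?P" using km m by measurable
  have cS: "card ?S = m - 1" using m by simp
  have meas: "(\<lambda>w. vpow \<beta> (dist (w i) (w j)) * of_bool (?e j w)) \<in> borel_measurable ?P" if "j \<in> ?S" for j
  proof -
    have [measurable]: "i \<in> {1..m}" "j \<in> {1..m}" using that m by auto
    have [measurable]: "(\<lambda>w. card {l\<in>{1..m} - {i, j}. w l \<in> cball (w i) r}) \<in> measurable ?P (count_space UNIV)"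
      using m by (intro measurable_count_cball) auto
    show ?thesis by measurable
  qed
  have point: "of_nat (m - k) * (vpow \<beta> (?R w) * of_bool (r < ?R w)) \<le> (\<Sum>j\<in>?S. vpow \<beta> (dist (w i) (w j)) * of_bool (?e j w))" for w
  proof (cases "r < ?R w")
    case True
    have ev: "?e j w" for j
    proof -
      have "card {l\<in>{1..m} - {i, j}. w l \<in> cball (w i) r} \<le> card {l\<in>?S. w l \<in> cball (w i) r}"
        by (intro card_mono) auto
      then show ?thesis using less_knn_radius_iff[OF km(1) m(2), of r w] True by linarith
    qed
    have "of_nat (card ?S + 1 - k) * vpow \<beta> (?R w) \<le> (\<Sum>j\<in>?S. vpow \<beta> (dist (w i) (w j)))"
      unfolding knn_radius_def using km k_pos \<beta> by (intro kth_smallest_average mono_vpow) auto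
    moreover have "card ?S + 1 - k = m - k" using cS m by simp
    ultimately show ?thesis using True ev by simp
  qed simp
  have "of_nat (m - k) * ?L = (\<integral>\<^sup>+w. of_nat (m - k) * (vpow \<beta> (?R w) * of_bool (r < ?R w)) \<partial>?P)"
    by (rule nn_integral_cmult[symmetric]) measurable
  also have "\<dots> \<le> (\<integral>\<^sup>+w. (\<Sum>j\<in>?S. vpow \<beta> (dist (w i) (w j)) * of_bool (?e j w)) \<partial>?P)"
    by (intro nn_integral_mono point)
  also have "\<dots> = (\<Sum>j\<in>?S. \<integral>\<^sup>+w. vpow \<beta> (dist (w i) (w j)) * of_bool (?e j w) \<partial>?P)"
    by (rule nn_integral_sum[OF meas])
  also have "\<dots> = (\<Sum>j\<in>?S. ?J)"
  proof (intro sum.cong refl)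
    fix j assume j: "j \<in> ?S"
    show "(\<integral>\<^sup>+w. vpow \<beta> (dist (w i) (w j)) * of_bool (?e j w) \<partial>?P) = ?J"
      unfolding mean_vpow_def
      using nn_integral_weighted_isolated[of "{1..m}" i j "\<lambda>x y. vpow \<beta> (dist x y)" r k] j m by auto
  qed
  also have "\<dots> = of_nat (m - 1) * ?J" using cS by simp
  \<comment> \<open>Since \<open>2 * k + 2 \<le> m\<close>, the m - 1 summands are at most twice the
    m - k used for averaging; this is the factor 2 in the bound.\<close>
  also have "\<dots> \<le> of_nat (2 * (m - k)) * ?J"
    using m by (intro mult_right_mono) (auto simp: of_nat_le_iff simp del: of_nat_mult)
  finally have "of_nat (m - k) * ?L \<le> of_nat (m - k) * (2 * ?J)" by (simp add: mult_ac)
  moreover have "(of_nat (m - k) :: ennreal) \<noteq> 0" using m by auto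
  ultimately show ?thesis by (subst (asm) ennreal_mult_le_mult_iff) auto
qed

text \<open>Two balls with fewer than \<open>k\<close> points each have fewer than
  \<open>2 * k\<close> in their union. The averaging avoids \<open>i'\<close> as well, because
  \<open>w i'\<close> is a centre of the isolation event.\<close>

lemma far_pair:
  assumes m: "2 * k + 2 \<le> m" "i \<in> {1..m}" "i' \<in> {1..m}" "i \<noteq> i'" and \<beta>: "0 \<le> \<beta>"
  shows "(\<integral>\<^sup>+w. vpow \<beta> (knn_radius k {1..m} w i) * of_bool (r < knn_radius k {1..m} w i \<and> r < knn_radius k {1..m} w i') \<partial>sample {1..m})
    \<le> 2 * (\<integral>\<^sup>+x. \<integral>\<^sup>+x'. mean_vpow \<beta> x * ennreal (binomial_below (m - 3) (2 * k) (prob (cball x r \<union> cball x' r))) \<partial>D \<partial>D)"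
    (is "?L \<le> 2 * ?J")
proof -
  let ?P = "sample {1..m}" and ?S = "{1..m} - {i, i'}" and ?R = "\<lambda>w i. knn_radius k {1..m} w i"
  let ?e = "\<lambda>j w. card {l\<in>{1..m} - {i, i', j}. w l \<in> cball (w i) r \<union> cball (w i') r} < 2 * k"
  have km: "k < m" "k \<le> card ({1..m} - {i})" using m by auto
  have [measurable]: "(\<lambda>w. ?R w i) \<in> borel_measurable ?P" "(\<lambda>w. ?R w i') \<in> borel_measurable ?P"
    using km m by measurable
  have cS: "card ?S = m - 2" using m by (simp add: card_Diff_subset)
  have meas: "(\<lambda>w. vpow \<beta> (dist (w i) (w j)) * of_bool (?e j w)) \<in> borel_measurable ?P" if "j \<in> ?S" for j
  proof -
    have [measurable]: "i \<in> {1..m}" "j \<in> {1..m}" using that m by auto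
    have [measurable]: "(\<lambda>w. card {l\<in>{1..m} - {i, i', j}. w l \<in> cball (w i) r \<union> cball (w i') r}) \<in> measurable ?P (count_space UNIV)"
      using m by (intro measurable_count_cball_Un) auto
    show ?thesis by measurable
  qed
  have point: "of_nat (m - 1 - k) * (vpow \<beta> (?R w i) * of_bool (r < ?R w i \<and> r < ?R w i'))
      \<le> (\<Sum>j\<in>?S. vpow \<beta> (dist (w i) (w j)) * of_bool (?e j w))" for w
  proof (cases "r < ?R w i \<and> r < ?R w i'")
    case True
    have ev: "?e j w" for j
    proof -
      have "card {l\<in>{1..m} - {i, i', j}. w l \<in> cball (w i) r \<union> cball (w i') r}
        \<le> card ({l\<in>{1..m} - {i}. w l \<in> cball (w i) r} \<union> {l\<in>{1..m} - {i'}. w l \<in> cball (w i') r})"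
        by (intro card_mono) auto
      also have "\<dots> \<le> card {l\<in>{1..m} - {i}. w l \<in> cball (w i) r} + card {l\<in>{1..m} - {i'}. w l \<in> cball (w i') r}"
        by (rule card_Un_le)
      finally show ?thesis
        using less_knn_radius_iff[OF km(1) m(2), of r w] less_knn_radius_iff[OF km(1) m(3), of r w] True by linarith
    qed
    have "of_nat (card ?S + 1 - k) * vpow \<beta> (?R w i) \<le> (\<Sum>j\<in>?S. vpow \<beta> (dist (w i) (w j)))"
      unfolding knn_radius_def using km k_pos \<beta> cS m by (intro kth_smallest_average mono_vpow) auto
    moreover have "card ?S + 1 - k = m - 1 - k" using cS m by simp
    ultimately have le: "of_nat (m - 1 - k) * vpow \<beta> (?R w i) \<le> (\<Sum>j\<in>?S. vpow \<beta> (dist (w i) (w j)))" by simp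
    have "of_bool (r < ?R w i \<and> r < ?R w i') = (1 :: ennreal)" using True by simp
    with le ev show ?thesis by (simp only: of_bool_eq mult_1_right)
  next
    case False
    then show ?thesis by (simp only: of_bool_eq mult_zero_right zero_le)
  qed
  have "of_nat (m - 1 - k) * ?L = (\<integral>\<^sup>+w. of_nat (m - 1 - k) * (vpow \<beta> (?R w i) * of_bool (r < ?R w i \<and> r < ?R w i')) \<partial>?P)"
    by (rule nn_integral_cmult[symmetric]) measurable
  also have "\<dots> \<le> (\<integral>\<^sup>+w. (\<Sum>j\<in>?S. vpow \<beta> (dist (w i) (w j)) * of_bool (?e j w)) \<partial>?P)"
    by (intro nn_integral_mono point)
  also have "\<dots> = (\<Sum>j\<in>?S. \<integral>\<^sup>+w. vpow \<beta> (dist (w i) (w j)) * of_bool (?e j w) \<partial>?P)"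
    by (rule nn_integral_sum[OF meas])
  also have "\<dots> = (\<Sum>j\<in>?S. ?J)"
  proof (intro sum.cong refl)
    fix j assume j: "j \<in> ?S"
    have "(\<integral>\<^sup>+w. vpow \<beta> (dist (w i) (w j)) * of_bool (?e j w) \<partial>?P)
      = (\<integral>\<^sup>+x. \<integral>\<^sup>+x'. (\<integral>\<^sup>+y. vpow \<beta> (dist x y) \<partial>D) * ennreal (binomial_below (card {1..m} - 3) (2 * k) (prob (cball x r \<union> cball x' r))) \<partial>D \<partial>D)"
      using j m by (intro nn_integral_weighted_both_isolated) auto
    then show "(\<integral>\<^sup>+w. vpow \<beta> (dist (w i) (w j)) * of_bool (?e j w) \<partial>?P) = ?J"
      by (simp add: mean_vpow_def)
  qed
  also have "\<dots> = of_nat (m - 2) * ?J" using cS by simp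
  also have "\<dots> \<le> of_nat (2 * (m - 1 - k)) * ?J"
    using m by (intro mult_right_mono) (auto simp: of_nat_le_iff simp del: of_nat_mult)
  finally have "of_nat (m - 1 - k) * ?L \<le> of_nat (m - 1 - k) * (2 * ?J)" by (simp add: mult_ac)
  moreover have "(of_nat (m - 1 - k) :: ennreal) \<noteq> 0" using m by auto
  ultimately show ?thesis by (subst (asm) ennreal_mult_le_mult_iff) auto
qed

end

lemma ennreal_tendsto_multc: "c < \<top> \<Longrightarrow> (f \<longlongrightarrow> x) F \<Longrightarrow> ((\<lambda>z. f z * c) \<longlongrightarrow> x * c) F" for c :: ennreal
  using ennreal_tendsto_cmult[of c f x F] by (simp add: mult.commute)

section \<open>Points whose k-th neighbour is remote\<close>

context knn_density
begin

definition far_part :: "real \<Rightarrow> real \<Rightarrow> nat \<Rightarrow> (nat \<Rightarrow> 'a) \<Rightarrow> nat \<Rightarrow> real" where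
  "far_part b r m w i = U m w i powr b * of_bool (r < knn_radius k {1..m} w i)"

lemma U_powr_eq: "k < m \<Longrightarrow> ennreal (U m w i powr \<beta>) = ennreal ((real m - 1) powr \<beta>) * vpow \<beta> (knn_radius k {1..m} w i)"
  unfolding U_def vpow_def by (subst powr_mult) (auto simp: ennreal_mult)

lemma weighted_decay:
  assumes c: "0 < c" and fin: "(\<integral>\<^sup>+x. G x \<partial>D) < \<infinity>" and G[measurable]: "G \<in> borel_measurable borel"
    and q: "AE x in D. 0 < prob (cball x r)"
  shows "(\<lambda>m. \<integral>\<^sup>+x. G x * ennreal (exp (- ((real m - 3) * c * prob (cball x r)))) \<partial>D) \<longlonglongrightarrow> 0"
proof -
  have finG: "AE x in D. G x \<noteq> \<infinity>"
    using fin by (intro nn_integral_PInf_AE) auto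
  have "(\<lambda>m. \<integral>\<^sup>+x. G x * ennreal (exp (- ((real m - 3) * c * prob (cball x r)))) \<partial>D) \<longlonglongrightarrow> (\<integral>\<^sup>+x. 0 \<partial>D)"
  \<comment> \<open>The majorant exp(3 c) covers m < 3, where the coefficient m - 3 is negative and
    the exponential may exceed 1.\<close>
  proof (intro nn_integral_dominated_convergence[where w="\<lambda>x. G x * ennreal (exp (3 * c))"])
    show "(\<integral>\<^sup>+x. G x * ennreal (exp (3 * c)) \<partial>D) < \<infinity>"
      using fin by (simp add: nn_integral_multc ennreal_mult_less_top)
    show "AE x in D. G x * ennreal (exp (- ((real m - 3) * c * prob (cball x r)))) \<le> G x * ennreal (exp (3 * c))" for m
    proof (intro AE_I2 mult_left_mono ennreal_leI)
      fix x
      have "0 \<le> real m * (c * prob (cball x r))" using c by simp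
      moreover have "c * prob (cball x r) \<le> c" using c by simp
      ultimately have "- ((real m - 3) * c * prob (cball x r)) \<le> 3 * c"
        by (simp add: algebra_simps)
      then show "exp (- ((real m - 3) * c * prob (cball x r))) \<le> exp (3 * c)" by simp
    qed auto
    show "AE x in D. (\<lambda>m. G x * ennreal (exp (- ((real m - 3) * c * prob (cball x r))))) \<longlonglongrightarrow> 0"
      using finG q
    proof eventually_elim
      case (elim x)
      define d where "d = c * prob (cball x r)"
      have d: "0 < d" using elim c by (simp add: d_def)
      have "(\<lambda>m. exp (- ((real m - 3) * d))) \<longlonglongrightarrow> 0"
        using d by real_asymp
      then have "(\<lambda>m. G x * ennreal (exp (- ((real m - 3) * d)))) \<longlonglongrightarrow> G x * ennreal 0"
        using elim by (intro ennreal_tendsto_cmult tendsto_ennrealI) (auto simp: less_top)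
      then show ?case by (simp add: d_def mult.assoc)
    qed
  qed measurable
  then show ?thesis by simp
qed

lemma far_part_vanishes:
  assumes r: "0 < r" and b: "0 < b"
    and pos: "AE x in D. 0 < enn2real (min_avg p r x)"
    and fin: "(\<integral>\<^sup>+x. ennreal (enn2real (min_avg p r x) powr (- (2 * b))) \<partial>D) < \<infinity>"
    and G: "(\<integral>\<^sup>+x. mean_vpow (2 * b) x \<partial>D) < \<infinity>"
  shows "(\<lambda>m. \<integral>\<^sup>+w. ennreal (((\<Sum>i\<in>{1..m}. far_part b r m w i) / real m)\<^sup>2) \<partial>sample {1..m}) \<longlonglongrightarrow> 0"
proof -
  define \<beta> where "\<beta> = 2 * b"
  have \<beta>: "0 < \<beta>" using b by (simp add: \<beta>_def)
  let ?q = "\<lambda>x. prob (cball x r)" and ?G = "mean_vpow \<beta>"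
  let ?e = "\<lambda>m c x. exp (- ((real m - 3) * c * ?q x))"
  define Jd where "Jd = (\<lambda>m. \<integral>\<^sup>+x. ?G x * ennreal (binomial_below (m - 2) k (?q x)) \<partial>D)"
  define Jo where "Jo = (\<lambda>m. \<integral>\<^sup>+x. \<integral>\<^sup>+x'. ?G x * ennreal (binomial_below (m - 3) (2 * k) (prob (cball x r \<union> cball x' r))) \<partial>D \<partial>D)"
  have vr: "0 < ball_vol TYPE('a) r" using r by (rule ball_vol_pos)
  have q_ge: "enn2real (min_avg p r x) * ball_vol TYPE('a) r \<le> ?q x" for x
    using min_avg_le_real[OF r order.refl, of x] vr by (simp add: avg_def le_divide_eq)
  have qpos: "AE x in D. 0 < ?q x"
    using pos by eventually_elim (use q_ge vr in \<open>auto intro: less_le_trans[OF mult_pos_pos]\<close>)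
  have bound: "(\<integral>\<^sup>+w. ennreal (((\<Sum>i\<in>{1..m}. far_part b r m w i) / real m)\<^sup>2) \<partial>sample {1..m})
      \<le> ennreal (1 / real m) * (ennreal ((real m - 1) powr \<beta>) * (2 * Jd m)) + ennreal ((real m - 1) powr \<beta>) * (2 * Jo m)"
    if m: "2 * k + 2 \<le> m" for m
  proof (rule sum_square_L2_bound)
    let ?P = "sample {1..m}" and ?c = "ennreal ((real m - 1) powr \<beta>)"
    let ?R = "\<lambda>w i. knn_radius k {1..m} w i"
    have km: "k < m" using m by simp
    show "0 < m" using m by simp
    show "0 \<le> far_part b r m w i" for w i by (simp add: far_part_def)
    have Rm: "(\<lambda>w. ?R w i) \<in> borel_measurable ?P" if "i \<in> {1..m}" for i
      using measurable_knn_radius[OF km that] .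
    show "(\<lambda>w. far_part b r m w i) \<in> borel_measurable ?P" if "i \<in> {1..m}" for i
    proof -
      note [measurable] = Rm[OF that]
      show ?thesis unfolding far_part_def U_def by measurable
    qed
    show "(\<integral>\<^sup>+w. ennreal ((far_part b r m w i)\<^sup>2) \<partial>?P) \<le> ?c * (2 * Jd m)" if i: "i \<in> {1..m}" for i
    proof -
      have "(\<integral>\<^sup>+w. ennreal ((far_part b r m w i)\<^sup>2) \<partial>?P)
          = (\<integral>\<^sup>+w. ?c * (vpow \<beta> (?R w i) * of_bool (r < ?R w i)) \<partial>?P)"
      proof (intro nn_integral_cong)
        fix w
        have "(U m w i powr b)\<^sup>2 = U m w i powr \<beta>"
          by (simp add: \<beta>_def power2_eq_square powr_add[symmetric])
        then show "ennreal ((far_part b r m w i)\<^sup>2) = ?c * (vpow \<beta> (?R w i) * of_bool (r < ?R w i))"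
          using U_powr_eq[OF km, of w i \<beta>] by (simp add: far_part_def power_mult_distrib)
      qed
      also have "\<dots> = ?c * (\<integral>\<^sup>+w. vpow \<beta> (?R w i) * of_bool (r < ?R w i) \<partial>?P)"
      proof -
        note [measurable] = Rm[OF i]
        show ?thesis by (rule nn_integral_cmult) measurable
      qed
      also have "\<dots> \<le> ?c * (2 * Jd m)"
        unfolding Jd_def using m i \<beta> by (intro mult_left_mono far_single) auto
      finally show ?thesis .
    qed
    show "(\<integral>\<^sup>+w. ennreal (far_part b r m w i * far_part b r m w j) \<partial>?P) \<le> ?c * (2 * Jo m)"
      if i: "i \<in> {1..m}" "j \<in> {1..m}" "i \<noteq> j" for i j
    proof -
      let ?Y = "\<lambda>i j w. vpow \<beta> (?R w i) * of_bool (r < ?R w i \<and> r < ?R w j)"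
      have Ym: "?Y i j \<in> borel_measurable ?P" if "i \<in> {1..m}" "j \<in> {1..m}" for i j
      proof -
        note [measurable] = Rm[OF that(1)] Rm[OF that(2)]
        show ?thesis by measurable
      qed
      have "(\<integral>\<^sup>+w. ennreal (far_part b r m w i * far_part b r m w j) \<partial>?P)
          \<le> (\<integral>\<^sup>+w. ennreal (1 / 2) * ?c * (?Y i j w + ?Y j i w) \<partial>?P)"
      proof (intro nn_integral_mono)
        fix w
        show "ennreal (far_part b r m w i * far_part b r m w j) \<le> ennreal (1 / 2) * ?c * (?Y i j w + ?Y j i w)"
        proof (cases "r < ?R w i \<and> r < ?R w j")
          case True
          let ?x = "U m w i powr b" and ?y = "U m w j powr b"
          have sq: "(U m w l powr b)\<^sup>2 = U m w l powr \<beta>" for l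
            by (simp add: \<beta>_def power2_eq_square powr_add[symmetric])
          \<comment> \<open>The arithmetic-geometric inequality leaves one weight at a time while
            both isolation events stay in force, which is the shape of
            \<open>far_pair\<close>.\<close>
          have "?x * ?y \<le> 1 / 2 * (?x\<^sup>2 + ?y\<^sup>2)"
            using sum_squares_bound[of ?x ?y] by simp
          then have "ennreal (?x * ?y) \<le> ennreal (1 / 2 * (U m w i powr \<beta> + U m w j powr \<beta>))"
            unfolding sq by (rule ennreal_leI)
          also have "\<dots> = ennreal (1 / 2) * (ennreal (U m w i powr \<beta>) + ennreal (U m w j powr \<beta>))"
            by (subst ennreal_mult) auto
          also have "\<dots> = ennreal (1 / 2) * ?c * (vpow \<beta> (?R w i) + vpow \<beta> (?R w j))"
            unfolding U_powr_eq[OF km] by (simp add: distrib_left mult.assoc)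
          finally have le: "ennreal (?x * ?y) \<le> ennreal (1 / 2) * ?c * (vpow \<beta> (?R w i) + vpow \<beta> (?R w j))" .
          have "far_part b r m w i * far_part b r m w j = ?x * ?y"
            using True by (simp add: far_part_def)
          moreover have "?Y i j w + ?Y j i w = vpow \<beta> (?R w i) + vpow \<beta> (?R w j)"
            using True by simp
          ultimately show ?thesis using le by (simp only:)
        next
          case False
          then have "far_part b r m w i * far_part b r m w j = 0"
            by (auto simp: far_part_def)
          then show ?thesis by (simp only: ennreal_0 zero_le)
        qed
      qed
      also have "\<dots> = ennreal (1 / 2) * ?c * ((\<integral>\<^sup>+w. ?Y i j w \<partial>?P) + (\<integral>\<^sup>+w. ?Y j i w \<partial>?P))"
        using Ym[OF i(1,2)] Ym[OF i(2,1)] by (simp only: nn_integral_cmult nn_integral_add borel_measurable_add)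
      also have "\<dots> \<le> ennreal (1 / 2) * ?c * (2 * Jo m + 2 * Jo m)"
        unfolding Jo_def using m i \<beta> by (intro mult_left_mono add_mono far_pair) auto
      also have "\<dots> = (ennreal (1 / 2) * 2) * (?c * (2 * Jo m))"
        by (simp only: mult_2[symmetric] mult_ac)
      also have "ennreal (1 / 2) * 2 = 1"
      proof -
        have "ennreal (1 / 2 * 2) = ennreal (1 / 2) * ennreal 2" by (rule ennreal_mult) auto
        moreover have "ennreal (1 / 2 * 2) = 1" by simp
        moreover have "ennreal 2 = 2" by simp
        ultimately show ?thesis by (simp only:)
      qed
      finally show ?thesis by simp
    qed
  qed
  have Gd: "(\<lambda>m. \<integral>\<^sup>+x. ?G x * ennreal (?e m c x) \<partial>D) \<longlonglongrightarrow> 0" if "0 < c" for c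
    using that G qpos unfolding \<beta>_def by (intro weighted_decay) auto
  have Jd_le: "Jd m \<le> ennreal (2 ^ k) * (\<integral>\<^sup>+x. ?G x * ennreal (?e m (1 / 2) x) \<partial>D)" if m: "3 \<le> m" for m
  proof -
    have "Jd m \<le> (\<integral>\<^sup>+x. ennreal (2 ^ k) * (?G x * ennreal (?e m (1 / 2) x)) \<partial>D)"
      unfolding Jd_def
    proof (intro nn_integral_mono)
      fix x
      have "binomial_below (m - 2) k (?q x) \<le> 2 ^ k * exp (- (real (m - 2) * ?q x / 2))"
        by (intro binomial_below_le_exp) auto
      also have "\<dots> \<le> 2 ^ k * ?e m (1 / 2) x"
        using m mult_right_mono[of "real m - 3" "real (m - 2)" "?q x"] by (simp add: of_nat_diff)
      finally have "ennreal (binomial_below (m - 2) k (?q x)) \<le> ennreal (2 ^ k) * ennreal (?e m (1 / 2) x)"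
        by (simp add: ennreal_mult[symmetric] ennreal_leI)
      then have "?G x * ennreal (binomial_below (m - 2) k (?q x)) \<le> ?G x * (ennreal (2 ^ k) * ennreal (?e m (1 / 2) x))"
        by (rule mult_left_mono) simp
      then show "?G x * ennreal (binomial_below (m - 2) k (?q x)) \<le> ennreal (2 ^ k) * (?G x * ennreal (?e m (1 / 2) x))"
        by (simp only: mult_ac)
    qed
    also have "\<dots> = ennreal (2 ^ k) * (\<integral>\<^sup>+x. ?G x * ennreal (?e m (1 / 2) x) \<partial>D)"
      by (rule nn_integral_cmult) measurable
    finally show ?thesis .
  qed
  have T1: "(\<lambda>m. ennreal (1 / real m) * (ennreal ((real m - 1) powr \<beta>) * (2 * Jd m))) \<longlonglongrightarrow> 0"
  proof (cases "\<beta> \<le> 1")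
    \<comment> \<open>For \<beta> at most 1 the diagonal weight 1 / m compensates (m - 1)^\<beta>,
      and \<open>Jd\<close> tends to 0 on its own.\<close>
    case True
    let ?H = "\<lambda>m. 2 * (ennreal (2 ^ k) * (\<integral>\<^sup>+x. ?G x * ennreal (?e m (1 / 2) x) \<partial>D))"
    have "?H \<longlonglongrightarrow> 2 * (ennreal (2 ^ k) * 0)"
      by (intro ennreal_tendsto_cmult Gd) auto
    then have lim: "?H \<longlonglongrightarrow> 0" by simp
    have "\<forall>\<^sub>F m in sequentially. ennreal (1 / real m) * (ennreal ((real m - 1) powr \<beta>) * (2 * Jd m)) \<le> ?H m"
      using eventually_ge_at_top[of 3]
    proof eventually_elim
      case (elim m)
      have "(real m - 1) powr \<beta> \<le> (real m - 1) powr 1"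
        using elim True by (intro powr_mono) auto
      then have "1 / real m * (real m - 1) powr \<beta> \<le> 1"
        using elim by (simp add: divide_le_eq)
      then have "ennreal (1 / real m * (real m - 1) powr \<beta>) \<le> 1" by simp
      moreover have "ennreal (1 / real m * (real m - 1) powr \<beta>) = ennreal (1 / real m) * ennreal ((real m - 1) powr \<beta>)"
        by (rule ennreal_mult) auto
      ultimately have le1: "ennreal (1 / real m) * ennreal ((real m - 1) powr \<beta>) \<le> 1"
        by (simp only:)
      have "(ennreal (1 / real m) * ennreal ((real m - 1) powr \<beta>)) * (2 * Jd m) \<le> 1 * ?H m"
        using Jd_le[OF elim] by (intro mult_mono[OF le1] mult_left_mono) auto
      then show ?case by (simp add: mult.assoc)
    qed
    from tendsto_sandwich[OF _ this tendsto_const lim] show ?thesis by simp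
  next
    case False
    \<comment> \<open>For \<beta> above 1 a power of m survives; the uniform lower bound on ball
      probabilities makes \<open>Jd\<close> exponentially small.\<close>
    then obtain \<delta> where \<delta>: "0 < \<delta>" "AE x in D. \<delta> \<le> ?q x"
      using ball_prob_bounded_below[OF r, of \<beta>] pos fin by (auto simp: \<beta>_def)
    let ?E = "\<integral>\<^sup>+x. ?G x \<partial>D"
    let ?H = "\<lambda>m. ennreal (1 / real m * (real m - 1) powr \<beta> * exp (- ((real m - 3) * (\<delta> / 2)))) * (2 * (ennreal (2 ^ k) * ?E))"
    have "(\<lambda>m. 1 / real m * (real m - 1) powr \<beta> * exp (- ((real m - 3) * (\<delta> / 2)))) \<longlonglongrightarrow> 0"
      using \<delta>(1) by real_asymp
    then have "?H \<longlonglongrightarrow> ennreal 0 * (2 * (ennreal (2 ^ k) * ?E))"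
      using G by (intro ennreal_tendsto_multc tendsto_ennrealI) (auto simp: \<beta>_def ennreal_mult_less_top)
    then have lim: "?H \<longlonglongrightarrow> 0" by simp
    have "\<forall>\<^sub>F m in sequentially. ennreal (1 / real m) * (ennreal ((real m - 1) powr \<beta>) * (2 * Jd m)) \<le> ?H m"
      using eventually_ge_at_top[of 3]
    proof eventually_elim
      case (elim m)
      let ?d = "ennreal (exp (- ((real m - 3) * (\<delta> / 2))))"
      have "(\<integral>\<^sup>+x. ?G x * ennreal (?e m (1 / 2) x) \<partial>D) \<le> (\<integral>\<^sup>+x. ?G x * ?d \<partial>D)"
      proof (intro nn_integral_mono_AE, use \<delta>(2) in eventually_elim)
        fix x assume "\<delta> \<le> ?q x"
        then have "(real m - 3) * (\<delta> / 2) \<le> (real m - 3) * (1 / 2) * ?q x"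
          using elim mult_left_mono[of \<delta> "?q x" "real m - 3"] by simp
        then show "?G x * ennreal (?e m (1 / 2) x) \<le> ?G x * ?d"
          by (intro mult_left_mono ennreal_leI) auto
      qed
      also have "\<dots> = ?E * ?d" by (rule nn_integral_multc) measurable
      finally have "Jd m \<le> ennreal (2 ^ k) * (?E * ?d)"
        by (intro order_trans[OF Jd_le[OF elim]] mult_left_mono) auto
      then have "(ennreal (1 / real m) * ennreal ((real m - 1) powr \<beta>)) * (2 * Jd m)
          \<le> (ennreal (1 / real m) * ennreal ((real m - 1) powr \<beta>)) * (2 * (ennreal (2 ^ k) * (?E * ?d)))"
        by (intro mult_left_mono) auto
      also have "\<dots> = ?H m"
      proof -
        have "ennreal (x * y * z) = ennreal x * ennreal y * ennreal z" if "0 \<le> x" "0 \<le> y" "0 \<le> z" for x y z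
          using that by (simp add: ennreal_mult)
        then have "ennreal (1 / real m * (real m - 1) powr \<beta> * exp (- ((real m - 3) * (\<delta> / 2))))
            = ennreal (1 / real m) * ennreal ((real m - 1) powr \<beta>) * ?d"
          by this auto
        then show ?thesis by (simp only: mult_ac)
      qed
      finally show ?case by (simp add: mult.assoc)
    qed
    from tendsto_sandwich[OF _ this tendsto_const lim] show ?thesis by simp
  qed
  \<comment> \<open>Here there is no weight 1 / m. The exponential is split between the two centres:
    the half at x' absorbs (m - 1)^\<beta>, the half at x makes the integral of \<open>?G\<close>
    vanish.\<close>
  have T2: "(\<lambda>m. ennreal ((real m - 1) powr \<beta>) * (2 * Jo m)) \<longlonglongrightarrow> 0"
  proof -
    let ?K = "\<integral>\<^sup>+x. ennreal (enn2real (min_avg p r x) powr (- \<beta>)) \<partial>D"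
    \<comment> \<open>The first factor bounds t^\<beta> exp(- t / 8). The rate 1 / 8 comes from (m -
      3) / 4 >= (m - 1) / 8 for m >= 5. The second factor converts a power of the ball probability
      into one of the minimal average.\<close>
    define C where "C = (\<beta> / (1 / 8)) powr \<beta> * ball_vol TYPE('a) r powr (- \<beta>)"
    have C: "0 \<le> C" by (simp add: C_def)
    let ?H = "\<lambda>m. (2 * (ennreal (2 ^ (2 * k)) * (ennreal C * ?K))) * (\<integral>\<^sup>+x. ?G x * ennreal (?e m (1 / 4) x) \<partial>D)"
    have "?H \<longlonglongrightarrow> (2 * (ennreal (2 ^ (2 * k)) * (ennreal C * ?K))) * 0"
      using fin by (intro ennreal_tendsto_cmult Gd) (auto simp: \<beta>_def ennreal_mult_less_top)
    then have lim: "?H \<longlonglongrightarrow> 0" by simp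
    have "\<forall>\<^sub>F m in sequentially. ennreal ((real m - 1) powr \<beta>) * (2 * Jo m) \<le> ?H m"
      using eventually_ge_at_top[of 5]
    proof eventually_elim
      case (elim m)
      let ?ex = "\<lambda>x. ennreal (?e m (1 / 4) x)" and ?c = "ennreal ((real m - 1) powr \<beta>)"
      have "Jo m \<le> (\<integral>\<^sup>+x. \<integral>\<^sup>+x'. (ennreal (2 ^ (2 * k)) * (?G x * ?ex x)) * ?ex x' \<partial>D \<partial>D)"
        unfolding Jo_def
      proof (intro nn_integral_mono)
        fix x x'
        let ?u = "prob (cball x r \<union> cball x' r)"
        have "?q x \<le> ?u" "?q x' \<le> ?u"
          by (intro finite_measure_mono; auto simp: sets_D)+
        \<comment> \<open>The union is at least as probable as the mean of both balls; a sum in the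
          exponent is what lets the bound factor over x and x'.\<close>
        then have "(?q x + ?q x') / 2 \<le> ?u" by simp
        then have "(real m - 3) * ((?q x + ?q x') / 2) \<le> (real m - 3) * ?u"
          using elim by (intro mult_left_mono) auto
        moreover have "real (m - 3) = real m - 3" using elim by simp
        moreover have "- (n * u / 2) \<le> - (n * (1 / 4) * q) + - (n * (1 / 4) * q')"
          if "n * ((q + q') / 2) \<le> n * u" for n u q q' :: real
          using that by (simp add: field_simps)
        ultimately have le: "- (real (m - 3) * ?u / 2) \<le> - ((real m - 3) * (1 / 4) * ?q x) + - ((real m - 3) * (1 / 4) * ?q x')"
          by presburger
        have "binomial_below (m - 3) (2 * k) ?u \<le> 2 ^ (2 * k) * exp (- (real (m - 3) * ?u / 2))"
          by (intro binomial_below_le_exp) auto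
        also have "\<dots> \<le> 2 ^ (2 * k) * (?e m (1 / 4) x * ?e m (1 / 4) x')"
          unfolding exp_add[symmetric] using le by (intro mult_left_mono) auto
        finally have "ennreal (binomial_below (m - 3) (2 * k) ?u) \<le> ennreal (2 ^ (2 * k)) * (?ex x * ?ex x')"
          by (simp only: ennreal_mult[symmetric] ennreal_leI exp_ge_zero zero_le_power zero_le_numeral mult_nonneg_nonneg)
        then have "?G x * ennreal (binomial_below (m - 3) (2 * k) ?u) \<le> ?G x * (ennreal (2 ^ (2 * k)) * (?ex x * ?ex x'))"
          by (rule mult_left_mono) simp
        then show "?G x * ennreal (binomial_below (m - 3) (2 * k) ?u) \<le> (ennreal (2 ^ (2 * k)) * (?G x * ?ex x)) * ?ex x'"
          by (simp only: mult_ac)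
      qed
      also have "\<dots> = (\<integral>\<^sup>+x. (ennreal (2 ^ (2 * k)) * (?G x * ?ex x)) * (\<integral>\<^sup>+x'. ?ex x' \<partial>D) \<partial>D)"
        by (intro nn_integral_cong nn_integral_cmult) measurable
      also have "\<dots> = (\<integral>\<^sup>+x. ennreal (2 ^ (2 * k)) * (?G x * ?ex x) \<partial>D) * (\<integral>\<^sup>+x'. ?ex x' \<partial>D)"
        by (rule nn_integral_multc) measurable
      also have "(\<integral>\<^sup>+x. ennreal (2 ^ (2 * k)) * (?G x * ?ex x) \<partial>D) = ennreal (2 ^ (2 * k)) * (\<integral>\<^sup>+x. ?G x * ?ex x \<partial>D)"
        by (rule nn_integral_cmult) measurable
      finally have Jo: "Jo m \<le> ennreal (2 ^ (2 * k)) * (\<integral>\<^sup>+x. ?G x * ?ex x \<partial>D) * (\<integral>\<^sup>+x'. ?ex x' \<partial>D)" .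
      have "?c * (\<integral>\<^sup>+x. ?ex x \<partial>D) = (\<integral>\<^sup>+x. ?c * ?ex x \<partial>D)"
        by (rule nn_integral_cmult[symmetric]) measurable
      also have "\<dots> \<le> (\<integral>\<^sup>+x. ennreal C * ennreal (enn2real (min_avg p r x) powr (- \<beta>)) \<partial>D)"
      proof (intro nn_integral_mono_AE, use pos in eventually_elim)
        fix x assume mx: "0 < enn2real (min_avg p r x)"
        let ?t = "(real m - 1) * ?q x" and ?mr = "enn2real (min_avg p r x)"
        have q0: "0 < ?q x" using q_ge[of x] mx vr by (auto intro: less_le_trans[OF mult_pos_pos])
        have "(real m - 1) / 2 * ?q x \<le> (real m - 3) * ?q x"
          using elim by (intro mult_right_mono) auto
        then have "?e m (1 / 4) x \<le> exp (- (1 / 8 * ?t))" by simp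
        then have "(real m - 1) powr \<beta> * ?e m (1 / 4) x \<le> (real m - 1) powr \<beta> * exp (- (1 / 8 * ?t))"
          by (intro mult_left_mono) auto
        also have "\<dots> = ?t powr \<beta> * exp (- (1 / 8 * ?t)) * ?q x powr (- \<beta>)"
          using q0 elim by (subst powr_mult) (auto simp: powr_minus field_simps)
        also have "\<dots> \<le> (\<beta> / (1 / 8)) powr \<beta> * ?q x powr (- \<beta>)"
          using powr_mult_exp_le[OF \<beta>, of ?t "1 / 8"] elim by (intro mult_right_mono) auto
        also have "\<dots> \<le> (\<beta> / (1 / 8)) powr \<beta> * (?mr * ball_vol TYPE('a) r) powr (- \<beta>)"
          using mx vr \<beta> q_ge[of x] by (intro mult_left_mono powr_mono2') auto
        also have "(?mr * ball_vol TYPE('a) r) powr (- \<beta>) = ?mr powr (- \<beta>) * ball_vol TYPE('a) r powr (- \<beta>)"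
          by (rule powr_mult)
        finally have "(real m - 1) powr \<beta> * ?e m (1 / 4) x \<le> C * ?mr powr (- \<beta>)"
          by (simp only: C_def mult_ac)
        then show "?c * ?ex x \<le> ennreal C * ennreal (?mr powr (- \<beta>))"
          using C by (simp only: ennreal_mult[symmetric] ennreal_leI exp_ge_zero powr_ge_zero)
      qed
      also have "\<dots> = ennreal C * ?K" by (rule nn_integral_cmult) measurable
      finally have e: "?c * (\<integral>\<^sup>+x. ?ex x \<partial>D) \<le> ennreal C * ?K" .
      have "?c * (2 * Jo m) \<le> ?c * (2 * (ennreal (2 ^ (2 * k)) * (\<integral>\<^sup>+x. ?G x * ?ex x \<partial>D) * (\<integral>\<^sup>+x'. ?ex x' \<partial>D)))"
        using Jo by (intro mult_left_mono) auto
      also have "\<dots> = (2 * (ennreal (2 ^ (2 * k)) * (\<integral>\<^sup>+x. ?G x * ?ex x \<partial>D))) * (?c * (\<integral>\<^sup>+x'. ?ex x' \<partial>D))"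
        by (simp only: mult_ac)
      also have "\<dots> \<le> (2 * (ennreal (2 ^ (2 * k)) * (\<integral>\<^sup>+x. ?G x * ?ex x \<partial>D))) * (ennreal C * ?K)"
        by (intro mult_left_mono e) auto
      also have "\<dots> = ?H m" by (simp only: mult_ac)
      finally show ?case .
    qed
    from tendsto_sandwich[OF _ this tendsto_const lim] show ?thesis by simp
  qed
  have "(\<lambda>m. ennreal (1 / real m) * (ennreal ((real m - 1) powr \<beta>) * (2 * Jd m)) + ennreal ((real m - 1) powr \<beta>) * (2 * Jo m)) \<longlonglongrightarrow> 0 + 0"
    by (intro tendsto_add T1 T2)
  then have lim: "(\<lambda>m. ennreal (1 / real m) * (ennreal ((real m - 1) powr \<beta>) * (2 * Jd m)) + ennreal ((real m - 1) powr \<beta>) * (2 * Jo m)) \<longlonglongrightarrow> 0"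
    by simp
  show ?thesis
    by (rule tendsto_sandwich[OF _ eventually_mono[OF eventually_ge_at_top[of "2 * k + 2"] bound] tendsto_const lim]) auto
qed

end

section \<open>Consistency for a dominated estimator function\<close>

text \<open>The building blocks are indicators of t < u with strict inequality, matching the events
  whose frequencies are known to converge. The approximant is exactly 0 outside the window, so only
  \<phi> itself is left to estimate there.\<close>

lemma continuous_on_step_approximation:
  fixes f :: "real \<Rightarrow> real"
  assumes f: "continuous_on {\<alpha>..\<beta>} f" and \<alpha>: "\<alpha> < \<beta>" and d: "0 < d"
  shows "\<exists>(N::nat) c t. (\<forall>j\<le>N. \<alpha> \<le> t j) \<and>
    (\<forall>u. \<alpha> < u \<longrightarrow> u \<le> \<beta> \<longrightarrow> \<bar>f u - (\<Sum>j\<le>N. c j * of_bool (t j < u))\<bar> \<le> d) \<and>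
    (\<forall>u. u \<le> \<alpha> \<or> \<beta> < u \<longrightarrow> (\<Sum>j\<le>N. c j * of_bool (t j < u)) = 0)"
proof -
  have "uniformly_continuous_on {\<alpha>..\<beta>} f"
    using f by (intro compact_uniformly_continuous) auto
  then obtain e where e: "0 < e" "\<And>x y. x \<in> {\<alpha>..\<beta>} \<Longrightarrow> y \<in> {\<alpha>..\<beta>} \<Longrightarrow> dist x y < e \<Longrightarrow> dist (f x) (f y) < d"
    using d unfolding uniformly_continuous_on_def by metis
  obtain N :: nat where N: "(\<beta> - \<alpha>) / e < real N" using reals_Archimedean2 by blast
  have "0 < (\<beta> - \<alpha>) / e" using \<alpha> e by simp
  with N have N0: "0 < N" using of_nat_0_less_iff by (metis less_trans)
  define h where "h = (\<beta> - \<alpha>) / real N"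
  have h: "0 < h" "h < e" using \<alpha> e N N0 by (auto simp: h_def field_simps)
  define t where "t = (\<lambda>j. \<alpha> + real j * h)"
  have tN: "t N = \<beta>" using N0 by (simp add: t_def h_def)
  have t0: "t 0 = \<alpha>" by (simp add: t_def)
  have t_mono: "t i \<le> t j" if "i \<le> j" for i j using that h by (simp add: t_def)
  have tS: "t (Suc j) = t j + h" for j by (simp add: t_def algebra_simps)
  \<comment> \<open>\<open>g j\<close> is the value on the j-th cell, taken at its right end, and 0
    beyond the last cell. The coefficients \<open>c\<close> are its increments, so the sum over t j
    < u telescopes to the value on the cell of u.\<close>
  define g where "g = (\<lambda>j. if j < N then f (t (Suc j)) else 0)"
  define c where "c = (\<lambda>j. g j - (if j = 0 then 0 else g (j - 1)))"
  have csum: "(\<Sum>j\<le>i. c j) = g i" for i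
    by (induction i) (auto simp: c_def)
  have val: "(\<Sum>j\<le>N. c j * of_bool (t j < u)) = g i" if i: "i \<le> N" "t i < u" "i < N \<Longrightarrow> u \<le> t (Suc i)" for u i
  proof -
    have iff: "t j < u \<longleftrightarrow> j \<le> i" if "j \<le> N" for j
    proof
      assume "t j < u"
      show "j \<le> i"
      proof (rule ccontr)
        assume "\<not> j \<le> i"
        then have "i < N" "t (Suc i) \<le> t j" using \<open>j \<le> N\<close> by (auto intro: t_mono)
        with i \<open>t j < u\<close> show False by auto
      qed
    next
      assume "j \<le> i"
      then show "t j < u" using t_mono[of j i] i by auto
    qed
    have "(\<Sum>j\<le>N. c j * of_bool (t j < u)) = (\<Sum>j\<le>N. if j \<le> i then c j else 0)"
      by (intro sum.cong) (auto simp: iff)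
    also have "\<dots> = (\<Sum>j\<le>i. c j)"
      using i by (subst sum.inter_filter[symmetric]) (auto intro!: sum.cong)
    finally show ?thesis by (simp add: csum)
  qed
  have low: "(\<Sum>j\<le>N. c j * of_bool (t j < u)) = 0" if "u \<le> \<alpha>" for u
  proof (rule sum.neutral, intro ballI)
    fix j
    have "\<not> t j < u" using t_mono[of 0 j] t0 that by auto
    then show "c j * of_bool (t j < u) = 0" by simp
  qed
  have high: "(\<Sum>j\<le>N. c j * of_bool (t j < u)) = 0" if "\<beta> < u" for u
    using val[of N u] that tN by (simp add: g_def)
  have mid: "\<bar>f u - (\<Sum>j\<le>N. c j * of_bool (t j < u))\<bar> \<le> d" if u: "\<alpha> < u" "u \<le> \<beta>" for u
  proof -
    define i where "i = (LEAST j. u \<le> t (Suc j))"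
    have ex: "u \<le> t (Suc (N - 1))" using u tN N0 by simp
    have i1: "u \<le> t (Suc i)" unfolding i_def using ex by (rule LeastI)
    have "i \<le> N - 1" unfolding i_def using ex by (rule Least_le)
    then have iN: "i < N" using N0 by simp
    have i2: "t i < u"
    proof (cases i)
      case 0
      then show ?thesis using u t0 by simp
    next
      case (Suc j)
      then have "\<not> u \<le> t (Suc j)" unfolding i_def by (metis i_def lessI not_less_Least)
      with Suc show ?thesis by simp
    qed
    have "(\<Sum>j\<le>N. c j * of_bool (t j < u)) = f (t (Suc i))"
      using val[of i u] iN i1 i2 by (simp add: g_def)
    moreover have "t (Suc i) \<in> {\<alpha>..\<beta>}"
      using t_mono[of 0 "Suc i"] t_mono[of "Suc i" N] t0 tN iN by simp
    moreover have "dist u (t (Suc i)) < e"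
      using i1 i2 tS[of i] h by (simp add: dist_real_def)
    ultimately show ?thesis
      using e(2)[of u "t (Suc i)"] u by (simp add: dist_real_def less_imp_le)
  qed
  show ?thesis
  proof (rule exI[of _ N], rule exI[of _ c], rule exI[of _ t], intro conjI)
    show "\<forall>j\<le>N. \<alpha> \<le> t j" using t_mono[of 0] t0 by auto
    show "\<forall>u. \<alpha> < u \<longrightarrow> u \<le> \<beta> \<longrightarrow> \<bar>f u - (\<Sum>j\<le>N. c j * of_bool (t j < u))\<bar> \<le> d"
      by (intro allI impI mid)
    show "\<forall>u. u \<le> \<alpha> \<or> \<beta> < u \<longrightarrow> (\<Sum>j\<le>N. c j * of_bool (t j < u)) = 0"
      using low high by blast
  qed
qed

lemma tendsto_0_ennrealI:
  fixes f :: "'b \<Rightarrow> ennreal"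
  assumes "\<And>e::real. 0 < e \<Longrightarrow> \<forall>\<^sub>F x in F. f x \<le> ennreal e"
  shows "(f \<longlongrightarrow> 0) F"
proof (rule order_tendstoI)
  fix y :: ennreal assume "0 < y"
  then obtain z where z: "0 < z" "z < y" using dense by blast
  then have "z < \<top>" using less_top_ennreal by (metis less_trans top.not_eq_extremum)
  then obtain e where e: "z = ennreal e" "0 \<le> e" by (cases z) auto
  with z have "0 < e" by (simp add: ennreal_less_zero_iff)
  from assms[OF this] show "\<forall>\<^sub>F x in F. f x < y"
    by eventually_elim (use z e in auto)
qed simp

section \<open>Gamma tails near infinity and near zero\<close>

context knn_density
begin

lemma nn_integral_erlang: "0 < l \<Longrightarrow> (\<integral>\<^sup>+u. ennreal (erlang_density (k - 1) l u) \<partial>lborel) = 1"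
  using prob_space.emeasure_space_1[OF prob_space_erlang_density, of l "k - 1"] by (simp add: emeasure_density)

lemma nn_integral_erlang_tail:
  assumes l: "0 < l" and t: "0 \<le> t"
  shows "(\<integral>\<^sup>+u. of_bool (t < u) * ennreal (erlang_density (k - 1) l u) \<partial>lborel) = ennreal (Q t l)"
proof -
  let ?e = "\<lambda>u. ennreal (erlang_density (k - 1) l u)"
  have Q: "Q t l = 1 - erlang_CDF (k - 1) l t"
    using t k_pos by (simp add: erlang_CDF_def Q_def lessThan_Suc_atMost[symmetric] mult.commute)
  have "(\<integral>\<^sup>+u. of_bool (t < u) * ?e u \<partial>lborel) + ennreal (erlang_CDF (k - 1) l t)
    = (\<integral>\<^sup>+u. of_bool (t < u) * ?e u + ?e u * indicator {..t} u \<partial>lborel)"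
    using l by (subst nn_integral_add) (auto simp: nn_integral_erlang_density)
  also have "\<dots> = (\<integral>\<^sup>+u. ?e u \<partial>lborel)"
    by (intro nn_integral_cong) (auto split: split_indicator)
  also have "\<dots> = 1" using l by (rule nn_integral_erlang)
  also have "1 = ennreal (Q t l) + ennreal (erlang_CDF (k - 1) l t)"
    using Q_bounds[OF t l] l by (subst ennreal_plus[symmetric]) (auto simp: Q)
  finally show ?thesis by simp
qed

text \<open>No mass of the mixture sits at infinity, because the rate p x is positive
  \<open>D\<close>-almost everywhere. The shift by 1 keeps all thresholds positive.\<close>

lemma limit_tail_at_top: "(\<lambda>n. limit_tail (real n + 1)) \<longlonglongrightarrow> 0"
proof -
  have "(\<lambda>n. \<integral>x. Q (real n + 1) (p x) \<partial>D) \<longlonglongrightarrow> (\<integral>x. 0 \<partial>D)"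
  proof (intro integral_dominated_convergence[where w="\<lambda>_. 1"])
    have "AE x in D. 0 < p x" using AE_ball_ratio by eventually_elim auto
    then show "AE x in D. (\<lambda>n. Q (real n + 1) (p x)) \<longlonglongrightarrow> 0"
    proof eventually_elim
      case (elim x)
      define c where "c = p x"
      have c: "0 < c" using elim by (simp add: c_def)
      have "(\<lambda>n. ((real n + 1) * c) ^ i * exp (- ((real n + 1) * c)) / fact i) \<longlonglongrightarrow> 0" for i
        using c by real_asymp
      then have "(\<lambda>n. Q (real n + 1) c) \<longlonglongrightarrow> (\<Sum>i<k. 0)"
        unfolding Q_def by (intro tendsto_sum)
      then show ?case by (simp add: c_def)
    qed
    show "AE x in D. norm (Q (real n + 1) (p x)) \<le> 1" for n
      using AE_Q_bounds[of "real n + 1"] by auto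
  qed auto
  then show ?thesis by (simp add: limit_tail_def)
qed

lemma limit_tail_at_0: "(\<lambda>n. limit_tail (1 / (real n + 1))) \<longlonglongrightarrow> 1"
proof -
  have "(\<lambda>n. \<integral>x. Q (1 / (real n + 1)) (p x) \<partial>D) \<longlonglongrightarrow> (\<integral>x. 1 \<partial>D)"
  proof (intro integral_dominated_convergence[where w="\<lambda>_. 1"])
    show "AE x in D. (\<lambda>n. Q (1 / (real n + 1)) (p x)) \<longlonglongrightarrow> 1"
    proof (rule AE_I2)
      fix x
      have l: "(\<lambda>n. 1 / (real n + 1) * p x) \<longlonglongrightarrow> 0" by real_asymp
      have "(\<lambda>n. Q (1 / (real n + 1)) (p x)) \<longlonglongrightarrow> (\<Sum>i<k. 0 ^ i * exp (- 0) / fact i)"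
        unfolding Q_def by (intro tendsto_intros l) auto
      also have "(\<Sum>i<k. 0 ^ i * exp (- 0) / fact i) = (\<Sum>i<k. if i = 0 then 1 else (0::real))"
        by (intro sum.cong) auto
      also have "\<dots> = 1" using k_pos by (simp add: sum.delta)
      finally show "(\<lambda>n. Q (1 / (real n + 1)) (p x)) \<longlonglongrightarrow> 1" .
    qed
    show "AE x in D. norm (Q (1 / (real n + 1)) (p x)) \<le> 1" for n
      using AE_Q_bounds[of "1 / (real n + 1)"] by auto
  qed auto
  then show ?thesis using prob_space by (simp add: limit_tail_def)
qed

end

text \<open>The moment assumptions are what the properties U and L yield when rewritten under
  \<open>D\<close>. Putting \<phi> = 0 off the positive reals makes a function that is continuous
  there Borel on the whole line.\<close>

locale knn_estimator = knn_density p k for p :: "'a::euclidean_space \<Rightarrow> real" and k +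
  fixes \<phi> :: "real \<Rightarrow> real" and a b C r\<^sub>1 r\<^sub>2 :: real
  assumes \<phi>_borel [measurable]: "\<phi> \<in> borel_measurable borel"
    and \<phi>_cont: "continuous_on {0<..} \<phi>"
    and \<phi>_nonpos: "\<And>u. u \<le> 0 \<Longrightarrow> \<phi> u = 0"
    and \<phi>_bound: "\<And>u. 0 < u \<Longrightarrow> \<bar>\<phi> u\<bar> \<le> C * poly_envelope a b u"
    and C: "0 \<le> C"
    and k_gt: "real k > - 2 * a"
    and r: "0 < r\<^sub>1" "0 < r\<^sub>2"
    and max_moment: "a < 0 \<Longrightarrow> (\<integral>\<^sup>+x. max_avg p r\<^sub>1 x ^ k \<partial>D) < \<infinity>"
    and min_pos: "0 < b \<Longrightarrow> AE x in D. 0 < enn2real (min_avg p r\<^sub>2 x)"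
    and min_moment: "0 < b \<Longrightarrow> (\<integral>\<^sup>+x. ennreal (enn2real (min_avg p r\<^sub>2 x) powr (- (2 * b))) \<partial>D) < \<infinity>"
    and dist_moment: "0 < b \<Longrightarrow> (\<integral>\<^sup>+x. mean_vpow (2 * b) x \<partial>D) < \<infinity>"
begin

text \<open>\<open>low\<close>, \<open>high\<close> and \<open>far\<close> together dominate \<phi>
  outside the window from 1 / (n + 1) to n + 1. The exponents \<open>min a 0\<close> and
  \<open>max b 0\<close> reflect that the envelope is at most 1 near 0 for a >= 0 and at most 1 near
  infinity for b <= 0; in the latter case \<open>high\<close> needs no restriction on the radius and
  \<open>far\<close> is 0.\<close>

definition low :: "nat \<Rightarrow> nat \<Rightarrow> (nat \<Rightarrow> 'a) \<Rightarrow> nat \<Rightarrow> real" where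
  "low n m w i = U m w i powr min a 0 * of_bool (0 < U m w i \<and> U m w i \<le> 1 / (real n + 1))"

definition high :: "nat \<Rightarrow> nat \<Rightarrow> (nat \<Rightarrow> 'a) \<Rightarrow> nat \<Rightarrow> real" where
  "high n m w i = U m w i powr max b 0 * of_bool (real n + 1 < U m w i \<and> (b \<le> 0 \<or> knn_radius k {1..m} w i \<le> r\<^sub>2))"

definition far :: "nat \<Rightarrow> (nat \<Rightarrow> 'a) \<Rightarrow> nat \<Rightarrow> real" where
  "far m w i = (if 0 < b then far_part b r\<^sub>2 m w i else 0)"

lemma envelope_le: "0 < u \<Longrightarrow> u \<le> 1 \<Longrightarrow> poly_envelope a b u \<le> u powr min a 0"
  "1 < u \<Longrightarrow> poly_envelope a b u \<le> u powr max b 0"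
  by (auto simp: poly_envelope_def intro: powr_mono powr_mono')

lemma \<phi>_tail_bound:
  assumes m: "k < m" "i \<in> {1..m}" and out: "0 < U m w i" "U m w i \<le> 1 / (real n + 1) \<or> real n + 1 < U m w i"
  shows "\<bar>\<phi> (U m w i)\<bar> \<le> C * (low n m w i + high n m w i + far m w i)"
proof -
  let ?u = "U m w i"
  have nn: "0 \<le> low n m w i" "0 \<le> high n m w i" "0 \<le> far m w i"
    by (auto simp: low_def high_def far_def far_part_def)
  have "poly_envelope a b ?u \<le> low n m w i + high n m w i + far m w i"
  proof (cases "?u \<le> 1 / (real n + 1)")
    case True
    have "1 / (real n + 1) \<le> 1" by simp
    with True have "?u \<le> 1" by linarith
    from envelope_le(1)[OF out(1) this] have "poly_envelope a b ?u \<le> low n m w i"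
      using True out by (simp add: low_def)
    then show ?thesis using nn by linarith
  next
    case False
    with out have u: "real n + 1 < ?u" by simp
    then have "1 < ?u" by simp
    note env = envelope_le(2)[OF this]
    show ?thesis
    proof (cases "b \<le> 0 \<or> knn_radius k {1..m} w i \<le> r\<^sub>2")
      case True
      then have "poly_envelope a b ?u \<le> high n m w i"
        using env u by (simp add: high_def)
      then show ?thesis using nn by linarith
    next
      case False
      then have "poly_envelope a b ?u \<le> far m w i"
        using env by (simp add: far_def far_part_def)
      then show ?thesis using nn by linarith
    qed
  qed
  then have "C * poly_envelope a b ?u \<le> C * (low n m w i + high n m w i + far m w i)"
    using C by (intro mult_left_mono) auto
  with \<phi>_bound[OF out(1)] show ?thesis by linarith
qed

text \<open>For negative \<open>a\<close> this is \<open>U_lower_moment\<close> with exponent 2 a.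
  Otherwise \<open>low\<close> is the indicator of a small volume, whose probability converges to
  the mass of the mixture near 0. The window index n is fixed before m grows, and the bound is
  uniform in i.\<close>

lemma low_small:
  assumes \<eta>: "0 < \<eta>"
  shows "\<forall>\<^sub>F n in sequentially. \<forall>\<^sub>F m in sequentially. \<forall>i\<in>{1..m}.
    (\<integral>\<^sup>+w. ennreal ((low n m w i)\<^sup>2) \<partial>sample {1..m}) \<le> ennreal \<eta>"
proof (cases "a < 0")
  case True
  let ?K = "\<integral>\<^sup>+x. max_avg p r\<^sub>1 x ^ k \<partial>D"
  define g where "g = real k + 2 * a"
  have g: "0 < g" using k_gt by (simp add: g_def)
  let ?B = "\<lambda>n. ennreal (2 powr (1 - 2 * a)) * (ennreal ((2 * (1 / (real n + 1))) powr g / g) * ?K)"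
  have "(\<lambda>n. (2 * (1 / (real n + 1))) powr g / g) \<longlonglongrightarrow> 0"
    using g by real_asymp
  then have "?B \<longlonglongrightarrow> ennreal (2 powr (1 - 2 * a)) * (ennreal 0 * ?K)"
    using max_moment[OF True] by (intro ennreal_tendsto_cmult ennreal_tendsto_multc tendsto_ennrealI) auto
  then have "?B \<longlonglongrightarrow> 0" by simp
  then have "\<forall>\<^sub>F n in sequentially. ?B n < ennreal \<eta>"
    using \<eta> by (intro order_tendstoD(2)) auto
  then show ?thesis
  proof eventually_elim
    case (elim n)
    let ?\<epsilon> = "1 / (real n + 1)"
    have "\<forall>\<^sub>F m in sequentially. \<rho> m (2 * ?\<epsilon>) < r\<^sub>1"
      using \<rho>_limit r(1) by (intro order_tendstoD(2)) auto
    then show ?case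
      using eventually_gt_at_top[of k]
    proof eventually_elim
      case (elim m)
      show ?case
      proof
        fix i assume i: "i \<in> {1..m}"
        have "(\<integral>\<^sup>+w. ennreal ((low n m w i)\<^sup>2) \<partial>sample {1..m})
          = (\<integral>\<^sup>+w. ennreal (U m w i powr (2 * a)) * of_bool (0 < U m w i \<and> U m w i \<le> ?\<epsilon>) \<partial>sample {1..m})"
          using True by (intro nn_integral_cong)
            (simp add: low_def power_mult_distrib power2_eq_square powr_add[symmetric] min_absorb1)
        also have "\<dots> \<le> ?B n"
          using elim i True g unfolding g_def
          by (intro U_lower_moment) auto
        also have "\<dots> \<le> ennreal \<eta>" using \<open>?B n < ennreal \<eta>\<close> by simp
        finally show "(\<integral>\<^sup>+w. ennreal ((low n m w i)\<^sup>2) \<partial>sample {1..m}) \<le> ennreal \<eta>" .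
      qed
    qed
  qed
next
  case False
  have "\<forall>\<^sub>F n in sequentially. 1 - \<eta> / 2 < limit_tail (1 / (real n + 1))"
    using limit_tail_at_0 \<eta> by (intro order_tendstoD(1)) auto
  then show ?thesis
  proof eventually_elim
    case (elim n)
    let ?\<epsilon> = "1 / (real n + 1)"
    have "(\<lambda>m. 1 - tail1 m ?\<epsilon>) \<longlonglongrightarrow> 1 - ennreal (limit_tail ?\<epsilon>)"
      by (intro tendsto_diff_ennreal tail1_limit) auto
    moreover have "1 - ennreal (limit_tail ?\<epsilon>) < ennreal \<eta>"
    proof -
      have "1 - ennreal (limit_tail ?\<epsilon>) = ennreal (1 - limit_tail ?\<epsilon>)"
        using limit_tail_nonneg[of ?\<epsilon>] by (subst ennreal_minus[symmetric]) auto
      also have "\<dots> < ennreal \<eta>" using elim \<eta> by (intro ennreal_lessI) auto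
      finally show ?thesis .
    qed
    ultimately have "\<forall>\<^sub>F m in sequentially. 1 - tail1 m ?\<epsilon> < ennreal \<eta>"
      by (rule order_tendstoD(2))
    then show ?case
      using eventually_gt_at_top[of k]
    proof eventually_elim
      case (elim m)
      show ?case
      proof
        fix i assume i: "i \<in> {1..m}"
        let ?P = "sample {1..m}"
        have "(\<integral>\<^sup>+w. ennreal ((low n m w i)\<^sup>2) \<partial>?P) \<le> (\<integral>\<^sup>+w. of_bool (U m w i \<le> ?\<epsilon>) \<partial>?P)"
          using False by (intro nn_integral_mono) (auto simp: low_def min_absorb2)
        also have "(\<integral>\<^sup>+w. of_bool (U m w i \<le> ?\<epsilon>) \<partial>?P) = 1 - tail1 m ?\<epsilon>"
          using elim i by (intro U_head) auto
        also have "\<dots> \<le> ennreal \<eta>" using elim by simp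
        finally show "(\<integral>\<^sup>+w. ennreal ((low n m w i)\<^sup>2) \<partial>?P) \<le> ennreal \<eta>" .
      qed
    qed
  qed
qed

text \<open>For positive \<open>b\<close> the bound is a tail of the convergent integral of
  \<open>near_tail\<close>, the same for all m > k. Otherwise \<open>high\<close> is the indicator
  of a large volume and the mixture has little mass far out.\<close>

lemma high_small:
  assumes \<eta>: "0 < \<eta>"
  shows "\<forall>\<^sub>F n in sequentially. \<forall>\<^sub>F m in sequentially. \<forall>i\<in>{1..m}.
    (\<integral>\<^sup>+w. ennreal ((high n m w i)\<^sup>2) \<partial>sample {1..m}) \<le> ennreal \<eta>"
proof (cases "0 < b")
  case True
  let ?I = "\<lambda>t. \<integral>\<^sup>+s. ennreal (s powr (2 * b - 1)) * indicator {t<..} s * near_tail r\<^sub>2 s \<partial>lborel"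
  have "?I 0 < \<infinity>"
    using near_tail_integral_finite[of "2 * b" r\<^sub>2] min_pos[OF True] min_moment[OF True] True by simp
  then have "(\<lambda>n. ?I (real n)) \<longlonglongrightarrow> 0"
    by (rule near_tail_integral_vanishes)
  then have "(\<lambda>n. ennreal (2 powr (2 * b + 1)) * ?I (real n)) \<longlonglongrightarrow> ennreal (2 powr (2 * b + 1)) * 0"
    by (intro ennreal_tendsto_cmult) auto
  then have lim: "(\<lambda>n. ennreal (2 powr (2 * b + 1)) * ?I (real n)) \<longlonglongrightarrow> 0" by simp
  then obtain n0 where n0: "ennreal (2 powr (2 * b + 1)) * ?I (real n0) < ennreal \<eta>"
    using order_tendstoD(2)[OF lim, of "ennreal \<eta>"] \<eta> eventually_sequentially by auto
  show ?thesis
    \<comment> \<open>\<open>U_near_upper_moment\<close> halves the threshold n + 1, so n is taken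
      at least \<open>2 * n0\<close>.\<close>
    using eventually_ge_at_top[of "2 * n0"]
  proof eventually_elim
    case (elim n)
    show ?case
      using eventually_gt_at_top[of k]
    proof eventually_elim
      case (elim m)
      show ?case
      proof
        fix i assume i: "i \<in> {1..m}"
        have "(\<integral>\<^sup>+w. ennreal ((high n m w i)\<^sup>2) \<partial>sample {1..m})
          = (\<integral>\<^sup>+w. ennreal (U m w i powr (2 * b)) * of_bool (real n + 1 < U m w i \<and> knn_radius k {1..m} w i \<le> r\<^sub>2) \<partial>sample {1..m})"
          using True by (intro nn_integral_cong)
            (simp add: high_def power_mult_distrib power2_eq_square powr_add[symmetric] max_absorb1)
        also have "\<dots> \<le> ennreal (2 powr (2 * b + 1)) * ?I ((real n + 1) / 2)"
          using elim i True r by (intro U_near_upper_moment) auto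
        also have "\<dots> \<le> ennreal (2 powr (2 * b + 1)) * ?I (real n0)"
          using \<open>2 * n0 \<le> n\<close> by (intro mult_left_mono nn_integral_mono mult_right_mono) (auto split: split_indicator)
        also have "\<dots> \<le> ennreal \<eta>" using n0 by simp
        finally show "(\<integral>\<^sup>+w. ennreal ((high n m w i)\<^sup>2) \<partial>sample {1..m}) \<le> ennreal \<eta>" .
      qed
    qed
  qed
next
  case False
  have "\<forall>\<^sub>F n in sequentially. limit_tail (real n + 1) < \<eta>"
    using limit_tail_at_top \<eta> by (intro order_tendstoD(2)) auto
  then show ?thesis
  proof eventually_elim
    case (elim n)
    have "\<forall>\<^sub>F m in sequentially. tail1 m (real n + 1) < ennreal \<eta>"
      using elim \<eta> by (intro order_tendstoD(2)[OF tail1_limit]) (auto intro!: ennreal_lessI)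
    then show ?case
      using eventually_gt_at_top[of k]
    proof eventually_elim
      case (elim m)
      show ?case
      proof
        fix i assume i: "i \<in> {1..m}"
        have "(\<integral>\<^sup>+w. ennreal ((high n m w i)\<^sup>2) \<partial>sample {1..m}) \<le> (\<integral>\<^sup>+w. of_bool (real n + 1 < U m w i) \<partial>sample {1..m})"
          using False by (intro nn_integral_mono) (auto simp: high_def max_absorb2)
        also have "\<dots> = tail1 m (real n + 1)"
          unfolding tail1_def using elim i by (intro U_tail) auto
        also have "\<dots> \<le> ennreal \<eta>" using elim by simp
        finally show "(\<integral>\<^sup>+w. ennreal ((high n m w i)\<^sup>2) \<partial>sample {1..m}) \<le> ennreal \<eta>" .
      qed
    qed
  qed
qed

lemma far_vanishes:
  "(\<lambda>m. \<integral>\<^sup>+w. ennreal (((\<Sum>i\<in>{1..m}. far m w i) / real m)\<^sup>2) \<partial>sample {1..m}) \<longlonglongrightarrow> 0"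
proof (cases "0 < b")
  case True
  then show ?thesis
    using far_part_vanishes[OF r(2) True min_pos[OF True] min_moment[OF True] dist_moment[OF True]]
    by (simp add: far_def)
qed (simp add: far_def)

end

lemma add_square_le: "(x + y)\<^sup>2 \<le> 2 * x\<^sup>2 + 2 * y\<^sup>2" for x y :: real
  using sum_squares_bound[of x y] by (simp add: power2_sum)

text \<open>The square of a mean is at most the mean of the squares. Unlike
  \<open>sum_square_L2_bound\<close>, this needs second moments that are themselves small, and no
  information on pairs.\<close>

lemma mean_square_L2_bound:
  fixes F :: "'b \<Rightarrow> nat \<Rightarrow> real"
  assumes m: "0 < m"
    and meas: "\<And>i. i \<in> {1..m} \<Longrightarrow> (\<lambda>w. F w i) \<in> borel_measurable P"
    and bound: "\<And>i. i \<in> {1..m} \<Longrightarrow> (\<integral>\<^sup>+w. ennreal ((F w i)\<^sup>2) \<partial>P) \<le> A"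
  shows "(\<integral>\<^sup>+w. ennreal (((\<Sum>i\<in>{1..m}. F w i) / real m)\<^sup>2) \<partial>P) \<le> A"
proof -
  have "(\<integral>\<^sup>+w. ennreal (((\<Sum>i\<in>{1..m}. F w i) / real m)\<^sup>2) \<partial>P)
     \<le> (\<integral>\<^sup>+w. ennreal (1 / real m) * (\<Sum>i\<in>{1..m}. ennreal ((F w i)\<^sup>2)) \<partial>P)"
  proof (intro nn_integral_mono)
    fix w
    have "((\<Sum>i\<in>{1..m}. F w i) / real m)\<^sup>2 \<le> (\<Sum>i\<in>{1..m}. (F w i)\<^sup>2) * real m / (real m)\<^sup>2"
      using sum_squared_le_sum_of_squares[of "F w" "{1..m}"] by (simp add: power_divide divide_right_mono)
    also have "\<dots> = 1 / real m * (\<Sum>i\<in>{1..m}. (F w i)\<^sup>2)"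
      using m by (simp add: power2_eq_square)
    finally have "ennreal (((\<Sum>i\<in>{1..m}. F w i) / real m)\<^sup>2) \<le> ennreal (1 / real m * (\<Sum>i\<in>{1..m}. (F w i)\<^sup>2))"
      by (rule ennreal_leI)
    also have "\<dots> = ennreal (1 / real m) * ennreal (\<Sum>i\<in>{1..m}. (F w i)\<^sup>2)"
      by (rule ennreal_mult) (auto intro: sum_nonneg)
    finally show "ennreal (((\<Sum>i\<in>{1..m}. F w i) / real m)\<^sup>2) \<le> ennreal (1 / real m) * (\<Sum>i\<in>{1..m}. ennreal ((F w i)\<^sup>2))"
      by (simp only: sum_ennreal zero_le_power2)
  qed
  also have "\<dots> = ennreal (1 / real m) * (\<integral>\<^sup>+w. (\<Sum>i\<in>{1..m}. ennreal ((F w i)\<^sup>2)) \<partial>P)"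
    by (rule nn_integral_cmult)
       (intro borel_measurable_sum measurable_compose[OF borel_measurable_power[OF meas] measurable_ennreal])
  also have "(\<integral>\<^sup>+w. (\<Sum>i\<in>{1..m}. ennreal ((F w i)\<^sup>2)) \<partial>P) = (\<Sum>i\<in>{1..m}. \<integral>\<^sup>+w. ennreal ((F w i)\<^sup>2) \<partial>P)"
    by (rule nn_integral_sum) (rule measurable_compose[OF borel_measurable_power[OF meas] measurable_ennreal])
  also have "\<dots> \<le> (\<Sum>i\<in>{1..m}. A)" by (intro sum_mono bound)
  also have "ennreal (1 / real m) * (\<Sum>i\<in>{1..m}. A) = (ennreal (1 / real m) * of_nat m) * A"
    by (simp add: mult.assoc)
  also have "ennreal (1 / real m) * of_nat m = 1"
    using m by (simp add: ennreal_of_nat_eq_real_of_nat ennreal_mult[symmetric])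
  finally show ?thesis by (simp add: mult_left_mono)
qed

section \<open>Almost surely the sample has no repetitions\<close>

context knn_density
begin

text \<open>\<open>D\<close> has no atoms, so given \<open>w i\<close> another point hits it with
  probability 0, and there are finitely many pairs.\<close>

lemma AE_sample_inj: "AE w in sample {1..m}. inj_on w {1..m}" for m :: nat
proof -
  have ne: "AE w in sample {1..m}. w i \<noteq> w j" if ij: "i \<in> {1..m}" "j \<in> {1..m}" "i \<noteq> j" for i j
  proof -
    note [measurable] = ij(1,2)
    have sing: "emeasure D {x} = 0" for x
      using emeasure_D_lborel_null[of "{x}"] by simp
    have "(\<integral>\<^sup>+w. of_bool (dist (w i) (w j) = 0) \<partial>sample {1..m})
      = (\<integral>\<^sup>+x. \<integral>\<^sup>+y. \<integral>\<^sup>+w. of_bool (dist ((w(j := y, i := x)) i) ((w(j := y, i := x)) j) = 0) \<partial>sample ({1..m} - {i, j}) \<partial>D \<partial>D)"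
    proof (intro nn_integral_sample_pull2)
      show "(\<lambda>w. of_bool (dist (w i) (w j) = 0) :: ennreal) \<in> borel_measurable (sample {1..m})"
        by measurable
    qed (use ij in auto)
    also have "\<dots> = (\<integral>\<^sup>+x. \<integral>\<^sup>+y. indicator {x} y \<partial>D \<partial>D)"
    proof (intro nn_integral_cong)
      fix x y :: 'a
      interpret S: prob_space "sample ({1..m} - {i, j})" by (rule prob_space_sample)
      have "(\<integral>\<^sup>+w. of_bool (dist ((w(j := y, i := x)) i) ((w(j := y, i := x)) j) = 0) \<partial>sample ({1..m} - {i, j}))
        = (\<integral>\<^sup>+w. indicator {x} y \<partial>sample ({1..m} - {i, j}))"
        using ij by (intro nn_integral_cong) (auto split: split_indicator)
      then show "(\<integral>\<^sup>+w. of_bool (dist ((w(j := y, i := x)) i) ((w(j := y, i := x)) j) = 0) \<partial>sample ({1..m} - {i, j})) = indicator {x} y"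
        using S.emeasure_space_1 by simp
    qed
    also have "\<dots> = 0"
      by (simp add: sing nn_integral_indicator sets_D)
    finally have "(\<integral>\<^sup>+w. of_bool (dist (w i) (w j) = 0) \<partial>sample {1..m}) = 0" .
    then have "AE w in sample {1..m}. (of_bool (dist (w i) (w j) = 0) :: ennreal) = 0"
      by (subst (asm) nn_integral_0_iff_AE) measurable
    then show ?thesis by eventually_elim simp
  qed
  have "AE w in sample {1..m}. \<forall>i\<in>{1..m}. \<forall>j\<in>{1..m}. i \<noteq> j \<longrightarrow> w i \<noteq> w j"
  proof (intro AE_finite_allI)
    fix i j assume "i \<in> {1..m}" "j \<in> {1..m}"
    then show "AE w in sample {1..m}. i \<noteq> j \<longrightarrow> w i \<noteq> w j"
      using ne[of i j] by (cases "i = j") auto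
  qed auto
  then show ?thesis by eventually_elim (auto simp: inj_on_def)
qed

lemma U_pos:
  assumes m: "k < m" "i \<in> {1..m}" and inj: "inj_on w {1..m}"
  shows "0 < U m w i"
proof -
  have "k \<le> card ({1..m} - {i})" using m by simp
  from kth_smallest_attained[OF finite_Diff[OF finite_atLeastAtMost] k_pos this, of "\<lambda>j. dist (w i) (w j)"]
  have "\<exists>j\<in>{1..m} - {i}. knn_radius k {1..m} w i = dist (w i) (w j)"
    unfolding knn_radius_def .
  then obtain j where j: "j \<in> {1..m} - {i}" "knn_radius k {1..m} w i = dist (w i) (w j)"
    by (rule bexE)
  have "j \<in> {1..m}" "i \<noteq> j" using j(1) by simp_all
  then have "w i \<noteq> w j" using inj_onD[OF inj _ m(2), of j] by metis
  then have "0 < ball_vol TYPE('a) (knn_radius k {1..m} w i)"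
    unfolding j(2) by (intro ball_vol_pos) simp
  then show ?thesis using m k_pos by (simp add: U_def)
qed

lemma U_stat_eq_U:
  assumes m: "k < m" "i \<in> {1..m}" and inj: "inj_on w {1..m}"
  shows "U_stat k m w i = U m w i"
  unfolding U_stat_def U_def measure_ball_eq_ball_vol
  using nn_dist_eq_knn_radius[of "{1..m}" i k w] m inj k_pos by simp

end

section \<open>The Gamma mixture and the mean of the estimator function under it\<close>

context knn_estimator
begin

text \<open>Density, with respect to \<open>joint\<close>, of the pair in which x has law
  \<open>D\<close> and, given x, u is Gamma with shape \<open>k\<close> and rate p x. The second
  marginal is the limit law of the volume statistic.\<close>

definition er :: "'a \<times> real \<Rightarrow> real" where
  "er z = erlang_density (k - 1) (p (fst z)) (snd z)"

abbreviation joint :: "('a \<times> real) measure" where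
  "joint \<equiv> D \<Otimes>\<^sub>M lborel"

lemma er_measurable [measurable]: "er \<in> borel_measurable (borel \<Otimes>\<^sub>M borel)"
  unfolding er_def[abs_def] erlang_density_def by measurable

lemma measurable_joint: "f \<in> measurable (borel \<Otimes>\<^sub>M borel) N \<Longrightarrow> f \<in> measurable joint N"
  by (simp only: measurable_cong_sets[OF sets_pair_measure_cong[OF sets_D sets_lborel] refl])

lemma er_nonneg: "0 \<le> er z"
  using p_nonneg by (simp add: er_def)

lemma nn_integral_joint:
  assumes [measurable]: "g \<in> borel_measurable joint"
  shows "(\<integral>\<^sup>+z. g z \<partial>joint) = (\<integral>\<^sup>+x. \<integral>\<^sup>+u. g (x, u) \<partial>lborel \<partial>D)"
  using lborel.nn_integral_fst[of g D] by simp

lemma AE_p_pos: "AE x in D. 0 < p x"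
  using AE_ball_ratio by eventually_elim auto

lemma joint_total: "(\<integral>\<^sup>+z. ennreal (er z) \<partial>joint) = 1"
proof -
  have "(\<integral>\<^sup>+z. ennreal (er z) \<partial>joint) = (\<integral>\<^sup>+x. \<integral>\<^sup>+u. ennreal (er (x, u)) \<partial>lborel \<partial>D)"
    by (rule nn_integral_joint) measurable
  also have "\<dots> = (\<integral>\<^sup>+x. 1 \<partial>D)"
    using AE_p_pos by (intro nn_integral_cong_AE) (auto simp: er_def nn_integral_erlang elim: eventually_mono)
  finally show ?thesis by simp
qed

lemma joint_tail:
  assumes t: "0 \<le> t"
  shows "(\<integral>\<^sup>+z. ennreal (of_bool (t < snd z) * er z) \<partial>joint) = ennreal (limit_tail t)"
proof -
  have "(\<integral>\<^sup>+z. ennreal (of_bool (t < snd z) * er z) \<partial>joint) = (\<integral>\<^sup>+x. \<integral>\<^sup>+u. ennreal (of_bool (t < u) * er (x, u)) \<partial>lborel \<partial>D)"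
  proof -
    have "(\<lambda>z. of_bool (t < snd z) :: real) \<in> borel_measurable (borel \<Otimes>\<^sub>M borel)"
      by measurable
    from nn_integral_joint[OF measurable_joint[OF measurable_compose[OF borel_measurable_times[OF this er_measurable] measurable_ennreal]]]
    show ?thesis by simp
  qed
  also have "\<dots> = (\<integral>\<^sup>+x. ennreal (Q t (p x)) \<partial>D)"
  proof (intro nn_integral_cong_AE, use AE_p_pos in eventually_elim)
    fix x assume px: "0 < p x"
    have "(\<integral>\<^sup>+u. ennreal (of_bool (t < u) * er (x, u)) \<partial>lborel) = (\<integral>\<^sup>+u. of_bool (t < u) * ennreal (er (x, u)) \<partial>lborel)"
      by (intro nn_integral_cong) auto
    then show "(\<integral>\<^sup>+u. ennreal (of_bool (t < u) * er (x, u)) \<partial>lborel) = ennreal (Q t (p x))"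
      using nn_integral_erlang_tail[OF px t] by (simp add: er_def)
  qed
  finally show ?thesis using t by (simp add: nn_integral_Q)
qed

lemma joint_tail_integral:
  assumes t: "0 \<le> t"
  shows "integrable joint (\<lambda>z. of_bool (t < snd z) * er z)" "(\<integral>z. of_bool (t < snd z) * er z \<partial>joint) = limit_tail t"
proof -
  have nn: "0 \<le> of_bool (t < snd z) * er z" for z using er_nonneg[of z] by simp
  show "integrable joint (\<lambda>z. of_bool (t < snd z) * er z)"
    using joint_tail[OF t] nn by (intro integrableI_nonneg) auto
  show "(\<integral>z. of_bool (t < snd z) * er z \<partial>joint) = limit_tail t"
    using joint_tail[OF t] nn limit_tail_nonneg[OF t] by (subst integral_eq_nn_integral) auto
qed

lemma \<phi>_le: "\<bar>\<phi> u\<bar> \<le> C * (u powr min a 0 + u powr max b 0)"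
proof (cases "0 < u")
  case True
  have "poly_envelope a b u \<le> u powr min a 0 + u powr max b 0"
    using envelope_le[of u] True by (cases "u \<le> 1") (auto intro: add_increasing add_increasing2)
  then have "C * poly_envelope a b u \<le> C * (u powr min a 0 + u powr max b 0)"
    using C by (rule mult_left_mono)
  with \<phi>_bound[OF True] show ?thesis by linarith
qed (use C \<phi>_nonpos in auto)

text \<open>A power u^a has mean proportional to l^(- a) under the Gamma law with rate l. For
  negative \<open>a\<close> the exponent - a lies between 0 and k, so p^(- a) is at most 1 + p^k,
  and p is at most \<open>max_avg\<close>.\<close>

lemma density_moment_low: "(\<integral>\<^sup>+x. ennreal (p x powr (- min a 0)) \<partial>D) < \<infinity>"
proof (cases "a < 0")
  case True
  have "(\<integral>\<^sup>+x. ennreal (p x powr (- min a 0)) \<partial>D) \<le> (\<integral>\<^sup>+x. 1 + max_avg p r\<^sub>1 x ^ k \<partial>D)"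
  proof (intro nn_integral_mono_AE, use AE_density_between_avgs[OF r(1)] AE_p_pos in eventually_elim)
    case (elim x)
    have "p x powr (- a) \<le> 1 + p x ^ k"
    proof (cases "p x \<le> 1")
      case True
      then have "p x powr (- a) \<le> 1 powr (- a)"
        using elim \<open>a < 0\<close> by (intro powr_mono2) auto
      then show ?thesis using elim by (simp add: add_increasing2)
    next
      case False
      then have "p x powr (- a) \<le> p x powr real k"
        using k_gt \<open>a < 0\<close> by (intro powr_mono) auto
      then show ?thesis using elim by (simp add: powr_realpow)
    qed
    then have "ennreal (p x powr (- a)) \<le> ennreal (1 + p x ^ k)" by (rule ennreal_leI)
    also have "\<dots> = 1 + ennreal (p x) ^ k"
      using elim by (simp add: ennreal_power)
    also have "\<dots> \<le> 1 + max_avg p r\<^sub>1 x ^ k"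
      using elim by (intro add_left_mono power_mono) auto
    finally show ?case using True by (simp add: min_absorb1)
  qed
  also have "\<dots> = 1 + (\<integral>\<^sup>+x. max_avg p r\<^sub>1 x ^ k \<partial>D)"
    by (subst nn_integral_add) auto
  also have "\<dots> < \<infinity>" using max_moment[OF True] by simp
  finally show ?thesis .
next
  case False
  have "(\<integral>\<^sup>+x. ennreal (p x powr (- min a 0)) \<partial>D) \<le> (\<integral>\<^sup>+x. 1 \<partial>D)"
    using False by (intro nn_integral_mono) (simp add: min_absorb2)
  also have "\<dots> < \<infinity>" by simp
  finally show ?thesis .
qed

text \<open>The density is at least \<open>min_avg\<close>, so p^(- b) is at most the power - b of
  the minimal average, and y <= 1 + y^2 leads to the exponent - 2 b at hand.\<close>

lemma density_moment_high: "(\<integral>\<^sup>+x. ennreal (p x powr (- max b 0)) \<partial>D) < \<infinity>"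
proof (cases "0 < b")
  case True
  have "(\<integral>\<^sup>+x. ennreal (p x powr (- max b 0)) \<partial>D) \<le> (\<integral>\<^sup>+x. 1 + ennreal (enn2real (min_avg p r\<^sub>2 x) powr (- (2 * b))) \<partial>D)"
  proof (intro nn_integral_mono_AE, use AE_density_between_avgs[OF r(2)] min_pos[OF True] AE_p_pos in eventually_elim)
    case (elim x)
    let ?m = "enn2real (min_avg p r\<^sub>2 x)"
    have "?m \<le> p x" using elim by (intro enn2real_leI) auto
    then have "p x powr (- b) \<le> ?m powr (- b)"
      using elim True by (intro powr_mono2') auto
    also have "\<dots> \<le> 1 + (?m powr (- b))\<^sup>2"
    proof -
      have "2 * ?m powr (- b) \<le> 1 + (?m powr (- b))\<^sup>2"
        using sum_squares_bound[of 1 "?m powr (- b)"] by simp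
      moreover have "0 \<le> ?m powr (- b)" by simp
      ultimately show ?thesis by linarith
    qed
    also have "(?m powr (- b))\<^sup>2 = ?m powr (- (2 * b))"
      by (simp add: power2_eq_square powr_add[symmetric])
    finally have "ennreal (p x powr (- b)) \<le> ennreal (1 + ?m powr (- (2 * b)))" by (rule ennreal_leI)
    then show ?case using True by (simp add: max_absorb1)
  qed
  also have "\<dots> = 1 + (\<integral>\<^sup>+x. ennreal (enn2real (min_avg p r\<^sub>2 x) powr (- (2 * b))) \<partial>D)"
    by (subst nn_integral_add) auto
  also have "\<dots> < \<infinity>" using min_moment[OF True] by simp
  finally show ?thesis .
next
  case False
  have "(\<integral>\<^sup>+x. ennreal (p x powr (- max b 0)) \<partial>D) \<le> (\<integral>\<^sup>+x. 1 \<partial>D)"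
    using False by (intro nn_integral_mono) (simp add: max_absorb2)
  also have "\<dots> < \<infinity>" by simp
  finally show ?thesis .
qed

text \<open>The envelope reduces the claim to two Gamma moments per point x, and these to the two
  moments of the density just bounded.\<close>

lemma integrable_\<phi>_er: "integrable joint (\<lambda>z. \<phi> (snd z) * er z)"
proof (rule integrableI_bounded)
  let ?a = "min a 0" and ?b = "max b 0"
  let ?A = "ennreal (Gamma (real k + ?a) / fact (k - 1))" and ?B = "ennreal (Gamma (real k + ?b) / fact (k - 1))"
  have ka: "0 < real k + ?a" "0 < real k + ?b" using k_gt k_pos by (auto simp: min_def max_def)
  have "(\<integral>\<^sup>+z. ennreal (norm (\<phi> (snd z) * er z)) \<partial>joint) = (\<integral>\<^sup>+x. \<integral>\<^sup>+u. ennreal (norm (\<phi> u * er (x, u))) \<partial>lborel \<partial>D)"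
  proof -
    have "(\<lambda>z. \<phi> (snd z)) \<in> borel_measurable (borel \<Otimes>\<^sub>M borel)"
      by measurable
    from nn_integral_joint[OF measurable_joint[OF measurable_compose[OF measurable_compose[OF borel_measurable_times[OF this er_measurable] borel_measurable_norm] measurable_ennreal]]]
    show ?thesis by simp
  qed
  also have "\<dots> \<le> (\<integral>\<^sup>+x. ennreal C * (?A * ennreal (p x powr (- ?a)) + ?B * ennreal (p x powr (- ?b))) \<partial>D)"
  proof (intro nn_integral_mono_AE, use AE_p_pos in eventually_elim)
    fix x assume px: "0 < p x"
    let ?e = "\<lambda>u. ennreal (er (x, u))"
    have "(\<integral>\<^sup>+u. ennreal (norm (\<phi> u * er (x, u))) \<partial>lborel)
        \<le> (\<integral>\<^sup>+u. ennreal C * (ennreal (u powr ?a) * ?e u + ennreal (u powr ?b) * ?e u) \<partial>lborel)"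
    proof (intro nn_integral_mono)
      fix u
      have "norm (\<phi> u * er (x, u)) \<le> C * (u powr ?a + u powr ?b) * er (x, u)"
        using \<phi>_le[of u] er_nonneg[of "(x, u)"] by (simp add: abs_mult mult_right_mono)
      then have "ennreal (norm (\<phi> u * er (x, u))) \<le> ennreal (C * (u powr ?a + u powr ?b) * er (x, u))"
        by (rule ennreal_leI)
      also have "\<dots> = ennreal C * (ennreal (u powr ?a) * ?e u + ennreal (u powr ?b) * ?e u)"
        using C er_nonneg[of "(x, u)"] by (simp add: ennreal_mult distrib_right mult.assoc)
      finally show "ennreal (norm (\<phi> u * er (x, u))) \<le> ennreal C * (ennreal (u powr ?a) * ?e u + ennreal (u powr ?b) * ?e u)" .
    qed
    also have "\<dots> = ennreal C * ((\<integral>\<^sup>+u. ennreal (u powr ?a) * ?e u \<partial>lborel) + (\<integral>\<^sup>+u. ennreal (u powr ?b) * ?e u \<partial>lborel))"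
      by (simp add: nn_integral_cmult nn_integral_add)
    also have "\<dots> = ennreal C * (?A * ennreal (p x powr (- ?a)) + ?B * ennreal (p x powr (- ?b)))"
      using px k_pos ka by (simp add: er_def nn_integral_erlang_powr)
    finally show "(\<integral>\<^sup>+u. ennreal (norm (\<phi> u * er (x, u))) \<partial>lborel)
        \<le> ennreal C * (?A * ennreal (p x powr (- ?a)) + ?B * ennreal (p x powr (- ?b)))" .
  qed
  also have "\<dots> = ennreal C * (?A * (\<integral>\<^sup>+x. ennreal (p x powr (- ?a)) \<partial>D) + ?B * (\<integral>\<^sup>+x. ennreal (p x powr (- ?b)) \<partial>D))"
    by (simp add: nn_integral_cmult nn_integral_add)
  also have "\<dots> < \<infinity>"
    using density_moment_low density_moment_high by (simp add: ennreal_mult_less_top)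
  finally show "(\<integral>\<^sup>+z. ennreal (norm (\<phi> (snd z) * er z)) \<partial>joint) < \<infinity>" .
qed measurable

definition T :: real where
  "T = (\<integral>z. \<phi> (snd z) * er z \<partial>joint)"

text \<open>The part of the mean of |\<phi>| under the mixture that the window loses.\<close>

definition W :: "nat \<Rightarrow> ennreal" where
  "W n = (\<integral>\<^sup>+z. ennreal (\<bar>\<phi> (snd z)\<bar> * er z) * of_bool (\<not> (1 / (real n + 1) < snd z \<and> snd z \<le> real n + 1)) \<partial>joint)"

lemma W_vanishes: "W \<longlonglongrightarrow> 0"
proof -
  have "W \<longlonglongrightarrow> (\<integral>\<^sup>+z. 0 \<partial>joint)"
    unfolding W_def[abs_def]
  proof (intro nn_integral_dominated_convergence[where w="\<lambda>z. ennreal (\<bar>\<phi> (snd z)\<bar> * er z)"] AE_I2)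
    show "(\<integral>\<^sup>+z. ennreal (\<bar>\<phi> (snd z)\<bar> * er z) \<partial>joint) < \<infinity>"
      using integrable_\<phi>_er er_nonneg by (simp add: integrable_iff_bounded abs_mult)
    fix z :: "'a \<times> real" and n
    show "ennreal (\<bar>\<phi> (snd z)\<bar> * er z) * of_bool (\<not> (1 / (real n + 1) < snd z \<and> snd z \<le> real n + 1)) \<le> ennreal (\<bar>\<phi> (snd z)\<bar> * er z)"
      by auto
    show "(\<lambda>n. ennreal (\<bar>\<phi> (snd z)\<bar> * er z) * of_bool (\<not> (1 / (real n + 1) < snd z \<and> snd z \<le> real n + 1))) \<longlonglongrightarrow> 0"
    proof (cases "0 < snd z")
      case True
      have "(\<lambda>n. 1 / (real n + 1)) \<longlonglongrightarrow> 0" by real_asymp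
      then have "\<forall>\<^sub>F n in sequentially. 1 / (real n + 1) < snd z"
        using True by (rule order_tendstoD(2))
      moreover obtain N :: nat where N: "snd z \<le> real N" using real_arch_simple by blast
      have "\<forall>\<^sub>F n in sequentially. snd z \<le> real n + 1"
        using eventually_ge_at_top[of N] by eventually_elim (use N in auto)
      ultimately have "\<forall>\<^sub>F n in sequentially. ennreal (\<bar>\<phi> (snd z)\<bar> * er z) * of_bool (\<not> (1 / (real n + 1) < snd z \<and> snd z \<le> real n + 1)) = 0"
        by eventually_elim simp
      then show ?thesis by (rule tendsto_eventually)
    next
      case False
      then show ?thesis by (simp add: \<phi>_nonpos)
    qed
  qed measurable
  then show ?thesis by simp
qed

end

section \<open>Step functions and the combination of all errors\<close>

context knn_estimator
begin

text \<open>Inside the window the error is at most \<open>d\<close> times the total mass 1; outside,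
  the step function is 0 and all of |\<phi>| is lost, which is \<open>W n\<close>.\<close>

lemma T_step_bound:
  fixes N :: nat
  assumes d: "0 \<le> d" and t: "\<And>j. j \<le> N \<Longrightarrow> 0 \<le> t j"
    and mid: "\<And>u. 1 / (real n + 1) < u \<Longrightarrow> u \<le> real n + 1 \<Longrightarrow> \<bar>\<phi> u - (\<Sum>j\<le>N. c j * of_bool (t j < u))\<bar> \<le> d"
    and out: "\<And>u. u \<le> 1 / (real n + 1) \<or> real n + 1 < u \<Longrightarrow> (\<Sum>j\<le>N. c j * of_bool (t j < u)) = 0"
  shows "ennreal \<bar>T - (\<Sum>j\<le>N. c j * limit_tail (t j))\<bar> \<le> ennreal d + W n"
proof -
  let ?S = "\<lambda>u. \<Sum>j\<le>(N::nat). c j * of_bool (t j < u)"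
  have int: "integrable joint (\<lambda>z. \<Sum>j\<le>N. c j * (of_bool (t j < snd z) * er z))"
    by (intro Bochner_Integration.integrable_sum integrable_mult_right joint_tail_integral t) simp
  have "(\<integral>z. (\<Sum>j\<le>N. c j * (of_bool (t j < snd z) * er z)) \<partial>joint) = (\<Sum>j\<le>N. c j * limit_tail (t j))"
    by (subst Bochner_Integration.integral_sum)
       (auto intro!: integrable_mult_right joint_tail_integral t sum.cong simp: joint_tail_integral(2)[OF t])
  then have "T - (\<Sum>j\<le>N. c j * limit_tail (t j))
      = (\<integral>z. \<phi> (snd z) * er z - (\<Sum>j\<le>N. c j * (of_bool (t j < snd z) * er z)) \<partial>joint)"
    unfolding T_def using integrable_\<phi>_er int by (subst Bochner_Integration.integral_diff) auto
  also have "ennreal \<bar>\<dots>\<bar> \<le> (\<integral>\<^sup>+z. ennreal \<bar>\<phi> (snd z) * er z - (\<Sum>j\<le>N. c j * (of_bool (t j < snd z) * er z))\<bar> \<partial>joint)"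
    using integral_norm_bound_ennreal[OF Bochner_Integration.integrable_diff[OF integrable_\<phi>_er int]] by simp
  also have "\<dots> \<le> (\<integral>\<^sup>+z. ennreal d * ennreal (er z) + ennreal (\<bar>\<phi> (snd z)\<bar> * er z) * of_bool (\<not> (1 / (real n + 1) < snd z \<and> snd z \<le> real n + 1)) \<partial>joint)"
  proof (intro nn_integral_mono)
    fix z :: "'a \<times> real"
    have eq: "\<phi> (snd z) * er z - (\<Sum>j\<le>N. c j * (of_bool (t j < snd z) * er z)) = (\<phi> (snd z) - ?S (snd z)) * er z"
      by (simp add: left_diff_distrib sum_distrib_right mult.assoc del: sum_mult_of_bool_eq)
    show "ennreal \<bar>\<phi> (snd z) * er z - (\<Sum>j\<le>N. c j * (of_bool (t j < snd z) * er z))\<bar>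
      \<le> ennreal d * ennreal (er z) + ennreal (\<bar>\<phi> (snd z)\<bar> * er z) * of_bool (\<not> (1 / (real n + 1) < snd z \<and> snd z \<le> real n + 1))"
    proof (cases "1 / (real n + 1) < snd z \<and> snd z \<le> real n + 1")
      case True
      then have "\<bar>(\<phi> (snd z) - ?S (snd z)) * er z\<bar> \<le> d * er z"
        using mid[of "snd z"] er_nonneg[of z] by (simp add: abs_mult mult_right_mono del: sum_mult_of_bool_eq)
      then have "ennreal \<bar>(\<phi> (snd z) - ?S (snd z)) * er z\<bar> \<le> ennreal d * ennreal (er z)"
        using d er_nonneg[of z] by (simp only: ennreal_mult[symmetric] ennreal_leI)
      then show ?thesis unfolding eq by (rule order_trans) simp
    next
      case False
      then have "?S (snd z) = 0" by (intro out) auto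
      then have "\<bar>(\<phi> (snd z) - ?S (snd z)) * er z\<bar> = \<bar>\<phi> (snd z)\<bar> * er z"
        using er_nonneg[of z] by (simp only: abs_mult diff_zero abs_of_nonneg)
      moreover have "of_bool (\<not> (1 / (real n + 1) < snd z \<and> snd z \<le> real n + 1)) = (1 :: ennreal)"
        using False by simp
      ultimately show ?thesis unfolding eq by (simp only: mult_1_right) simp
    qed
  qed
  also have "\<dots> = (\<integral>\<^sup>+z. ennreal d * ennreal (er z) \<partial>joint) + W n"
  proof -
    have 1: "(\<lambda>z. \<phi> (snd z)) \<in> borel_measurable (borel \<Otimes>\<^sub>M borel)" "(\<lambda>z. of_bool (\<not> (1 / (real n + 1) < snd z \<and> snd z \<le> real n + 1)) :: ennreal) \<in> borel_measurable (borel \<Otimes>\<^sub>M borel)"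
      by measurable
    show ?thesis
      unfolding W_def
      by (rule nn_integral_add; rule measurable_joint;
          intro borel_measurable_times_ennreal borel_measurable_const 1
            measurable_compose[OF er_measurable measurable_ennreal]
            measurable_compose[OF borel_measurable_times[OF borel_measurable_abs[OF 1(1)] er_measurable] measurable_ennreal])
  qed
  also have "(\<integral>\<^sup>+z. ennreal d * ennreal (er z) \<partial>joint) = ennreal d"
    using joint_total by (subst nn_integral_cmult, intro measurable_joint measurable_compose[OF er_measurable measurable_ennreal]) simp
  finally show ?thesis .
qed

lemma low_measurable: "k < m \<Longrightarrow> i \<in> {1..m} \<Longrightarrow> (\<lambda>w. low n m w i) \<in> borel_measurable (sample {1..m})"
proof -
  assume m: "k < m" "i \<in> {1..m}"
  note [measurable] = measurable_U[OF m]
  show ?thesis unfolding low_def by measurable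
qed

lemma high_measurable: "k < m \<Longrightarrow> i \<in> {1..m} \<Longrightarrow> (\<lambda>w. high n m w i) \<in> borel_measurable (sample {1..m})"
proof -
  assume m: "k < m" "i \<in> {1..m}"
  note [measurable] = measurable_U[OF m] measurable_knn_radius[OF m]
  show ?thesis unfolding high_def by measurable
qed

lemma far_measurable: "k < m \<Longrightarrow> i \<in> {1..m} \<Longrightarrow> (\<lambda>w. far m w i) \<in> borel_measurable (sample {1..m})"
proof -
  assume m: "k < m" "i \<in> {1..m}"
  note [measurable] = measurable_U[OF m] measurable_knn_radius[OF m]
  show ?thesis unfolding far_def far_part_def by measurable
qed

text \<open>A step function is a combination of N + 1 tail indicators; the inequality of Cauchy and
  Schwarz over these terms reduces the claim to \<open>tail_fraction_L2\<close>.\<close>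

lemma step_mean_L2:
  assumes t: "\<And>j. j \<le> N \<Longrightarrow> 0 < t j"
  shows "(\<lambda>m. \<integral>\<^sup>+w. ennreal (((\<Sum>i\<in>{1..m}. \<Sum>j\<le>(N::nat). c j * of_bool (t j < U m w i)) / real m
      - (\<Sum>j\<le>N. c j * limit_tail (t j)))\<^sup>2) \<partial>sample {1..m}) \<longlonglongrightarrow> 0"
proof -
  let ?A = "\<lambda>m j w. (\<Sum>i\<in>{1..m}. of_bool (t j < U m w i)) / real m - limit_tail (t j)"
  let ?H = "\<lambda>m. \<Sum>j\<le>N. ennreal (real (N + 1) * (c j)\<^sup>2) * (\<integral>\<^sup>+w. ennreal ((?A m j w)\<^sup>2) \<partial>sample {1..m})"
  have "?H \<longlonglongrightarrow> (\<Sum>j\<le>N. ennreal (real (N + 1) * (c j)\<^sup>2) * 0)"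
    by (intro tendsto_sum ennreal_tendsto_cmult tail_fraction_L2 t) auto
  then have lim: "?H \<longlonglongrightarrow> 0" by simp
  have bound: "(\<integral>\<^sup>+w. ennreal (((\<Sum>i\<in>{1..m}. \<Sum>j\<le>N. c j * of_bool (t j < U m w i)) / real m
      - (\<Sum>j\<le>N. c j * limit_tail (t j)))\<^sup>2) \<partial>sample {1..m}) \<le> ?H m" if m: "k < m" for m
  proof -
    have meas: "(\<lambda>w. ennreal ((?A m j w)\<^sup>2)) \<in> borel_measurable (sample {1..m})" for j
    proof -
      have ob: "(\<lambda>w. of_bool (t j < U m w i) :: real) \<in> borel_measurable (sample {1..m})" if "i \<in> {1..m}" for i
      proof -
        note [measurable] = measurable_U[OF m that]
        show ?thesis by measurable
      qed
      show ?thesis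
        by (intro measurable_compose[OF _ measurable_ennreal] borel_measurable_power borel_measurable_diff
            borel_measurable_divide borel_measurable_sum borel_measurable_const ob)
    qed
    have "(\<integral>\<^sup>+w. ennreal (((\<Sum>i\<in>{1..m}. \<Sum>j\<le>N. c j * of_bool (t j < U m w i)) / real m
      - (\<Sum>j\<le>N. c j * limit_tail (t j)))\<^sup>2) \<partial>sample {1..m})
      \<le> (\<integral>\<^sup>+w. (\<Sum>j\<le>N. ennreal (real (N + 1) * (c j)\<^sup>2) * ennreal ((?A m j w)\<^sup>2)) \<partial>sample {1..m})"
    proof (intro nn_integral_mono)
      fix w
      have "(\<Sum>i\<in>{1..m}. \<Sum>j\<le>N. c j * of_bool (t j < U m w i)) / real m
          = (\<Sum>j\<le>N. c j * ((\<Sum>i\<in>{1..m}. of_bool (t j < U m w i)) / real m))"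
        by (subst sum.swap) (simp add: sum_divide_distrib sum_distrib_left del: sum_mult_of_bool_eq sum_of_bool_eq)
      then have "(\<Sum>i\<in>{1..m}. \<Sum>j\<le>N. c j * of_bool (t j < U m w i)) / real m - (\<Sum>j\<le>N. c j * limit_tail (t j))
          = (\<Sum>j\<le>N. c j * ?A m j w)"
        by (simp only: sum_subtractf right_diff_distrib)
      then have "((\<Sum>i\<in>{1..m}. \<Sum>j\<le>N. c j * of_bool (t j < U m w i)) / real m - (\<Sum>j\<le>N. c j * limit_tail (t j)))\<^sup>2
          = (\<Sum>j\<le>N. c j * ?A m j w)\<^sup>2" by (simp only:)
      also have "\<dots> \<le> (\<Sum>j\<le>N. (c j * ?A m j w)\<^sup>2) * card {..N}"
        by (rule sum_squared_le_sum_of_squares)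
      also have "\<dots> = (\<Sum>j\<le>N. (real (N + 1) * (c j)\<^sup>2) * (?A m j w)\<^sup>2)"
        unfolding sum_distrib_right by (intro sum.cong refl) (simp add: power_mult_distrib del: sum_of_bool_eq)
      finally have "ennreal (((\<Sum>i\<in>{1..m}. \<Sum>j\<le>N. c j * of_bool (t j < U m w i)) / real m - (\<Sum>j\<le>N. c j * limit_tail (t j)))\<^sup>2)
        \<le> ennreal (\<Sum>j\<le>N. (real (N + 1) * (c j)\<^sup>2) * (?A m j w)\<^sup>2)" by (rule ennreal_leI)
      also have "\<dots> = (\<Sum>j\<le>N. ennreal ((real (N + 1) * (c j)\<^sup>2) * (?A m j w)\<^sup>2))"
        by (rule sum_ennreal[symmetric]) simp
      also have "\<dots> = (\<Sum>j\<le>N. ennreal (real (N + 1) * (c j)\<^sup>2) * ennreal ((?A m j w)\<^sup>2))"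
        by (intro sum.cong refl ennreal_mult) auto
      finally show "ennreal (((\<Sum>i\<in>{1..m}. \<Sum>j\<le>N. c j * of_bool (t j < U m w i)) / real m - (\<Sum>j\<le>N. c j * limit_tail (t j)))\<^sup>2)
        \<le> (\<Sum>j\<le>N. ennreal (real (N + 1) * (c j)\<^sup>2) * ennreal ((?A m j w)\<^sup>2))" .
    qed
    also have "\<dots> = (\<Sum>j\<le>N. \<integral>\<^sup>+w. ennreal (real (N + 1) * (c j)\<^sup>2) * ennreal ((?A m j w)\<^sup>2) \<partial>sample {1..m})"
      by (rule nn_integral_sum) (intro borel_measurable_times_ennreal borel_measurable_const meas)
    also have "\<dots> = ?H m"
      by (intro sum.cong refl nn_integral_cmult meas)
    finally show ?thesis .
  qed
  show ?thesis
    by (rule tendsto_sandwich[OF _ eventually_mono[OF eventually_gt_at_top[of k] bound] tendsto_const lim]) auto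
qed

theorem knn_estimator_L2_consistent:
  "(\<lambda>m. \<integral>\<^sup>+w. ennreal (((\<Sum>i\<in>{1..m}. \<phi> (U m w i)) / real m - T)\<^sup>2) \<partial>sample {1..m}) \<longlonglongrightarrow> 0"
proof (rule tendsto_0_ennrealI)
  fix e :: real assume e: "0 < e"
  \<comment> \<open>Five terms get e / 5 each. The constants solve 16 (3 d)^2 = e / 5 and 16 C^2
    \<eta> <= e / 5; the added 1 in the denominator of \<eta> allows C = 0.\<close>
  define d where "d = sqrt (e / 720)"
  define \<eta> where "\<eta> = e / (80 * (C\<^sup>2 + 1))"
  have d: "0 < d" "d\<^sup>2 = e / 720" using e by (auto simp: d_def)
  have C1: "0 < C\<^sup>2 + 1" by (simp add: add_nonneg_pos)
  have \<eta>: "0 < \<eta>" using e C1 by (simp add: \<eta>_def)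
  have C\<eta>: "16 * C\<^sup>2 * \<eta> \<le> e / 5"
  proof -
    have "16 * C\<^sup>2 * \<eta> = e / 5 * (C\<^sup>2 / (C\<^sup>2 + 1))" using C1 by (simp add: \<eta>_def field_simps)
    also have "\<dots> \<le> e / 5 * 1" using e C1 by (intro mult_left_mono) (auto simp: divide_le_eq)
    finally show ?thesis by simp
  qed
  \<comment> \<open>The order of choices matters: the window n first, so that what lies outside it
    is small for all large m; then a step function for this window; only then m.\<close>
  have "\<forall>\<^sub>F n in sequentially. W n < ennreal d"
    using W_vanishes d by (intro order_tendstoD(2)) auto
  from eventually_happens'[OF sequentially_bot eventually_conj[OF this eventually_conj[OF low_small[OF \<eta>] high_small[OF \<eta>]]]]
  obtain n where n: "W n < ennreal d"
    "\<forall>\<^sub>F m in sequentially. \<forall>i\<in>{1..m}. (\<integral>\<^sup>+w. ennreal ((low n m w i)\<^sup>2) \<partial>sample {1..m}) \<le> ennreal \<eta>"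
    "\<forall>\<^sub>F m in sequentially. \<forall>i\<in>{1..m}. (\<integral>\<^sup>+w. ennreal ((high n m w i)\<^sup>2) \<partial>sample {1..m}) \<le> ennreal \<eta>"
    by blast
  let ?\<alpha> = "1 / (real n + 1)"
  have \<alpha>: "0 < ?\<alpha>" by simp
  obtain N :: nat and c t where step:
    "\<And>j. j \<le> N \<Longrightarrow> ?\<alpha> \<le> t j"
    "\<And>u. ?\<alpha> < u \<Longrightarrow> u \<le> real n + 1 \<Longrightarrow> \<bar>\<phi> u - (\<Sum>j\<le>N. c j * of_bool (t j < u))\<bar> \<le> d"
    "\<And>u. u \<le> ?\<alpha> \<or> real n + 1 < u \<Longrightarrow> (\<Sum>j\<le>N. c j * of_bool (t j < u)) = 0"
  proof (cases "?\<alpha> < real n + 1")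
    case True
    have "continuous_on {?\<alpha>..real n + 1} \<phi>"
      using \<phi>_cont by (rule continuous_on_subset) (intro subsetI, use \<alpha> in \<open>simp del: zero_less_divide_1_iff, linarith\<close>)
    from continuous_on_step_approximation[OF this True d(1)] that show thesis by blast
  next
    \<comment> \<open>Only n = 0 is left, where the window from 1 to 1 is empty and the zero step
      function will do.\<close>
    case False
    show thesis
      by (rule that[of 0 "\<lambda>_. ?\<alpha>" "\<lambda>_. 0"]) (use False in auto)
  qed
  have t0: "0 < t j" if "j \<le> N" for j using step(1)[OF that] \<alpha> by linarith
  let ?S = "\<lambda>u. \<Sum>j\<le>N. c j * of_bool (t j < u)" and ?T = "\<Sum>j\<le>N. c j * limit_tail (t j)"
  have "ennreal \<bar>T - ?T\<bar> \<le> ennreal d + W n"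
    using d t0 by (intro T_step_bound step(2,3)) (auto simp: less_imp_le)
  also have "\<dots> \<le> ennreal d + ennreal d" using n(1) by (intro add_left_mono) simp
  also have "\<dots> = ennreal (2 * d)" using d by (simp add: ennreal_plus[symmetric] del: ennreal_plus)
  finally have TT: "\<bar>?T - T\<bar> \<le> 2 * d" using d by (simp add: abs_minus_commute)
  let ?X = "\<lambda>m w. (\<Sum>i\<in>{1..m}. ?S (U m w i)) / real m - ?T"
  let ?L = "\<lambda>m w. (\<Sum>i\<in>{1..m}. low n m w i) / real m" and ?H = "\<lambda>m w. (\<Sum>i\<in>{1..m}. high n m w i) / real m"
    and ?F = "\<lambda>m w. (\<Sum>i\<in>{1..m}. far m w i) / real m"
  have X: "\<forall>\<^sub>F m in sequentially. ennreal 16 * (\<integral>\<^sup>+w. ennreal ((?X m w)\<^sup>2) \<partial>sample {1..m}) < ennreal (e / 5)"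
  proof (rule order_tendstoD(2))
    show "(\<lambda>m. ennreal 16 * (\<integral>\<^sup>+w. ennreal ((?X m w)\<^sup>2) \<partial>sample {1..m})) \<longlonglongrightarrow> ennreal 16 * 0"
      by (intro ennreal_tendsto_cmult step_mean_L2 t0) auto
  qed (use e in auto)
  have Fr: "\<forall>\<^sub>F m in sequentially. ennreal (16 * C\<^sup>2) * (\<integral>\<^sup>+w. ennreal ((?F m w)\<^sup>2) \<partial>sample {1..m}) < ennreal (e / 5)"
  proof (rule order_tendstoD(2))
    show "(\<lambda>m. ennreal (16 * C\<^sup>2) * (\<integral>\<^sup>+w. ennreal ((?F m w)\<^sup>2) \<partial>sample {1..m})) \<longlonglongrightarrow> ennreal (16 * C\<^sup>2) * 0"
      by (intro ennreal_tendsto_cmult far_vanishes) auto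
  qed (use e in auto)
  show "\<forall>\<^sub>F m in sequentially. (\<integral>\<^sup>+w. ennreal (((\<Sum>i\<in>{1..m}. \<phi> (U m w i)) / real m - T)\<^sup>2) \<partial>sample {1..m}) \<le> ennreal e"
    using X Fr n(2,3) eventually_gt_at_top[of k]
  proof eventually_elim
    case (elim m)
    let ?P = "sample {1..m}"
    interpret P: prob_space ?P by (rule prob_space_sample)
    have km: "k < m" using elim by simp
    have m0: "0 < m" using km by simp
    have point: "((\<Sum>i\<in>{1..m}. \<phi> (U m w i)) / real m - T)\<^sup>2
      \<le> 16 * (?X m w)\<^sup>2 + e / 5 + 16 * C\<^sup>2 * (?L m w)\<^sup>2 + 16 * C\<^sup>2 * (?H m w)\<^sup>2 + 16 * C\<^sup>2 * (?F m w)\<^sup>2"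
      if inj: "inj_on w {1..m}" for w
    proof -
      let ?Y = "\<lambda>i. low n m w i + high n m w i + far m w i"
      have Y0: "0 \<le> ?Y i" for i by (simp add: low_def high_def far_def far_part_def)
      have each: "\<bar>\<phi> (U m w i) - ?S (U m w i)\<bar> \<le> d + C * ?Y i" if i: "i \<in> {1..m}" for i
      proof (cases "?\<alpha> < U m w i \<and> U m w i \<le> real n + 1")
        case True
        then have "\<bar>\<phi> (U m w i) - ?S (U m w i)\<bar> \<le> d" by (intro step(2)) auto
        moreover have "0 \<le> C * ?Y i" using C Y0 by (rule mult_nonneg_nonneg)
        ultimately show ?thesis by linarith
      next
        case False
        then have z: "?S (U m w i) = 0" by (intro step(3)) auto
        have "\<bar>\<phi> (U m w i)\<bar> \<le> C * ?Y i"
          using False by (intro \<phi>_tail_bound km i U_pos inj) auto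
        then show ?thesis unfolding z using d by linarith
      qed
      have "\<bar>(\<Sum>i\<in>{1..m}. \<phi> (U m w i)) / real m - (\<Sum>i\<in>{1..m}. ?S (U m w i)) / real m\<bar>
          = \<bar>\<Sum>i\<in>{1..m}. \<phi> (U m w i) - ?S (U m w i)\<bar> / real m"
        by (simp only: diff_divide_distrib[symmetric] sum_subtractf[symmetric] abs_divide abs_of_nat)
      also have "\<dots> \<le> (\<Sum>i\<in>{1..m}. d + C * ?Y i) / real m"
        using each by (intro divide_right_mono order_trans[OF sum_abs sum_mono]) auto
      also have "(\<Sum>i\<in>{1..m}. d + C * ?Y i) / real m = d + C * ?L m w + C * ?H m w + C * ?F m w"
        using m0 by (simp add: sum.distrib sum_distrib_left[symmetric] add_divide_distrib distrib_left)
      \<comment> \<open>Of the three \<open>d\<close>, one is the approximation inside the window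
        and two come from \<open>TT\<close>.\<close>
      finally have "\<bar>(\<Sum>i\<in>{1..m}. \<phi> (U m w i)) / real m - T\<bar>
          \<le> \<bar>?X m w\<bar> + 3 * d + C * ?L m w + C * ?H m w + C * ?F m w"
        using TT by linarith
      then have "((\<Sum>i\<in>{1..m}. \<phi> (U m w i)) / real m - T)\<^sup>2
          \<le> (\<bar>?X m w\<bar> + 3 * d + C * ?L m w + C * ?H m w + C * ?F m w)\<^sup>2"
        by (rule abs_le_square_iff[THEN iffD1, OF order_trans[OF _ abs_ge_self]])
      also have "\<dots> \<le> 16 * (?X m w)\<^sup>2 + 16 * (3 * d)\<^sup>2 + 16 * (C * ?L m w)\<^sup>2 + 16 * (C * ?H m w)\<^sup>2 + 16 * (C * ?F m w)\<^sup>2"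
      proof -
        \<comment> \<open>Four nested uses of \<open>add_square_le\<close> give the innermost terms
          the weight 16, and the others are raised to it.\<close>
        have five: "(x + y + z + u + v)\<^sup>2 \<le> 16 * x\<^sup>2 + 16 * y\<^sup>2 + 16 * z\<^sup>2 + 16 * u\<^sup>2 + 16 * v\<^sup>2" for x y z u v :: real
          using add_square_le[of "x + y + z + u" v] add_square_le[of "x + y + z" u] add_square_le[of "x + y" z] add_square_le[of x y]
            zero_le_power2[of x] zero_le_power2[of y] zero_le_power2[of z] zero_le_power2[of u] zero_le_power2[of v]
          by linarith
        show ?thesis using five[of "\<bar>?X m w\<bar>" "3 * d" "C * ?L m w" "C * ?H m w" "C * ?F m w"] by (simp only: power2_abs)
      qed
      also have "16 * (3 * d)\<^sup>2 = e / 5" using d by (simp add: power_mult_distrib)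
      finally show ?thesis by (simp only: power_mult_distrib mult.assoc)
    qed
    have low_m: "(\<lambda>w. ?L m w) \<in> borel_measurable ?P" and high_m: "(\<lambda>w. ?H m w) \<in> borel_measurable ?P"
      and far_m: "(\<lambda>w. ?F m w) \<in> borel_measurable ?P"
      using km by (auto intro!: borel_measurable_divide borel_measurable_sum low_measurable high_measurable far_measurable)
    have X_m: "(\<lambda>w. ?X m w) \<in> borel_measurable ?P"
    proof -
      have "(\<lambda>w. of_bool (s < U m w i) :: real) \<in> borel_measurable ?P" if "i \<in> {1..m}" for i s
      proof -
        note [measurable] = measurable_U[OF km that]
        show ?thesis by measurable
      qed
      then show ?thesis
        by (intro borel_measurable_diff borel_measurable_divide borel_measurable_sum borel_measurable_const borel_measurable_times)
    qed
    have L2m: "(\<lambda>w. ennreal ((g w)\<^sup>2)) \<in> borel_measurable ?P" if "g \<in> borel_measurable ?P" for g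
      using that by measurable
    note L2ms = L2m[OF X_m] L2m[OF low_m] L2m[OF high_m] L2m[OF far_m]
    let ?I = "\<lambda>g. \<integral>\<^sup>+w. ennreal ((g w)\<^sup>2) \<partial>?P" and ?c = "ennreal (16 * C\<^sup>2)"
    have "(\<integral>\<^sup>+w. ennreal (((\<Sum>i\<in>{1..m}. \<phi> (U m w i)) / real m - T)\<^sup>2) \<partial>?P)
      \<le> (\<integral>\<^sup>+w. ennreal 16 * ennreal ((?X m w)\<^sup>2) + ennreal (e / 5) + ?c * ennreal ((?L m w)\<^sup>2) + ?c * ennreal ((?H m w)\<^sup>2) + ?c * ennreal ((?F m w)\<^sup>2) \<partial>?P)"
    proof (intro nn_integral_mono_AE, use AE_sample_inj[of m] in eventually_elim)
      fix w :: "nat \<Rightarrow> 'a" assume inj: "inj_on w {1..m}"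
      have split5: "ennreal (x + y + z + u + v) = ennreal x + ennreal y + ennreal z + ennreal u + ennreal v"
        if "0 \<le> x" "0 \<le> y" "0 \<le> z" "0 \<le> u" "0 \<le> v" for x y z u v
        using that by simp
      have sq: "ennreal (r * g\<^sup>2) = ennreal r * ennreal (g\<^sup>2)" if "0 \<le> r" for r g :: real
        using that by (rule ennreal_mult) simp
      have "ennreal (((\<Sum>i\<in>{1..m}. \<phi> (U m w i)) / real m - T)\<^sup>2)
        \<le> ennreal (16 * (?X m w)\<^sup>2 + e / 5 + 16 * C\<^sup>2 * (?L m w)\<^sup>2 + 16 * C\<^sup>2 * (?H m w)\<^sup>2 + 16 * C\<^sup>2 * (?F m w)\<^sup>2)"
        by (intro ennreal_leI point inj)
      also have "\<dots> = ennreal (16 * (?X m w)\<^sup>2) + ennreal (e / 5) + ennreal (16 * C\<^sup>2 * (?L m w)\<^sup>2) + ennreal (16 * C\<^sup>2 * (?H m w)\<^sup>2) + ennreal (16 * C\<^sup>2 * (?F m w)\<^sup>2)"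
        using e by (intro split5 mult_nonneg_nonneg zero_le_power2) auto
      also have "\<dots> = ennreal 16 * ennreal ((?X m w)\<^sup>2) + ennreal (e / 5) + ?c * ennreal ((?L m w)\<^sup>2) + ?c * ennreal ((?H m w)\<^sup>2) + ?c * ennreal ((?F m w)\<^sup>2)"
        by (intro arg_cong2[where f="(+)"] refl sq) auto
      finally show "ennreal (((\<Sum>i\<in>{1..m}. \<phi> (U m w i)) / real m - T)\<^sup>2)
        \<le> ennreal 16 * ennreal ((?X m w)\<^sup>2) + ennreal (e / 5) + ?c * ennreal ((?L m w)\<^sup>2) + ?c * ennreal ((?H m w)\<^sup>2) + ?c * ennreal ((?F m w)\<^sup>2)" .
    qed
    also have "\<dots> = ennreal 16 * ?I (?X m) + ennreal (e / 5) + ?c * ?I (?L m) + ?c * ?I (?H m) + ?c * ?I (?F m)"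
    proof -
      have "(\<integral>\<^sup>+w. ennreal 16 * x1 w + ennreal (e / 5) + ?c * x2 w + ?c * x3 w + ?c * x4 w \<partial>?P)
        = ennreal 16 * (\<integral>\<^sup>+w. x1 w \<partial>?P) + ennreal (e / 5) + ?c * (\<integral>\<^sup>+w. x2 w \<partial>?P) + ?c * (\<integral>\<^sup>+w. x3 w \<partial>?P) + ?c * (\<integral>\<^sup>+w. x4 w \<partial>?P)"
        if [measurable]: "x1 \<in> borel_measurable ?P" "x2 \<in> borel_measurable ?P" "x3 \<in> borel_measurable ?P" "x4 \<in> borel_measurable ?P" for x1 x2 x3 x4
        by (simp add: nn_integral_add nn_integral_cmult P.emeasure_space_1)
      from this[OF L2ms] show ?thesis .
    qed
    also have "\<dots> \<le> ennreal (e / 5) + ennreal (e / 5) + ennreal (e / 5) + ennreal (e / 5) + ennreal (e / 5)"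
    proof -
      have c\<eta>: "?c * ennreal \<eta> \<le> ennreal (e / 5)"
        using C\<eta> \<eta> by (subst ennreal_mult[symmetric]) (auto intro: ennreal_leI)
      have "?I (?L m) \<le> ennreal \<eta>" "?I (?H m) \<le> ennreal \<eta>"
        using elim m0 km by (auto intro!: mean_square_L2_bound low_measurable high_measurable)
      then have "?c * ?I (?L m) \<le> ennreal (e / 5)" "?c * ?I (?H m) \<le> ennreal (e / 5)"
        using c\<eta> by (auto intro: order_trans[OF mult_left_mono])
      then show ?thesis
        using elim by (intro add_mono) auto
    qed
    also have "\<dots> = ennreal e"
      using e by (simp add: ennreal_plus[symmetric] del: ennreal_plus)
    finally show ?case .
  qed
qed

end

section \<open>The estimator of the density functional\<close>

text \<open>Independence makes the law of the sample vector a product. Measurability is asked of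
  \<open>g\<close> only: the estimator \<open>h\<close>, defined through sorted sets of points, is
  compared with it almost everywhere.\<close>

lemma (in prob_space) nn_integral_iid_sample:
  fixes X :: "'i \<Rightarrow> 'a \<Rightarrow> 'b"
  assumes I: "I \<noteq> {}" and indep: "indep_vars (\<lambda>_. N) X I"
    and distr: "\<And>i. i \<in> I \<Longrightarrow> distr M N (X i) = D"
    and eq: "AE w in Pi\<^sub>M I (\<lambda>_. D). h w = g w" and g: "g \<in> borel_measurable (Pi\<^sub>M I (\<lambda>_. D))"
  shows "(\<integral>\<^sup>+\<omega>. h (\<lambda>i\<in>I. X i \<omega>) \<partial>M) = (\<integral>\<^sup>+w. g w \<partial>Pi\<^sub>M I (\<lambda>_. D))"
proof -
  have rv: "random_variable N (X i)" if "i \<in> I" for i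
    using indep that by (auto simp: indep_vars_def)
  have Y: "(\<lambda>\<omega>. \<lambda>i\<in>I. X i \<omega>) \<in> measurable M (Pi\<^sub>M I (\<lambda>_. N))"
    using rv by (intro measurable_restrict)
  have D: "distr M (Pi\<^sub>M I (\<lambda>_. N)) (\<lambda>\<omega>. \<lambda>i\<in>I. X i \<omega>) = Pi\<^sub>M I (\<lambda>_. D)"
  proof -
    have "distr M (Pi\<^sub>M I (\<lambda>_. N)) (\<lambda>\<omega>. \<lambda>i\<in>I. X i \<omega>) = Pi\<^sub>M I (\<lambda>i. distr M N (X i))"
      using indep_vars_iff_distr_eq_PiM'[where X=X and M'="\<lambda>_. N", OF I rv] indep by simp
    also have "\<dots> = Pi\<^sub>M I (\<lambda>_. D)" by (intro PiM_cong distr refl)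
    finally show ?thesis .
  qed
  have "AE \<omega> in M. h (\<lambda>i\<in>I. X i \<omega>) = g (\<lambda>i\<in>I. X i \<omega>)"
    using eq unfolding D[symmetric] by (rule AE_distrD[OF Y])
  then have "(\<integral>\<^sup>+\<omega>. h (\<lambda>i\<in>I. X i \<omega>) \<partial>M) = (\<integral>\<^sup>+\<omega>. g (\<lambda>i\<in>I. X i \<omega>) \<partial>M)"
    by (rule nn_integral_cong_AE)
  also have "\<dots> = (\<integral>\<^sup>+w. g w \<partial>distr M (Pi\<^sub>M I (\<lambda>_. N)) (\<lambda>\<omega>. \<lambda>i\<in>I. X i \<omega>))"
    using g unfolding D[symmetric] by (subst nn_integral_distr[OF Y]) auto
  finally show ?thesis unfolding D .
qed

context knn_estimator
begin

definition gamma_expectation :: "real \<Rightarrow> real" where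
  "gamma_expectation l = (\<integral>u. \<phi> u * erlang_density (k - 1) l u \<partial>lborel)"

lemma gamma_expectation_measurable [measurable]: "gamma_expectation \<in> borel_measurable borel"
proof -
  have "(\<lambda>(l, u). \<phi> u * erlang_density (k - 1) l u) \<in> borel_measurable (borel \<Otimes>\<^sub>M lborel)"
    unfolding erlang_density_def by measurable
  then show ?thesis
    unfolding gamma_expectation_def[abs_def] by (intro lborel.borel_measurable_lebesgue_integral)
qed

lemma integrable_gamma_expectation: "integrable D (\<lambda>x. gamma_expectation (p x))"
  and integral_gamma_expectation: "(\<integral>x. gamma_expectation (p x) \<partial>D) = T"
proof -
  interpret DL: pair_sigma_finite D lborel ..
  have eq: "(\<integral>u. \<phi> (snd (x, u)) * er (x, u) \<partial>lborel) = gamma_expectation (p x)" for x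
    by (simp add: gamma_expectation_def er_def)
  show "integrable D (\<lambda>x. gamma_expectation (p x))"
    using DL.integrable_fst'[OF integrable_\<phi>_er] unfolding eq .
  show "(\<integral>x. gamma_expectation (p x) \<partial>D) = T"
    using DL.integral_fst'[OF integrable_\<phi>_er] unfolding eq T_def .
qed

lemma integrable_functional: "integrable lborel (\<lambda>x. gamma_expectation (p x) * p x)"
  and functional_eq_T: "(\<integral>x. gamma_expectation (p x) * p x \<partial>lborel) = T"
proof -
  have eq: "p x *\<^sub>R gamma_expectation (p x) = gamma_expectation (p x) * p x" for x by simp
  have m: "(\<lambda>x. gamma_expectation (p x)) \<in> borel_measurable lborel" "p \<in> borel_measurable lborel" by measurable
  have nn: "AE x in lborel. 0 \<le> p x" using p_nonneg by simp
  show "integrable lborel (\<lambda>x. gamma_expectation (p x) * p x)"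
    using integrable_gamma_expectation unfolding D_def integrable_density[OF m nn] eq .
  show "(\<integral>x. gamma_expectation (p x) * p x \<partial>lborel) = T"
    using integral_gamma_expectation unfolding D_def integral_density[OF m nn] eq .
qed

end

text \<open>The factor s^k / (k - 1)! of the Erlang density cancels the right-hand side of the
  Laplace equation except for f s. The truncation of \<phi> mirrors that this equation integrates
  over the positive reals.\<close>

lemma estimator_function_eq_gamma_expectation:
  assumes phi: "estimator_function f k \<phi>" and k: "1 \<le> k" and s: "0 < s"
  shows "(\<integral>u. (if 0 < u then \<phi> u else 0) * erlang_density (k - 1) s u \<partial>lborel) = f s"
proof -
  have k': "Suc (k - 1) = k" using k by simp
  have G: "Gamma (real k) = fact (k - 1)"
    using Gamma_fact[of "k - 1", where 'a=real] k' by (simp add: add.commute of_nat_Suc[symmetric] del: of_nat_Suc)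
  have "(\<integral>u. (if 0 < u then \<phi> u else 0) * erlang_density (k - 1) s u \<partial>lborel)
    = (\<integral>u. (s ^ k / fact (k - 1)) * (indicator {0<..} u *\<^sub>R (u ^ (k - 1) * \<phi> u * exp (- s * u))) \<partial>lborel)"
    by (intro Bochner_Integration.integral_cong refl) (auto simp: erlang_density_def k' split: split_indicator)
  also have "\<dots> = (s ^ k / fact (k - 1)) * (LINT u:{0<..}|lborel. u ^ (k - 1) * \<phi> u * exp (- s * u))"
    unfolding set_lebesgue_integral_def by (rule integral_mult_right_zero)
  also have "\<dots> = (s ^ k / fact (k - 1)) * (Gamma (real k) * f s / s ^ k)"
    using phi s unfolding estimator_function_def by simp
  also have "\<dots> = f s" using s by (simp add: G)
  finally show ?thesis .
qed

section \<open>Moment conditions extracted from the properties U and L\<close>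

context knn_density
begin

lemma property_U_max_moment:
  assumes "property_U p k a"
  shows "\<exists>r>0. a < 0 \<longrightarrow> (\<integral>\<^sup>+x. max_avg p r x ^ k \<partial>D) < \<infinity>"
proof (cases "a < 0")
  case True
  then obtain r where r: "0 < r" "(\<integral>\<^sup>+x. ennreal (p x) * max_avg p r x ^ k \<partial>lborel) < \<infinity>"
    using assms unfolding property_U_def by auto
  have "(\<integral>\<^sup>+x. max_avg p r x ^ k \<partial>D) = (\<integral>\<^sup>+x. ennreal (p x) * max_avg p r x ^ k \<partial>lborel)"
    unfolding D_def by (rule nn_integral_density) measurable
  with r show ?thesis by auto
qed (intro exI[of _ 1], simp)

text \<open>The value infinity at a vanishing minimal average turns finiteness of the integral into
  positivity almost everywhere. Squaring doubles the exponent b.\<close>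

lemma property_L_min_moment:
  assumes L: "property_L p (\<lambda>t. t\<^sup>2) b"
  shows "\<exists>r>0. 0 < b \<longrightarrow> (AE x in D. 0 < enn2real (min_avg p r x)) \<and>
    (\<integral>\<^sup>+x. ennreal (enn2real (min_avg p r x) powr (- (2 * b))) \<partial>D) < \<infinity>"
proof (cases "0 < b")
  case True
  then obtain r where r: "0 < r" "(\<integral>\<^sup>+x. ennreal (p x) * (if min_avg p r x = 0 then \<infinity>
      else ennreal ((enn2real (min_avg p r x) powr (- b))\<^sup>2)) \<partial>lborel) < \<infinity>"
    using L unfolding property_L_def by auto
  let ?h = "\<lambda>x. if min_avg p r x = 0 then \<infinity> else ennreal ((enn2real (min_avg p r x) powr (- b))\<^sup>2)"
  have [measurable]: "?h \<in> borel_measurable borel" by measurable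
  have "(\<integral>\<^sup>+x. ?h x \<partial>D) = (\<integral>\<^sup>+x. ennreal (p x) * ?h x \<partial>lborel)"
    unfolding D_def by (rule nn_integral_density) measurable
  with r have fin: "(\<integral>\<^sup>+x. ?h x \<partial>D) < \<infinity>" by simp
  have "AE x in D. ?h x \<noteq> \<infinity>"
    using fin by (intro nn_integral_PInf_AE) auto
  then have "AE x in D. 0 < enn2real (min_avg p r x)"
  proof eventually_elim
    case (elim x)
    then have "min_avg p r x \<noteq> 0" by auto
    then show ?case
      using min_avg_finite[OF r(1), of x] by (simp add: enn2real_positive_iff zero_less_iff_neq_zero)
  qed
  moreover have "(\<integral>\<^sup>+x. ennreal (enn2real (min_avg p r x) powr (- (2 * b))) \<partial>D) \<le> (\<integral>\<^sup>+x. ?h x \<partial>D)"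
    by (intro nn_integral_mono) (auto simp: power2_eq_square powr_add[symmetric])
  ultimately show ?thesis using r(1) fin by (intro exI[of _ r]) (auto intro: le_less_trans)
qed (intro exI[of _ 1], simp)

text \<open>A finite limsup provides an m whose double integral over pairs farther apart than some R
  is finite. Pairs within R contribute at most the constant \<open>vpow (2 * b) R\<close>.\<close>

lemma property_L_dist_moment:
  assumes L: "property_L p (\<lambda>t. t\<^sup>2) b" and b: "0 < b"
  shows "(\<integral>\<^sup>+x. mean_vpow (2 * b) x \<partial>D) < \<infinity>"
proof -
  let ?v = "\<lambda>r. ball_vol TYPE('a) r"
  let ?J = "\<lambda>R. \<integral>\<^sup>+y. \<integral>\<^sup>+x. ennreal (p x * p y * (?v (norm (x - y)) powr b)\<^sup>2) * indicator {z. norm (z - y) > R} x \<partial>lborel \<partial>lborel"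
  obtain \<kappa> :: "nat \<Rightarrow> real" where lim: "limsup (\<lambda>m. ennreal ((real m powr b)\<^sup>2) * ?J (ball_radius TYPE('a) (\<kappa> m / real m))) < \<infinity>"
    using L b unfolding property_L_def by auto
  have "\<forall>\<^sub>F m in sequentially. ennreal ((real m powr b)\<^sup>2) * ?J (ball_radius TYPE('a) (\<kappa> m / real m)) < \<infinity>"
    using lim by (rule Limsup_lessD)
  from eventually_happens'[OF sequentially_bot eventually_conj[OF this eventually_gt_at_top[of 0]]]
  obtain m :: nat where m: "ennreal ((real m powr b)\<^sup>2) * ?J (ball_radius TYPE('a) (\<kappa> m / real m)) < \<infinity>" "0 < m"
    by blast
  define R where "R = ball_radius TYPE('a) (\<kappa> m / real m)"
  \<comment> \<open>A weight 0 could hide an infinite integral; m > 0 excludes this.\<close>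
  have "ennreal ((real m powr b)\<^sup>2) \<noteq> 0" using m(2) by (simp add: ennreal_eq_0_iff)
  with m(1) have J: "?J R < \<infinity>"
    unfolding R_def by (auto simp: ennreal_mult_less_top)
  have v2: "vpow (2 * b) r = ennreal ((?v r powr b)\<^sup>2)" for r
    by (simp add: vpow_def power2_eq_square powr_add[symmetric])
  have "mean_vpow (2 * b) y \<le> vpow (2 * b) R + (\<integral>\<^sup>+x. vpow (2 * b) (dist x y) * indicator {z. R < norm (z - y)} x \<partial>D)" for y
  proof -
    have "mean_vpow (2 * b) y \<le> (\<integral>\<^sup>+x. vpow (2 * b) R + vpow (2 * b) (dist x y) * indicator {z. R < norm (z - y)} x \<partial>D)"
      unfolding mean_vpow_def
    proof (intro nn_integral_mono)
      fix x
      show "vpow (2 * b) (dist y x) \<le> vpow (2 * b) R + vpow (2 * b) (dist x y) * indicator {z. R < norm (z - y)} x"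
      proof (cases "R < norm (x - y)")
        case False
        then have "vpow (2 * b) (dist y x) \<le> vpow (2 * b) R"
          using b by (intro monoD[OF mono_vpow]) (auto simp: dist_norm norm_minus_commute)
        then show ?thesis by (simp add: add_increasing2)
      qed (simp add: dist_commute add_increasing)
    qed
    also have "\<dots> = vpow (2 * b) R + (\<integral>\<^sup>+x. vpow (2 * b) (dist x y) * indicator {z. R < norm (z - y)} x \<partial>D)"
      by (subst nn_integral_add) auto
    finally show ?thesis .
  qed
  then have "(\<integral>\<^sup>+y. mean_vpow (2 * b) y \<partial>D)
      \<le> (\<integral>\<^sup>+y. vpow (2 * b) R + (\<integral>\<^sup>+x. vpow (2 * b) (dist x y) * indicator {z. R < norm (z - y)} x \<partial>D) \<partial>D)"
    by (rule nn_integral_mono)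
  also have "\<dots> = vpow (2 * b) R + (\<integral>\<^sup>+y. \<integral>\<^sup>+x. vpow (2 * b) (dist x y) * indicator {z. R < norm (z - y)} x \<partial>D \<partial>D)"
  proof -
    have [measurable]: "(\<lambda>y. \<integral>\<^sup>+x. vpow (2 * b) (dist x y) * indicator {z. R < norm (z - y)} x \<partial>D) \<in> borel_measurable borel"
      by measurable
    show ?thesis by (subst nn_integral_add) auto
  qed
  also have "(\<integral>\<^sup>+y. \<integral>\<^sup>+x. vpow (2 * b) (dist x y) * indicator {z. R < norm (z - y)} x \<partial>D \<partial>D) = ?J R"
  proof -
    have inner: "(\<integral>\<^sup>+x. vpow (2 * b) (dist x y) * indicator {z. R < norm (z - y)} x \<partial>D)
      = (\<integral>\<^sup>+x. ennreal (p x) * (vpow (2 * b) (dist x y) * indicator {z. R < norm (z - y)} x) \<partial>lborel)" for y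
      unfolding D_def by (rule nn_integral_density) measurable
    have "(\<integral>\<^sup>+y. \<integral>\<^sup>+x. vpow (2 * b) (dist x y) * indicator {z. R < norm (z - y)} x \<partial>D \<partial>D)
      = (\<integral>\<^sup>+y. ennreal (p y) * (\<integral>\<^sup>+x. ennreal (p x) * (vpow (2 * b) (dist x y) * indicator {z. R < norm (z - y)} x) \<partial>lborel) \<partial>lborel)"
      unfolding inner unfolding D_def by (rule nn_integral_density) measurable
    also have "\<dots> = (\<integral>\<^sup>+y. \<integral>\<^sup>+x. ennreal (p y) * (ennreal (p x) * (vpow (2 * b) (dist x y) * indicator {z. R < norm (z - y)} x)) \<partial>lborel \<partial>lborel)"
      by (intro nn_integral_cong nn_integral_cmult[symmetric]) measurable
    also have "\<dots> = ?J R"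
      using p_nonneg unfolding v2 by (intro nn_integral_cong) (simp add: dist_norm ennreal_mult mult_ac)
    finally show ?thesis .
  qed
  also have "vpow (2 * b) R + ?J R < \<infinity>" using J by (simp add: vpow_def)
  finally show ?thesis .
qed

end

lemma poly_envelope_nonneg: "0 \<le> poly_envelope a b u"
  by (simp add: poly_envelope_def)

text \<open>The product space consists of functions restricted to the index set, and the estimator
  reads no other index.\<close>

lemma T_estimator_restrict: "T_estimator \<phi> k m (\<lambda>i\<in>{1..m}. x i) = T_estimator \<phi> k m x"
proof -
  have "U_stat k m (\<lambda>i\<in>{1..m}. x i) i = U_stat k m x i" if "i \<in> {1..m}" for i
  proof -
    have "(\<lambda>i\<in>{1..m}. x i) ` ({1..m} - {i}) = x ` ({1..m} - {i})"
      by (intro image_cong) auto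
    then show ?thesis using that by (simp add: U_stat_def)
  qed
  then show ?thesis
    unfolding T_estimator_def by (intro arg_cong2[where f="(/)"] sum.cong refl) simp
qed

theorem mainTheorem3:
  fixes M :: "'w measure"
    and X :: "nat \<Rightarrow> 'w \<Rightarrow> 'a::euclidean_space"
    and p :: "'a \<Rightarrow> real"
    and f \<phi> :: "real \<Rightarrow> real"
    and a b :: real
    and k :: nat
  assumes p_borel: "p \<in> borel_measurable borel"
    and p_nonneg: "\<And>x. 0 \<le> p x"
    and p_total: "(\<integral>\<^sup>+ x. ennreal (p x) \<partial>lborel) = 1"
    and prob: "prob_space M"
    and indep: "prob_space.indep_vars M (\<lambda>_. borel) X {1..}"
    and dens: "\<And>i. 1 \<le> i \<Longrightarrow> distributed M lborel (X i) (\<lambda>x. ennreal (p x))"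
    and k_pos: "1 \<le> k"
    and k_gt: "real k > - 2 * a"
    and phi: "estimator_function f k \<phi>"
    and phi_cont: "continuous_on {0<..} \<phi>"
    and phi_bound: "\<exists>C. \<forall>u>0. \<bar>\<phi> u\<bar> \<le> C * poly_envelope a b u"
    and U: "property_U p k a"
    and L: "property_L p (\<lambda>t. t\<^sup>2) b"
  shows "integrable lborel (\<lambda>x. f (p x) * p x) \<and>
    (\<lambda>m. \<integral>\<^sup>+ \<omega>. ennreal ((T_estimator \<phi> k m (\<lambda>i. X i \<omega>) - T_functional f p)\<^sup>2) \<partial>M)
      \<longlonglongrightarrow> 0"
proof -
  interpret M: prob_space M by (rule prob)
  interpret K: knn_density p k
    by unfold_locales (use p_borel p_nonneg p_total k_pos in auto)
  obtain C where C: "\<And>u. 0 < u \<Longrightarrow> \<bar>\<phi> u\<bar> \<le> C * poly_envelope a b u"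
    using phi_bound by blast
  obtain r1 where r1: "0 < r1" "a < 0 \<Longrightarrow> (\<integral>\<^sup>+x. max_avg p r1 x ^ k \<partial>K.D) < \<infinity>"
    using K.property_U_max_moment[OF U] by blast
  obtain r2 where r2: "0 < r2" "0 < b \<Longrightarrow> AE x in K.D. 0 < enn2real (min_avg p r2 x)"
    "0 < b \<Longrightarrow> (\<integral>\<^sup>+x. ennreal (enn2real (min_avg p r2 x) powr (- (2 * b))) \<partial>K.D) < \<infinity>"
    using K.property_L_min_moment[OF L] by blast
  \<comment> \<open>The values of \<phi> off the positive reals are arbitrary; replacing them by 0
    secures measurability, and almost surely all volumes are positive.\<close>
  define \<phi>0 where "\<phi>0 = (\<lambda>u. if 0 < u then \<phi> u else 0)"
  have \<phi>0_eq: "\<phi>0 = (\<lambda>u. indicator {0<..} u *\<^sub>R \<phi> u)"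
    by (auto simp: \<phi>0_def split: split_indicator)
  interpret E: knn_estimator p k \<phi>0 a b "max C 0" r1 r2
  proof unfold_locales
    show "\<phi>0 \<in> borel_measurable borel"
      unfolding \<phi>0_eq by (intro borel_measurable_continuous_on_indicator phi_cont) simp
    show "continuous_on {0<..} \<phi>0"
      using phi_cont by (rule continuous_on_eq) (simp add: \<phi>0_def)
    show "\<bar>\<phi>0 u\<bar> \<le> max C 0 * poly_envelope a b u" if "0 < u" for u
      using C[OF that] mult_right_mono[of C "max C 0", OF _ poly_envelope_nonneg[of a b u]] that
      by (simp add: \<phi>0_def)
  qed (use k_gt r1 r2 K.property_L_dist_moment[OF L] in \<open>auto simp: \<phi>0_def\<close>)
  \<comment> \<open>The Laplace equation speaks of positive arguments; where the density is 0, the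
    factor p x makes both sides 0.\<close>
  have gamma: "E.gamma_expectation (p x) * p x = f (p x) * p x" for x
  proof (cases "p x = 0")
    case False
    then have "0 < p x" using p_nonneg[of x] by simp
    from estimator_function_eq_gamma_expectation[OF phi k_pos this]
    show ?thesis
      unfolding E.gamma_expectation_def by (simp add: \<phi>0_def)
  qed simp
  have T: "T_functional f p = E.T"
    using E.functional_eq_T by (simp add: T_functional_def gamma)
  let ?g = "\<lambda>m w. ennreal (((\<Sum>i\<in>{1..m}. \<phi>0 (K.U m w i)) / real m - E.T)\<^sup>2)"
  have "(\<integral>\<^sup>+ \<omega>. ennreal ((T_estimator \<phi> k m (\<lambda>i. X i \<omega>) - T_functional f p)\<^sup>2) \<partial>M) = (\<integral>\<^sup>+ w. ?g m w \<partial>K.sample {1..m})"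
    if m: "k < m" for m
  proof -
    have "(\<integral>\<^sup>+ \<omega>. ennreal ((T_estimator \<phi> k m (\<lambda>i. X i \<omega>) - T_functional f p)\<^sup>2) \<partial>M)
      = (\<integral>\<^sup>+ \<omega>. ennreal ((T_estimator \<phi> k m (\<lambda>i\<in>{1..m}. X i \<omega>) - E.T)\<^sup>2) \<partial>M)"
      by (simp only: T T_estimator_restrict)
    also have "\<dots> = (\<integral>\<^sup>+ w. ?g m w \<partial>K.sample {1..m})"
    proof (rule M.nn_integral_iid_sample)
      show "{1..m} \<noteq> {}" using m by simp
      show "M.indep_vars (\<lambda>_. borel) X {1..m}"
        using indep by (rule M.indep_vars_subset) auto
      show "distr M borel (X i) = K.D" if "i \<in> {1..m}" for i
      proof -
        have "distr M borel (X i) = distr M lborel (X i)"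
          by (rule distr_cong) auto
        also have "\<dots> = K.D"
          unfolding K.D_def using dens[of i] that by (intro distributed_distr_eq_density) auto
        finally show ?thesis .
      qed
      \<comment> \<open>On samples without repetitions the set-based and the index-based volumes
        coincide and are positive, so \<phi> and its truncation agree there.\<close>
      show "AE w in K.sample {1..m}. ennreal ((T_estimator \<phi> k m w - E.T)\<^sup>2) = ?g m w"
        using K.AE_sample_inj[of m]
      proof eventually_elim
        case (elim w)
        have "(\<Sum>i\<in>{1..m}. \<phi> (U_stat k m w i)) = (\<Sum>i\<in>{1..m}. \<phi>0 (K.U m w i))"
          using K.U_pos[OF m _ elim] K.U_stat_eq_U[OF m _ elim] by (intro sum.cong refl) (simp add: \<phi>0_def)
        then show ?case by (simp only: T_estimator_def)
      qed
      have "(\<lambda>w. \<phi>0 (K.U m w i)) \<in> borel_measurable (K.sample {1..m})" if "i \<in> {1..m}" for i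
        using K.measurable_U[OF m that] E.\<phi>_borel by (rule measurable_compose)
      then show "?g m \<in> borel_measurable (K.sample {1..m})"
        by (intro measurable_compose[OF _ measurable_ennreal] borel_measurable_power borel_measurable_diff
            borel_measurable_divide borel_measurable_sum borel_measurable_const)
    qed
    finally show ?thesis .
  qed
  then have "\<forall>\<^sub>F m in sequentially. (\<integral>\<^sup>+ w. ?g m w \<partial>K.sample {1..m})
      = (\<integral>\<^sup>+ \<omega>. ennreal ((T_estimator \<phi> k m (\<lambda>i. X i \<omega>) - T_functional f p)\<^sup>2) \<partial>M)"
    by (intro eventually_mono[OF eventually_gt_at_top[of k]]) simp
  with E.knn_estimator_L2_consistent
  have "(\<lambda>m. \<integral>\<^sup>+ \<omega>. ennreal ((T_estimator \<phi> k m (\<lambda>i. X i \<omega>) - T_functional f p)\<^sup>2) \<partial>M) \<longlonglongrightarrow> 0"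
    by (rule Lim_transform_eventually)
  moreover have "integrable lborel (\<lambda>x. f (p x) * p x)"
    using E.integrable_functional by (simp only: gamma)
  ultimately show ?thesis by simp
qed

end
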